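(* Let $M$ be a coherent (i.e. finitely generated) $D_n$-module equipped with a good $V_\bullet D_n$-filtration $U_\bullet M$ with respect to a weight $w\in\mathbb{R}^n$ with $w_1=\cdots=w_n>0$. Let $i\colon\mathbb{C}^r\hookrightarrow\mathbb{C}^n$ be $(x_1,\ldots,x_r)\mapsto(x_1,\ldots,x_r,0,\ldots,0)$. If $i$ is non-characteristic for $M$ (in a neighborhood of the origin), then the natural map $$\mathrm{gr}^U(i^*M)\twoheadrightarrow i^*\mathrm{gr}^U(M)$$ is an isomorphism (in a neighborhood of the origin).
   Context: $D_n=\mathbb{C}\langle x_1,\dots,x_n,\partial_1,\dots,\partial_n\rangle$ is the $n$th Weyl algebra. For $w\in\mathbb{R}^n$ and $0\ne P=\sum c_{\alpha\beta}x^\alpha\partial^\beta$, $\mathrm{ord}_{(-w,w)}(P):=\max\{w\cdot(\beta-\alpha):c_{\alpha\beta}\ne0\}$, and $V_kD_n:=\{P : P=0 \text{ or } \mathrm{ord}_{(-w,w)}(P)\le k\}$. For integral $w$ the index $k$ runs over $\mathbb{Z}$ and $\mathrm{gr}_k=V_k/V_{k-1}$; for general real $w$ the index runs over $\mathbb{R}$ and $\mathrm{gr}_k=V_k/V_{<k}$. In either case $\mathrm{gr}^VD_n\cong D_n$. A good filtration $U_\bullet M$ is one of the form $U_kM=\sum_l V_{k-k_l}D_n\cdot m_l$ for finitely many generators $m_l$ of $M$ and indices $k_l$; $\mathrm{gr}^U(M)$ is then a $D_n$-module via $\mathrm{gr}^VD_n\cong D_n$. The restriction along $i$ is the $D_r$-module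 $i^*M=M/\sum_{j=r+1}^n x_jM$, equipped with the filtration $U_\bullet i^*M:=U_\bullet M/\bigl((\sum_{j=r+1}^nx_jM)\cap U_\bullet M\bigr)$, a $V_\bullet D_r$-filtration with respect to $(w_1,\dots,w_r)$. The natural map is the $D_r$-linear surjection induced in each degree $k$ by the identity on $U_kM$, from $\mathrm{gr}^U_k(i^*M)=U_kM/\bigl(U_{<k}M+(\sum_{j>r} x_jM)\cap U_kM\bigr)$ to $i^*\mathrm{gr}^U(M)=\mathrm{gr}^U(M)/\sum_{j>r}x_j\,\mathrm{gr}^U(M)$. The inclusion $i\colon Z\hookrightarrow X$ of a smooth subvariety is non-characteristic for a coherent $\mathcal{D}_X$-module $\mathcal{M}$ if $T^*_ZX\cap\operatorname{Ch}(\mathcal{M})\subseteq T^*_XX$, with $\operatorname{Ch}$ the characteristic variety, $T^*_ZX$ the conormal bundle, $T^*_XX$ the zero section; "in a neighborhood of the origin" means after restriction to some Zariski open neighborhood of $0$. *)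

theory Defs
  imports
    "HOL-Algebra.AbelCoset"
    "HOL-Algebra.Module"
    "HOL-Library.Poly_Mapping"
    "HOL-Library.Product_Plus"
    "HOL.Complex"
begin

section \<open>The Weyl algebra\<close>

abbreviation keys :: "('a \<Rightarrow>\<^sub>0 'b::zero) \<Rightarrow> 'a set" where
  "keys \<equiv> Poly_Mapping.keys"

abbreviation lookup :: "('a \<Rightarrow>\<^sub>0 'b::zero) \<Rightarrow> 'a \<Rightarrow> 'b" where
  "lookup \<equiv> Poly_Mapping.lookup"

type_synonym mindex = "nat \<Rightarrow>\<^sub>0 nat"

definition mindices :: "nat \<Rightarrow> mindex set" where
  "mindices n = {\<alpha>. keys \<alpha> \<subseteq> {1..n}}"

text \<open>
  A finitely supported family of coefficients \<open>c (\<alpha>, \<beta>)\<close> stands for the normally ordered operator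
  \<open>\<Sum> c (\<alpha>, \<beta>) x\<^sup>\<alpha> \<partial>\<^sup>\<beta>\<close>. With this encoding the \<open>r\<close>-th Weyl algebra is literally a subset of the
  \<open>n\<close>-th one for \<open>r \<le> n\<close>. The same data also stands for the commutative polynomial
  \<open>\<Sum> c (\<alpha>, \<beta>) x\<^sup>\<alpha> \<xi>\<^sup>\<beta>\<close>.
\<close>

type_synonym weyl_elem = "mindex \<times> mindex \<Rightarrow>\<^sub>0 complex"

text \<open>
  The product is given by the Leibniz formula
  \<open>x\<^sup>\<alpha> \<partial>\<^sup>\<beta> x\<^sup>\<gamma> \<partial>\<^sup>\<delta> = (\<Sum>\<kappa> \<le> \<beta>, \<gamma>. \<kappa>! (\<beta> choose \<kappa>) (\<gamma> choose \<kappa>) x\<^sup>\<alpha>\<^sup>+\<^sup>\<gamma>\<^sup>-\<^sup>\<kappa> \<partial>\<^sup>\<beta>\<^sup>-\<^sup>\<kappa>\<^sup>+\<^sup>\<delta>)\<close>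
  with multi-index factorials and binomial coefficients.
\<close>

definition weyl_monom_mult ::
  "mindex \<times> mindex \<Rightarrow> mindex \<times> mindex \<Rightarrow> complex \<Rightarrow> weyl_elem" where
  "weyl_monom_mult p q c =
     (\<Sum>\<kappa> | \<forall>i. lookup \<kappa> i \<le> lookup (snd p) i \<and> lookup \<kappa> i \<le> lookup (fst q) i.
        Poly_Mapping.single (fst p + (fst q - \<kappa>), (snd p - \<kappa>) + snd q)
          (c * of_nat (\<Prod>i\<in>keys \<kappa>. fact (lookup \<kappa> i)
                  * (lookup (snd p) i choose lookup \<kappa> i)
                  * (lookup (fst q) i choose lookup \<kappa> i))))"

definition weyl_mult :: "weyl_elem \<Rightarrow> weyl_elem \<Rightarrow> weyl_elem" where
  "weyl_mult P Q =
     (\<Sum>p\<in>keys P. \<Sum>q\<in>keys Q. weyl_monom_mult p q (lookup P p * lookup Q q))"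

definition weyl :: "nat \<Rightarrow> weyl_elem ring" where
  "weyl n = \<lparr>carrier = {P. keys P \<subseteq> mindices n \<times> mindices n},
     monoid.mult = weyl_mult, one = Poly_Mapping.single 0 1, zero = 0, add = (+)\<rparr>"

definition xvar :: "nat \<Rightarrow> weyl_elem" where
  "xvar j = Poly_Mapping.single (Poly_Mapping.single j 1, 0) 1"

definition dvar :: "nat \<Rightarrow> weyl_elem" where
  "dvar j = Poly_Mapping.single (0, Poly_Mapping.single j 1) 1"

definition polys :: "nat \<Rightarrow> weyl_elem set" where
  "polys n = {f. keys f \<subseteq> mindices n \<times> {0}}"

text \<open>The value at \<open>(a, \<xi>)\<close> of the commutative polynomial with the given coefficients.\<close>

definition symbol_eval :: "weyl_elem \<Rightarrow> (nat \<Rightarrow> complex) \<Rightarrow> (nat \<Rightarrow> complex) \<Rightarrow> complex" where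
  "symbol_eval p a \<xi> = (\<Sum>m\<in>keys p. lookup p m
     * (\<Prod>i\<in>keys (fst m). a i ^ lookup (fst m) i) * (\<Prod>i\<in>keys (snd m). \<xi> i ^ lookup (snd m) i))"

definition poly_eval :: "weyl_elem \<Rightarrow> (nat \<Rightarrow> complex) \<Rightarrow> complex" where
  "poly_eval f a = symbol_eval f a (\<lambda>_. 0)"


section \<open>Left modules\<close>

text \<open>
  The library's \<open>module\<close> locale requires a commutative ring; only its record type is used here.
  The multiplicative fields of that record carry no meaning for modules.
\<close>

locale left_module = R?: ring R + M?: abelian_group M
  for R :: "('a, 'b) ring_scheme" (structure) and M :: "('a, 'm, 'c) module_scheme" (structure) +
  assumes smult_closed: "\<lbrakk>a \<in> carrier R; x \<in> carrier M\<rbrakk> \<Longrightarrow> a \<odot>\<^bsub>M\<^esub> x \<in> carrier M"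
    and smult_l_distr: "\<lbrakk>a \<in> carrier R; b \<in> carrier R; x \<in> carrier M\<rbrakk>
      \<Longrightarrow> (a \<oplus>\<^bsub>R\<^esub> b) \<odot>\<^bsub>M\<^esub> x = a \<odot>\<^bsub>M\<^esub> x \<oplus>\<^bsub>M\<^esub> b \<odot>\<^bsub>M\<^esub> x"
    and smult_r_distr: "\<lbrakk>a \<in> carrier R; x \<in> carrier M; y \<in> carrier M\<rbrakk>
      \<Longrightarrow> a \<odot>\<^bsub>M\<^esub> (x \<oplus>\<^bsub>M\<^esub> y) = a \<odot>\<^bsub>M\<^esub> x \<oplus>\<^bsub>M\<^esub> a \<odot>\<^bsub>M\<^esub> y"
    and smult_assoc: "\<lbrakk>a \<in> carrier R; b \<in> carrier R; x \<in> carrier M\<rbrakk>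
      \<Longrightarrow> (a \<otimes>\<^bsub>R\<^esub> b) \<odot>\<^bsub>M\<^esub> x = a \<odot>\<^bsub>M\<^esub> (b \<odot>\<^bsub>M\<^esub> x)"
    and smult_one: "x \<in> carrier M \<Longrightarrow> \<one>\<^bsub>R\<^esub> \<odot>\<^bsub>M\<^esub> x = x"

definition lmod_iso ::
  "('a, 'b) ring_scheme \<Rightarrow> ('a, 'm) module \<Rightarrow> ('a, 'n) module \<Rightarrow> ('m \<Rightarrow> 'n) set" where
  "lmod_iso R M N = {\<phi>. bij_betw \<phi> (carrier M) (carrier N)
     \<and> (\<forall>x\<in>carrier M. \<forall>y\<in>carrier M. \<phi> (x \<oplus>\<^bsub>M\<^esub> y) = \<phi> x \<oplus>\<^bsub>N\<^esub> \<phi> y)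
     \<and> (\<forall>a\<in>carrier R. \<forall>x\<in>carrier M. \<phi> (a \<odot>\<^bsub>M\<^esub> x) = a \<odot>\<^bsub>N\<^esub> \<phi> x)}"

definition lmod_generates ::
  "('a, 'b) ring_scheme \<Rightarrow> ('a, 'm) module \<Rightarrow> nat \<Rightarrow> (nat \<Rightarrow> 'm) \<Rightarrow> bool" where
  "lmod_generates R M s m \<longleftrightarrow> m \<in> {..<s} \<rightarrow> carrier M \<and>
     carrier M = {\<Oplus>\<^bsub>M\<^esub>l\<in>{..<s}. P l \<odot>\<^bsub>M\<^esub> m l | P. P \<in> {..<s} \<rightarrow> carrier R}"

definition lmod_fin_gen :: "('a, 'b) ring_scheme \<Rightarrow> ('a, 'm) module \<Rightarrow> bool" where
  "lmod_fin_gen R M \<longleftrightarrow> (\<exists>s m. lmod_generates R M s m)"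


section \<open>Filtrations defined by weights\<close>

text \<open>
  A weight \<open>(u, v)\<close> gives \<open>x\<^sub>i\<close> degree \<open>u i\<close> and \<open>\<partial>\<^sub>i\<close> degree \<open>v i\<close>. The \<open>V\<close>-filtration for \<open>w\<close> is
  the case \<open>(u, v) = (-w, w)\<close>, the order filtration is the case \<open>(u, v) = (0, 1)\<close>.
\<close>

type_synonym weight = "(nat \<Rightarrow> real) \<times> (nat \<Rightarrow> real)"

definition V_weight :: "(nat \<Rightarrow> real) \<Rightarrow> weight" where
  "V_weight w = ((\<lambda>i. - w i), w)"

definition order_weight :: weight where
  "order_weight = ((\<lambda>_. 0), (\<lambda>_. 1))"

definition monom_weight :: "nat \<Rightarrow> weight \<Rightarrow> mindex \<times> mindex \<Rightarrow> real" where
  "monom_weight n uv p =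
     (\<Sum>i=1..n. fst uv i * real (lookup (fst p) i) + snd uv i * real (lookup (snd p) i))"

definition weyl_ord :: "nat \<Rightarrow> weight \<Rightarrow> weyl_elem \<Rightarrow> real" where
  "weyl_ord n uv P = Max (monom_weight n uv ` keys P)"

definition weyl_filt :: "nat \<Rightarrow> weight \<Rightarrow> real \<Rightarrow> weyl_elem set" where
  "weyl_filt n uv k = {P \<in> carrier (weyl n). P = 0 \<or> weyl_ord n uv P \<le> k}"

definition weyl_comp :: "nat \<Rightarrow> weight \<Rightarrow> real \<Rightarrow> weyl_elem \<Rightarrow> weyl_elem" where
  "weyl_comp n uv d P =
     (\<Sum>p | p \<in> keys P \<and> monom_weight n uv p = d. Poly_Mapping.single p (lookup P p))"

text \<open>
  \<open>\<Gamma>\<close> is the set in which the degrees of the generators may lie: the integers for integral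
  weights, all reals in general. In either case the filtration is regarded as a function of a
  real index; when \<open>\<Gamma>\<close> is the set of integers and the weight is integral it is constant on
  each interval from \<open>k\<close> (included) to \<open>k + 1\<close> (excluded), \<open>k\<close> an integer.
\<close>

definition good_filtration ::
  "real set \<Rightarrow> nat \<Rightarrow> weight \<Rightarrow> (weyl_elem, 'm) module \<Rightarrow> (real \<Rightarrow> 'm set) \<Rightarrow> bool" where
  "good_filtration \<Gamma> n uv M U \<longleftrightarrow> (\<exists>s m \<kappa>. lmod_generates (weyl n) M s m \<and> \<kappa> \<in> {..<s} \<rightarrow> \<Gamma> \<and>
     (\<forall>k. U k = {\<Oplus>\<^bsub>M\<^esub>l\<in>{..<s}. P l \<odot>\<^bsub>M\<^esub> m l | P. \<forall>l<s. P l \<in> weyl_filt n uv (k - \<kappa> l)}))"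

definition filt_less :: "(real \<Rightarrow> 'm set) \<Rightarrow> real \<Rightarrow> 'm set" where
  "filt_less U k = (\<Union>j\<in>{..<k}. U j)"

text \<open>
  The associated graded module, the direct sum over \<open>k\<close> of \<open>U k / filt_less U k\<close>. A coefficient
  family \<open>P\<close> acts through its homogeneous components: the component of degree \<open>d\<close> maps the class
  of \<open>u\<close> in degree \<open>k - d\<close> to the class in degree \<open>k\<close> of the operator with these coefficients applied
  to \<open>u\<close>. Since \<open>x\<^sub>i\<close> and \<open>\<partial>\<^sub>i\<close> have opposite degrees for the \<open>V\<close>-filtration, the associated graded
  ring is the Weyl algebra again in that case; for the order filtration it is the polynomial ring
  in \<open>x\<close> and \<open>\<xi>\<close>.
\<close>

definition gr_smult ::
  "nat \<Rightarrow> weight \<Rightarrow> (weyl_elem, 'm) module \<Rightarrow> (real \<Rightarrow> 'm set)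
    \<Rightarrow> weyl_elem \<Rightarrow> (real \<Rightarrow> 'm set) \<Rightarrow> (real \<Rightarrow> 'm set)" where
  "gr_smult n uv M U P g = (\<lambda>k.
     let degs = monom_weight n uv ` keys P in
     \<Union>u\<in>(\<Pi> d\<in>degs. g (k - d)).
       filt_less U k +>\<^bsub>M\<^esub> (\<Oplus>\<^bsub>M\<^esub>d\<in>degs. weyl_comp n uv d P \<odot>\<^bsub>M\<^esub> u d))"

definition gr_module ::
  "nat \<Rightarrow> weight \<Rightarrow> (weyl_elem, 'm) module \<Rightarrow> (real \<Rightarrow> 'm set)
    \<Rightarrow> (weyl_elem, real \<Rightarrow> 'm set) module" where
  "gr_module n uv M U = \<lparr>
     carrier = {g. (\<forall>k. g k \<in> (\<lambda>u. filt_less U k +>\<^bsub>M\<^esub> u) ` U k)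
                 \<and> finite {k. g k \<noteq> filt_less U k}},
     monoid.mult = undefined, one = undefined,
     zero = filt_less U, add = (\<lambda>g h k. g k <+>\<^bsub>M\<^esub> h k),
     smult = gr_smult n uv M U\<rparr>"

definition gr_class ::
  "(weyl_elem, 'm) module \<Rightarrow> (real \<Rightarrow> 'm set) \<Rightarrow> real \<Rightarrow> 'm \<Rightarrow> (real \<Rightarrow> 'm set)" where
  "gr_class M U k u = (filt_less U)(k := filt_less U k +>\<^bsub>M\<^esub> u)"


section \<open>Characteristic variety\<close>

definition affine_space :: "nat \<Rightarrow> (nat \<Rightarrow> complex) set" where
  "affine_space n = {a. \<forall>i. i \<notin> {1..n} \<longrightarrow> a i = 0}"

text \<open>
  The zero set of the annihilator of \<open>gr M\<close> in the polynomial ring, for a good filtration of \<open>M\<close>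
  with respect to the order filtration. It does not depend on the choice of the filtration.
\<close>

definition char_variety ::
  "nat \<Rightarrow> (weyl_elem, 'm) module \<Rightarrow> ((nat \<Rightarrow> complex) \<times> (nat \<Rightarrow> complex)) set" where
  "char_variety n M =
     (let F = (SOME F. good_filtration \<int> n order_weight M F);
          G = gr_module n order_weight M F
      in {(a, \<xi>) \<in> affine_space n \<times> affine_space n.
           \<forall>p\<in>carrier (weyl n). (\<forall>g\<in>carrier G. p \<odot>\<^bsub>G\<^esub> g = \<zero>\<^bsub>G\<^esub>) \<longrightarrow> symbol_eval p a \<xi> = 0})"

definition conormal :: "nat \<Rightarrow> nat \<Rightarrow> ((nat \<Rightarrow> complex) \<times> (nat \<Rightarrow> complex)) set" where
  "conormal r n = {(a, \<xi>) \<in> affine_space n \<times> affine_space n.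
     (\<forall>j\<in>{r+1..n}. a j = 0) \<and> (\<forall>j\<in>{1..r}. \<xi> j = 0)}"

definition zero_section :: "nat \<Rightarrow> ((nat \<Rightarrow> complex) \<times> (nat \<Rightarrow> complex)) set" where
  "zero_section n = {(a, \<xi>). a \<in> affine_space n \<and> \<xi> = (\<lambda>_. 0)}"

text \<open>
  The sets \<open>f \<noteq> 0\<close> with \<open>f\<close> a polynomial not vanishing at the origin form a basis of the Zariski
  neighborhoods of the origin, and over \<open>f \<noteq> 0\<close> the characteristic variety of the restricted
  module is the restriction of the characteristic variety.
\<close>

definition noncharacteristic_near_origin :: "nat \<Rightarrow> nat \<Rightarrow> (weyl_elem, 'm) module \<Rightarrow> bool" where
  "noncharacteristic_near_origin r n M \<longleftrightarrow> (\<exists>f\<in>polys n. poly_eval f (\<lambda>_. 0) \<noteq> 0 \<and>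
     conormal r n \<inter> char_variety n M \<inter> {(a, \<xi>). poly_eval f a \<noteq> 0} \<subseteq> zero_section n)"


section \<open>Restriction\<close>

definition restr_sub :: "nat \<Rightarrow> nat \<Rightarrow> (weyl_elem, 'm) module \<Rightarrow> 'm set" where
  "restr_sub r n M =
     {\<Oplus>\<^bsub>M\<^esub>j\<in>{r+1..n}. xvar j \<odot>\<^bsub>M\<^esub> m j | m. m \<in> {r+1..n} \<rightarrow> carrier M}"

definition restr_class :: "nat \<Rightarrow> nat \<Rightarrow> (weyl_elem, 'm) module \<Rightarrow> 'm \<Rightarrow> 'm set" where
  "restr_class r n M x = restr_sub r n M +>\<^bsub>M\<^esub> x"

definition restriction ::
  "nat \<Rightarrow> nat \<Rightarrow> (weyl_elem, 'm) module \<Rightarrow> (weyl_elem, 'm set) module" where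
  "restriction r n M = \<lparr>
     carrier = restr_class r n M ` carrier M,
     monoid.mult = undefined, one = undefined,
     zero = restr_sub r n M, add = (\<lambda>C D. C <+>\<^bsub>M\<^esub> D),
     smult = (\<lambda>P C. \<Union>x\<in>C. restr_class r n M (P \<odot>\<^bsub>M\<^esub> x))\<rparr>"

text \<open>
  The quotient of \<open>U k\<close> by its intersection with \<open>restr_sub r n M\<close> is identified with its image in
  the restriction.
\<close>

definition restr_filt ::
  "nat \<Rightarrow> nat \<Rightarrow> (weyl_elem, 'm) module \<Rightarrow> (real \<Rightarrow> 'm set) \<Rightarrow> (real \<Rightarrow> 'm set set)" where
  "restr_filt r n M U k = restr_class r n M ` U k"

definition gr_restriction ::
  "nat \<Rightarrow> nat \<Rightarrow> (nat \<Rightarrow> real) \<Rightarrow> (weyl_elem, 'm) module \<Rightarrow> (real \<Rightarrow> 'm set)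
    \<Rightarrow> (weyl_elem, real \<Rightarrow> 'm set set) module" where
  "gr_restriction r n w M U =
     gr_module r (V_weight w) (restriction r n M) (restr_filt r n M U)"

definition restriction_gr ::
  "nat \<Rightarrow> nat \<Rightarrow> (nat \<Rightarrow> real) \<Rightarrow> (weyl_elem, 'm) module \<Rightarrow> (real \<Rightarrow> 'm set)
    \<Rightarrow> (weyl_elem, (real \<Rightarrow> 'm set) set) module" where
  "restriction_gr r n w M U = restriction r n (gr_module n (V_weight w) M U)"

text \<open>The classes of an element \<open>u\<close> of \<open>U k\<close>, placed in degree \<open>k\<close>, in these two modules.\<close>

definition gr_restriction_class ::
  "nat \<Rightarrow> nat \<Rightarrow> (weyl_elem, 'm) module \<Rightarrow> (real \<Rightarrow> 'm set)
    \<Rightarrow> real \<Rightarrow> 'm \<Rightarrow> (real \<Rightarrow> 'm set set)" where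
  "gr_restriction_class r n M U k u =
     gr_class (restriction r n M) (restr_filt r n M U) k (restr_class r n M u)"

definition restriction_gr_class ::
  "nat \<Rightarrow> nat \<Rightarrow> (nat \<Rightarrow> real) \<Rightarrow> (weyl_elem, 'm) module \<Rightarrow> (real \<Rightarrow> 'm set)
    \<Rightarrow> real \<Rightarrow> 'm \<Rightarrow> (real \<Rightarrow> 'm set) set" where
  "restriction_gr_class r n w M U k u =
     restr_class r n (gr_module n (V_weight w) M U) (gr_class M U k u)"


section \<open>Localization\<close>

text \<open>
  \<open>frac_class r f A a k\<close> is the fraction \<open>f\<^sup>-\<^sup>k a\<close> in the localization of the \<open>weyl r\<close>-module \<open>A\<close> at
  the powers of the polynomial \<open>f\<close>, that is, on the open set \<open>f \<noteq> 0\<close>. An operator \<open>P\<close> acts by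
  \<open>P (f\<^sup>-\<^sup>k a) = f\<^sup>-\<^sup>l (Q a)\<close> for any \<open>Q\<close> and \<open>l\<close> with \<open>f\<^sup>l P = Q f\<^sup>k\<close>.
\<close>

definition frac_class ::
  "nat \<Rightarrow> weyl_elem \<Rightarrow> (weyl_elem, 'm) module \<Rightarrow> 'm \<Rightarrow> nat \<Rightarrow> ('m \<times> nat) set" where
  "frac_class r f A a k = {(b, l). b \<in> carrier A \<and>
     (\<exists>i::nat. (f [^]\<^bsub>weyl r\<^esub> (i + l)) \<odot>\<^bsub>A\<^esub> a = (f [^]\<^bsub>weyl r\<^esub> (i + k)) \<odot>\<^bsub>A\<^esub> b)}"

definition localization ::
  "nat \<Rightarrow> weyl_elem \<Rightarrow> (weyl_elem, 'm) module \<Rightarrow> (weyl_elem, ('m \<times> nat) set) module" where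
  "localization r f A = \<lparr>
     carrier = {frac_class r f A a k | a k. a \<in> carrier A},
     monoid.mult = undefined, one = undefined,
     zero = frac_class r f A \<zero>\<^bsub>A\<^esub> 0,
     add = (\<lambda>C D. \<Union>(a, k)\<in>C. \<Union>(b, l)\<in>D. frac_class r f A
       ((f [^]\<^bsub>weyl r\<^esub> l) \<odot>\<^bsub>A\<^esub> a \<oplus>\<^bsub>A\<^esub> (f [^]\<^bsub>weyl r\<^esub> k) \<odot>\<^bsub>A\<^esub> b) (k + l)),
     smult = (\<lambda>P C. \<Union>(a, k)\<in>C. \<Union>(Q, l)\<in>{(Q, l). Q \<in> carrier (weyl r) \<and>
         (f [^]\<^bsub>weyl r\<^esub> l) \<otimes>\<^bsub>weyl r\<^esub> P = Q \<otimes>\<^bsub>weyl r\<^esub> (f [^]\<^bsub>weyl r\<^esub> k)}.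
       frac_class r f A (Q \<odot>\<^bsub>A\<^esub> a) l)\<rparr>"


section \<open>The natural map near the origin\<close>

text \<open>
  The identity maps of the \<open>U k\<close> induce, over some neighborhood \<open>f \<noteq> 0\<close> of the origin, a well-defined
  isomorphism of \<open>weyl r\<close>-modules from \<open>gr (i\<^sup>* M)\<close> to \<open>i\<^sup>* (gr M)\<close>. Every element of the localized
  module is a fraction whose numerator is a sum of classes of elements of the \<open>U k\<close>, so the
  condition on \<open>\<phi>\<close> determines it uniquely. That the identity of \<open>U k\<close> passes to the quotients in
  this direction is part of the assertion: it amounts to the injectivity of the surjection from
  \<open>i\<^sup>* (gr M)\<close> to \<open>gr (i\<^sup>* M)\<close>, which always exists.
\<close>

definition natural_map_iso_near_origin ::
  "nat \<Rightarrow> nat \<Rightarrow> (nat \<Rightarrow> real) \<Rightarrow> (weyl_elem, 'm) module \<Rightarrow> (real \<Rightarrow> 'm set) \<Rightarrow> bool" where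
  "natural_map_iso_near_origin r n w M U \<longleftrightarrow>
     (\<exists>f\<in>polys r. poly_eval f (\<lambda>_. 0) \<noteq> 0 \<and>
       (\<exists>\<phi>\<in>lmod_iso (weyl r)
              (localization r f (gr_restriction r n w M U))
              (localization r f (restriction_gr r n w M U)).
         \<forall>k. \<forall>u\<in>U k.
           \<phi> (frac_class r f (gr_restriction r n w M U) (gr_restriction_class r n M U k u) 0)
           = frac_class r f (restriction_gr r n w M U) (restriction_gr_class r n w M U k u) 0))"


section \<open>Ring axioms and commutation relations of the Weyl algebra\<close>

lemma weyl_monom_mult_add: "weyl_monom_mult p q (c + d) = weyl_monom_mult p q c + weyl_monom_mult p q d"
  by (simp add: weyl_monom_mult_def distrib_right single_add sum.distrib)

lemma weyl_monom_mult_0: "weyl_monom_mult p q 0 = 0"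
  by (simp add: weyl_monom_mult_def)

lemma weyl_mult_eq_sum:
  assumes "finite S" "keys P \<subseteq> S" "finite T" "keys Q \<subseteq> T"
  shows "weyl_mult P Q = (\<Sum>p\<in>S. \<Sum>q\<in>T. weyl_monom_mult p q (lookup P p * lookup Q q))"
proof -
  have "weyl_mult P Q = (\<Sum>p\<in>keys P. \<Sum>q\<in>T. weyl_monom_mult p q (lookup P p * lookup Q q))"
    unfolding weyl_mult_def using assms
    by (intro sum.cong refl sum.mono_neutral_left) (auto simp: in_keys_iff weyl_monom_mult_0)
  also have "\<dots> = (\<Sum>p\<in>S. \<Sum>q\<in>T. weyl_monom_mult p q (lookup P p * lookup Q q))"
    using assms by (intro sum.mono_neutral_left) (auto simp: in_keys_iff weyl_monom_mult_0)
  finally show ?thesis .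
qed

lemma weyl_mult_add_left: "weyl_mult (P + P') Q = weyl_mult P Q + weyl_mult P' Q"
proof -
  let ?S = "keys P \<union> keys P'"
  have "keys (P + P') \<subseteq> ?S" by (rule Poly_Mapping.keys_add)
  then show ?thesis
    using weyl_mult_eq_sum[of ?S "P + P'" "keys Q" Q] weyl_mult_eq_sum[of ?S P "keys Q" Q]
      weyl_mult_eq_sum[of ?S P' "keys Q" Q]
    by (simp add: lookup_add distrib_right weyl_monom_mult_add sum.distrib)
qed

lemma weyl_mult_add_right: "weyl_mult P (Q + Q') = weyl_mult P Q + weyl_mult P Q'"
proof -
  let ?S = "keys Q \<union> keys Q'"
  have "keys (Q + Q') \<subseteq> ?S" by (rule Poly_Mapping.keys_add)
  then show ?thesis
    using weyl_mult_eq_sum[of "keys P" P ?S "Q + Q'"] weyl_mult_eq_sum[of "keys P" P ?S Q]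
      weyl_mult_eq_sum[of "keys P" P ?S Q']
    by (simp add: lookup_add distrib_left weyl_monom_mult_add sum.distrib)
qed

lemma weyl_mult_0: "weyl_mult 0 Q = 0" "weyl_mult P 0 = 0"
  by (simp_all add: weyl_mult_def)

lemma weyl_mult_sum_left: "weyl_mult (sum f S) Q = (\<Sum>s\<in>S. weyl_mult (f s) Q)"
  by (induction S rule: infinite_finite_induct) (simp_all add: weyl_mult_0 weyl_mult_add_left)

lemma weyl_mult_sum_right: "weyl_mult P (sum f S) = (\<Sum>s\<in>S. weyl_mult P (f s))"
  by (induction S rule: infinite_finite_induct) (simp_all add: weyl_mult_0 weyl_mult_add_right)

lemma weyl_mult_single:
  "weyl_mult (Poly_Mapping.single p c) (Poly_Mapping.single q d) = weyl_monom_mult p q (c * d)"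
  by (subst weyl_mult_eq_sum[of "{p}" _ "{q}"]) (auto simp: in_keys_iff lookup_single)

lemma single_sum: "Poly_Mapping.single k (\<Sum>s\<in>S. h s :: complex) = (\<Sum>s\<in>S. Poly_Mapping.single k (h s))"
  by (induction S rule: infinite_finite_induct) (simp_all add: single_add)

lemma poly_mapping_sum_single: "(P::'a \<Rightarrow>\<^sub>0 complex) = (\<Sum>p\<in>keys P. Poly_Mapping.single p (lookup P p))"
  by (rule poly_mapping_eqI) (auto simp: lookup_sum lookup_single when_def in_keys_iff sum.If_cases)

lemma additive_eq:
  fixes F G :: "('a \<Rightarrow>\<^sub>0 complex) \<Rightarrow> 'b :: comm_monoid_add"
  assumes F: "\<And>h (S :: 'a set). F (sum h S) = (\<Sum>s\<in>S. F (h s))"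
    and G: "\<And>h (S :: 'a set). G (sum h S) = (\<Sum>s\<in>S. G (h s))"
    and FG: "\<And>p c. F (Poly_Mapping.single p c) = G (Poly_Mapping.single p c)"
  shows "F P = G P"
proof -
  have "F P = F (\<Sum>p\<in>keys P. Poly_Mapping.single p (lookup P p))"
    by (rule arg_cong[OF poly_mapping_sum_single])
  also have "\<dots> = G (\<Sum>p\<in>keys P. Poly_Mapping.single p (lookup P p))"
    unfolding F G FG ..
  also have "\<dots> = G P"
    by (rule arg_cong[OF poly_mapping_sum_single[symmetric]])
  finally show ?thesis .
qed

text \<open>
  Associativity is obtained from the faithful action on polynomials,
  \<open>x\<^sup>\<alpha> \<partial>\<^sup>\<beta> x\<^sup>\<mu> = \<beta>! (\<mu> choose \<beta>) x\<^sup>\<alpha>\<^sup>+\<^sup>\<mu>\<^sup>-\<^sup>\<beta>\<close>.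
\<close>

definition falling :: "nat \<Rightarrow> nat \<Rightarrow> nat" where "falling b m = fact b * (m choose b)"
definition multi_falling :: "mindex \<Rightarrow> mindex \<Rightarrow> nat" where
  "multi_falling \<beta> \<mu> = (\<Prod>i\<in>keys \<beta>. falling (lookup \<beta> i) (lookup \<mu> i))"

lemma multi_falling_superset: "finite S \<Longrightarrow> keys \<beta> \<subseteq> S \<Longrightarrow> multi_falling \<beta> \<mu> = (\<Prod>i\<in>S. falling (lookup \<beta> i) (lookup \<mu> i))"
  unfolding multi_falling_def by (intro prod.mono_neutral_left) (auto simp: in_keys_iff falling_def)

definition weyl_act_monom :: "mindex \<times> mindex \<Rightarrow> mindex \<Rightarrow> complex \<Rightarrow> mindex \<Rightarrow>\<^sub>0 complex" where
  "weyl_act_monom p \<mu> c = Poly_Mapping.single (fst p + (\<mu> - snd p)) (c * of_nat (multi_falling (snd p) \<mu>))"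

definition weyl_act :: "weyl_elem \<Rightarrow> (mindex \<Rightarrow>\<^sub>0 complex) \<Rightarrow> mindex \<Rightarrow>\<^sub>0 complex" where
  "weyl_act P f = (\<Sum>p\<in>keys P. \<Sum>\<mu>\<in>keys f. weyl_act_monom p \<mu> (lookup P p * lookup f \<mu>))"

lemma weyl_act_monom_add: "weyl_act_monom p q (c + d) = weyl_act_monom p q c + weyl_act_monom p q d"
  by (simp add: weyl_act_monom_def distrib_right single_add)

lemma weyl_act_monom_0: "weyl_act_monom p q 0 = 0"
  by (simp add: weyl_act_monom_def)

lemma weyl_act_eq_sum:
  assumes "finite S" "keys P \<subseteq> S" "finite T" "keys Q \<subseteq> T"
  shows "weyl_act P Q = (\<Sum>p\<in>S. \<Sum>q\<in>T. weyl_act_monom p q (lookup P p * lookup Q q))"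
proof -
  have "weyl_act P Q = (\<Sum>p\<in>keys P. \<Sum>q\<in>T. weyl_act_monom p q (lookup P p * lookup Q q))"
    unfolding weyl_act_def using assms
    by (intro sum.cong refl sum.mono_neutral_left) (auto simp: in_keys_iff weyl_act_monom_0)
  also have "\<dots> = (\<Sum>p\<in>S. \<Sum>q\<in>T. weyl_act_monom p q (lookup P p * lookup Q q))"
    using assms by (intro sum.mono_neutral_left) (auto simp: in_keys_iff weyl_act_monom_0)
  finally show ?thesis .
qed

lemma weyl_act_add_left: "weyl_act (P + P') Q = weyl_act P Q + weyl_act P' Q"
proof -
  let ?S = "keys P \<union> keys P'"
  have "keys (P + P') \<subseteq> ?S" by (rule Poly_Mapping.keys_add)
  then show ?thesis
    using weyl_act_eq_sum[of ?S "P + P'" "keys Q" Q] weyl_act_eq_sum[of ?S P "keys Q" Q]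
      weyl_act_eq_sum[of ?S P' "keys Q" Q]
    by (simp add: lookup_add distrib_right weyl_act_monom_add sum.distrib)
qed

lemma weyl_act_add_right: "weyl_act P (Q + Q') = weyl_act P Q + weyl_act P Q'"
proof -
  let ?S = "keys Q \<union> keys Q'"
  have "keys (Q + Q') \<subseteq> ?S" by (rule Poly_Mapping.keys_add)
  then show ?thesis
    using weyl_act_eq_sum[of "keys P" P ?S "Q + Q'"] weyl_act_eq_sum[of "keys P" P ?S Q]
      weyl_act_eq_sum[of "keys P" P ?S Q']
    by (simp add: lookup_add distrib_left weyl_act_monom_add sum.distrib)
qed

lemma weyl_act_0: "weyl_act 0 Q = 0" "weyl_act P 0 = 0"
  by (simp_all add: weyl_act_def)

lemma weyl_act_sum_left: "weyl_act (sum f S) Q = (\<Sum>s\<in>S. weyl_act (f s) Q)"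
  by (induction S rule: infinite_finite_induct) (simp_all add: weyl_act_0 weyl_act_add_left)

lemma weyl_act_sum_right: "weyl_act P (sum f S) = (\<Sum>s\<in>S. weyl_act P (f s))"
  by (induction S rule: infinite_finite_induct) (simp_all add: weyl_act_0 weyl_act_add_right)

lemma weyl_act_single:
  "weyl_act (Poly_Mapping.single p c) (Poly_Mapping.single q d) = weyl_act_monom p q (c * d)"
  by (subst weyl_act_eq_sum[of "{p}" _ "{q}"]) (auto simp: in_keys_iff lookup_single)

lemma falling_split: "falling d m * falling e (m - d) = falling (e + d) m"
proof (cases "e + d \<le> m")
  case True
  then have "fact (m - d) * falling d m = fact m"
    using binomial_fact_lemma[of d m] by (simp add: falling_def mult_ac)
  moreover have "fact (m - d - e) * falling e (m - d) = fact (m - d)"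
    using binomial_fact_lemma[of e "m - d"] True by (simp add: falling_def mult_ac)
  moreover have "fact (m - d - e) * falling (e + d) m = fact m"
    using binomial_fact_lemma[of "e + d" m] True by (simp add: falling_def mult_ac add.commute)
  ultimately have "fact (m - d - e) * (falling d m * falling e (m - d)) = fact (m - d - e) * falling (e + d) m"
    by (metis mult.assoc mult.commute)
  then show ?thesis by simp
next
  case False
  then have "m choose d = 0 \<or> m - d choose e = 0" "m choose (e + d) = 0"
    by (auto simp: binomial_eq_0_iff)
  then show ?thesis unfolding falling_def by (metis mult_zero_left mult_zero_right)
qed

lemma falling_vandermonde:
  "falling b (g + v) = (\<Sum>k\<le>min b g. fact k * (b choose k) * (g choose k) * falling (b - k) v)"
proof -
  have "falling b (g + v) = (\<Sum>k\<le>b. fact b * ((g choose k) * (v choose (b - k))))"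
    unfolding falling_def vandermonde[symmetric] by (simp add: sum_distrib_left)
  also have "\<dots> = (\<Sum>k\<le>b. fact k * (b choose k) * (g choose k) * falling (b - k) v)"
  proof (rule sum.cong)
    fix k assume "k \<in> {..b}"
    then have "fact k * fact (b - k) * (b choose k) = (fact b :: nat)"
      using binomial_fact_lemma by simp
    then show "fact b * ((g choose k) * (v choose (b - k))) = fact k * (b choose k) * (g choose k) * falling (b - k) v"
      unfolding falling_def by (metis (no_types, lifting) mult.assoc mult.commute mult.left_commute)
  qed simp
  also have "\<dots> = (\<Sum>k\<le>min b g. fact k * (b choose k) * (g choose k) * falling (b - k) v)"
    by (rule sum.mono_neutral_right) (auto simp: binomial_eq_0_iff)
  finally show ?thesis .
qed

lemma falling_key:
  "falling b (g + (m - d)) * falling d m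
    = (\<Sum>k\<le>min b g. fact k * (b choose k) * (g choose k) * falling (b - k + d) m)"
  unfolding falling_vandermonde sum_distrib_right falling_split[symmetric]
  by (intro sum.cong) (simp_all add: mult_ac)

definition leibniz_set :: "mindex \<Rightarrow> mindex \<Rightarrow> mindex set" where
  "leibniz_set \<beta> \<gamma> = {\<kappa>. \<forall>i. lookup \<kappa> i \<le> lookup \<beta> i \<and> lookup \<kappa> i \<le> lookup \<gamma> i}"

lemma mindex_of_fun:
  assumes "finite S" shows "\<exists>\<kappa>::mindex. \<forall>i. lookup \<kappa> i = (if i \<in> S then f i else 0)"
proof -
  have "finite {i. (if i \<in> S then f i else 0) \<noteq> 0}"
    by (rule finite_subset[OF _ assms]) auto
  then have "lookup (Poly_Mapping.Abs_poly_mapping (\<lambda>i. if i \<in> S then f i else 0))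
      = (\<lambda>i. if i \<in> S then f i else 0)"
    by (rule lookup_Abs_poly_mapping)
  then show ?thesis
    by (intro exI[of _ "Poly_Mapping.Abs_poly_mapping (\<lambda>i. if i \<in> S then f i else 0)"] allI) (rule fun_cong)
qed

lemma leibniz_set_bij:
  assumes "finite S" "keys \<beta> \<subseteq> S"
  shows "bij_betw (\<lambda>\<kappa>. restrict (lookup \<kappa>) S) (leibniz_set \<beta> \<gamma>)
           (PiE S (\<lambda>i. {..min (lookup \<beta> i) (lookup \<gamma> i)}))"
proof (rule bij_betwI')
  fix x y assume xy: "x \<in> leibniz_set \<beta> \<gamma>" "y \<in> leibniz_set \<beta> \<gamma>"
  have z: "i \<notin> S \<Longrightarrow> lookup \<beta> i = 0" for i using assms by (auto simp: in_keys_iff)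
  show "(restrict (lookup x) S = restrict (lookup y) S) = (x = y)"
  proof
    assume e: "restrict (lookup x) S = restrict (lookup y) S"
    show "x = y"
    proof (rule poly_mapping_eqI)
      fix i show "lookup x i = lookup y i"
      proof (cases "i \<in> S")
        case True then show ?thesis using fun_cong[OF e, of i] by simp
      next
        case False
        then show ?thesis using xy z[OF False] unfolding leibniz_set_def by (simp, metis le_zero_eq)
      qed
    qed
  qed simp
next
  fix x assume "x \<in> leibniz_set \<beta> \<gamma>"
  then show "restrict (lookup x) S \<in> PiE S (\<lambda>i. {..min (lookup \<beta> i) (lookup \<gamma> i)})"
    by (auto simp: leibniz_set_def)
next
  fix y assume y: "y \<in> PiE S (\<lambda>i. {..min (lookup \<beta> i) (lookup \<gamma> i)})"
  obtain \<kappa> :: mindex where k: "\<And>i. lookup \<kappa> i = (if i \<in> S then y i else 0)"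
    using mindex_of_fun[OF assms(1)] by blast
  have "\<kappa> \<in> leibniz_set \<beta> \<gamma>" using y by (auto simp: leibniz_set_def k PiE_iff)
  moreover have "y = restrict (lookup \<kappa>) S"
    using y by (intro ext) (auto simp: k PiE_iff extensional_def)
  ultimately show "\<exists>x\<in>leibniz_set \<beta> \<gamma>. y = restrict (lookup x) S" by blast
qed

lemma finite_leibniz_set: "finite (leibniz_set \<beta> \<gamma>)"
proof -
  have "finite (PiE (keys \<beta>) (\<lambda>i. {..min (lookup \<beta> i) (lookup \<gamma> i)}))"
    by (rule finite_PiE) auto
  then show ?thesis
    by (rule iffD2[OF bij_betw_finite[OF leibniz_set_bij[of "keys \<beta>" \<beta> \<gamma>, OF finite_keys subset_refl]]])
qed

definition leibniz_coef :: "mindex \<Rightarrow> mindex \<Rightarrow> mindex \<Rightarrow> nat" where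
  "leibniz_coef \<beta> \<gamma> \<kappa> = (\<Prod>i\<in>keys \<kappa>. fact (lookup \<kappa> i) * (lookup \<beta> i choose lookup \<kappa> i)
                  * (lookup \<gamma> i choose lookup \<kappa> i))"

lemma multi_falling_key:
  "multi_falling \<beta> (\<gamma> + (\<mu> - \<delta>)) * multi_falling \<delta> \<mu> = (\<Sum>\<kappa>\<in>leibniz_set \<beta> \<gamma>. leibniz_coef \<beta> \<gamma> \<kappa> * multi_falling (\<beta> - \<kappa> + \<delta>) \<mu>)"
proof -
  let ?S = "keys \<beta> \<union> keys \<delta>"
  let ?h = "\<lambda>i k. fact k * (lookup \<beta> i choose k) * (lookup \<gamma> i choose k)
                    * falling (lookup \<beta> i - k + lookup \<delta> i) (lookup \<mu> i)"
  have "multi_falling \<beta> (\<gamma> + (\<mu> - \<delta>)) * multi_falling \<delta> \<mu> = (\<Prod>i\<in>?S. \<Sum>k\<le>min (lookup \<beta> i) (lookup \<gamma> i). ?h i k)"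
    by (simp add: multi_falling_superset[of ?S] prod.distrib[symmetric] lookup_add lookup_minus falling_key)
  also have "\<dots> = (\<Sum>y\<in>PiE ?S (\<lambda>i. {..min (lookup \<beta> i) (lookup \<gamma> i)}). \<Prod>i\<in>?S. ?h i (y i))"
    by (subst prod_sum_PiE) auto
  also have "\<dots> = (\<Sum>\<kappa>\<in>leibniz_set \<beta> \<gamma>. \<Prod>i\<in>?S. ?h i (restrict (lookup \<kappa>) ?S i))"
    by (rule sum.reindex_bij_betw[symmetric]) (rule leibniz_set_bij; simp)
  also have "\<dots> = (\<Sum>\<kappa>\<in>leibniz_set \<beta> \<gamma>. leibniz_coef \<beta> \<gamma> \<kappa> * multi_falling (\<beta> - \<kappa> + \<delta>) \<mu>)"
  proof (rule sum.cong[OF refl])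
    fix \<kappa> assume k: "\<kappa> \<in> leibniz_set \<beta> \<gamma>"
    have sub: "keys \<kappa> \<subseteq> ?S"
    proof
      fix i assume "i \<in> keys \<kappa>"
      then have "lookup \<kappa> i \<noteq> 0" by (simp add: in_keys_iff)
      moreover have "lookup \<kappa> i \<le> lookup \<beta> i" using k by (simp add: leibniz_set_def)
      ultimately show "i \<in> ?S" by (auto simp: in_keys_iff)
    qed
    have "leibniz_coef \<beta> \<gamma> \<kappa> = (\<Prod>i\<in>?S. fact (lookup \<kappa> i) * (lookup \<beta> i choose lookup \<kappa> i)
                  * (lookup \<gamma> i choose lookup \<kappa> i))"
      unfolding leibniz_coef_def using sub by (intro prod.mono_neutral_left) (auto simp: in_keys_iff)
    moreover have "multi_falling (\<beta> - \<kappa> + \<delta>) \<mu> = (\<Prod>i\<in>?S. falling (lookup \<beta> i - lookup \<kappa> i + lookup \<delta> i) (lookup \<mu> i))"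
      by (subst multi_falling_superset[of ?S]) (auto simp: lookup_add lookup_minus in_keys_iff)
    ultimately show "(\<Prod>i\<in>?S. ?h i (restrict (lookup \<kappa>) ?S i)) = leibniz_coef \<beta> \<gamma> \<kappa> * multi_falling (\<beta> - \<kappa> + \<delta>) \<mu>"
      by (simp add: prod.distrib[symmetric])
  qed
  finally show ?thesis .
qed

lemma multi_falling_nonzero: "multi_falling \<beta> \<mu> \<noteq> 0 \<Longrightarrow> lookup \<beta> i \<le> lookup \<mu> i"
  by (cases "i \<in> keys \<beta>") (auto simp: multi_falling_def falling_def binomial_eq_0_iff in_keys_iff not_less)

lemma weyl_act_weyl_monom_mult:
  "weyl_act (weyl_monom_mult p q c) (Poly_Mapping.single \<mu> d)
     = weyl_act (Poly_Mapping.single p c) (weyl_act (Poly_Mapping.single q 1) (Poly_Mapping.single \<mu> d))"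
proof -
  obtain \<alpha> \<beta> \<gamma> \<delta> where pq: "p = (\<alpha>, \<beta>)" "q = (\<gamma>, \<delta>)" by (metis surj_pair)
  have w: "weyl_monom_mult p q c = (\<Sum>\<kappa>\<in>leibniz_set \<beta> \<gamma>. Poly_Mapping.single (\<alpha> + (\<gamma> - \<kappa>), \<beta> - \<kappa> + \<delta>)
        (c * of_nat (leibniz_coef \<beta> \<gamma> \<kappa>)))"
    by (simp add: weyl_monom_mult_def pq leibniz_set_def leibniz_coef_def)
  have "weyl_act (weyl_monom_mult p q c) (Poly_Mapping.single \<mu> d)
     = (\<Sum>\<kappa>\<in>leibniz_set \<beta> \<gamma>. Poly_Mapping.single (\<alpha> + (\<gamma> - \<kappa>) + (\<mu> - (\<beta> - \<kappa> + \<delta>)))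
          (c * d * of_nat (leibniz_coef \<beta> \<gamma> \<kappa> * multi_falling (\<beta> - \<kappa> + \<delta>) \<mu>)))"
    by (simp add: w weyl_act_sum_left weyl_act_single weyl_act_monom_def mult_ac)
  also have "\<dots> = (\<Sum>\<kappa>\<in>leibniz_set \<beta> \<gamma>. Poly_Mapping.single (\<alpha> + (\<gamma> + (\<mu> - \<delta>) - \<beta>))
          (c * d * of_nat (leibniz_coef \<beta> \<gamma> \<kappa> * multi_falling (\<beta> - \<kappa> + \<delta>) \<mu>)))"
  proof (rule sum.cong[OF refl])
    fix \<kappa> assume k: "\<kappa> \<in> leibniz_set \<beta> \<gamma>"
    show "Poly_Mapping.single (\<alpha> + (\<gamma> - \<kappa>) + (\<mu> - (\<beta> - \<kappa> + \<delta>)))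
          (c * d * of_nat (leibniz_coef \<beta> \<gamma> \<kappa> * multi_falling (\<beta> - \<kappa> + \<delta>) \<mu>))
       = Poly_Mapping.single (\<alpha> + (\<gamma> + (\<mu> - \<delta>) - \<beta>))
          (c * d * of_nat (leibniz_coef \<beta> \<gamma> \<kappa> * multi_falling (\<beta> - \<kappa> + \<delta>) \<mu>))"
    proof (cases "multi_falling (\<beta> - \<kappa> + \<delta>) \<mu> = 0")
      case False
      have "\<alpha> + (\<gamma> - \<kappa>) + (\<mu> - (\<beta> - \<kappa> + \<delta>)) = \<alpha> + (\<gamma> + (\<mu> - \<delta>) - \<beta>)"
      proof (rule poly_mapping_eqI)
        fix i
        have "lookup (\<beta> - \<kappa> + \<delta>) i \<le> lookup \<mu> i" using multi_falling_nonzero[OF False] .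
        moreover have "lookup \<kappa> i \<le> lookup \<beta> i" "lookup \<kappa> i \<le> lookup \<gamma> i"
          using k by (auto simp: leibniz_set_def)
        ultimately show "lookup (\<alpha> + (\<gamma> - \<kappa>) + (\<mu> - (\<beta> - \<kappa> + \<delta>))) i = lookup (\<alpha> + (\<gamma> + (\<mu> - \<delta>) - \<beta>)) i"
          by (simp add: lookup_add lookup_minus)
      qed
      then show ?thesis by simp
    qed simp
  qed
  also have "\<dots> = Poly_Mapping.single (\<alpha> + (\<gamma> + (\<mu> - \<delta>) - \<beta>))
          (c * d * of_nat (multi_falling \<beta> (\<gamma> + (\<mu> - \<delta>)) * multi_falling \<delta> \<mu>))"
    unfolding multi_falling_key by (simp add: single_sum sum_distrib_left)
  also have "\<dots> = weyl_act (Poly_Mapping.single p c) (weyl_act (Poly_Mapping.single q 1) (Poly_Mapping.single \<mu> d))"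
    by (simp add: weyl_act_single weyl_act_monom_def pq mult_ac)
  finally show ?thesis .
qed

lemma weyl_act_mult_single:
  "weyl_act (weyl_mult (Poly_Mapping.single p c) (Poly_Mapping.single q d)) (Poly_Mapping.single \<mu> e)
   = weyl_act (Poly_Mapping.single p c) (weyl_act (Poly_Mapping.single q d) (Poly_Mapping.single \<mu> e))"
proof -
  have "weyl_act (Poly_Mapping.single p (c * d)) (weyl_act (Poly_Mapping.single q 1) (Poly_Mapping.single \<mu> e))
    = weyl_act (Poly_Mapping.single p c) (weyl_act (Poly_Mapping.single q d) (Poly_Mapping.single \<mu> e))"
    by (simp add: weyl_act_single weyl_act_monom_def mult_ac)
  then show ?thesis by (simp add: weyl_mult_single weyl_act_weyl_monom_mult)
qed

lemma weyl_act_mult: "weyl_act (weyl_mult P Q) f = weyl_act P (weyl_act Q f)"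
proof -
  have 1: "weyl_act (weyl_mult (Poly_Mapping.single p c) (Poly_Mapping.single q d)) f
    = weyl_act (Poly_Mapping.single p c) (weyl_act (Poly_Mapping.single q d) f)" for p c q d
    by (rule additive_eq[of "weyl_act (weyl_mult (Poly_Mapping.single p c) (Poly_Mapping.single q d))"])
      (simp_all only: weyl_act_sum_right weyl_act_mult_single)
  have 2: "weyl_act (weyl_mult (Poly_Mapping.single p c) Q) f
    = weyl_act (Poly_Mapping.single p c) (weyl_act Q f)" for p c
    by (rule additive_eq[of "\<lambda>Q. weyl_act (weyl_mult (Poly_Mapping.single p c) Q) f"])
      (simp_all only: weyl_act_sum_right weyl_act_sum_left weyl_mult_sum_right 1)
  show ?thesis
    by (rule additive_eq[of "\<lambda>P. weyl_act (weyl_mult P Q) f"])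
      (simp_all only: weyl_act_sum_right weyl_act_sum_left weyl_mult_sum_left 2)
qed

lemma weyl_act_faithful:
  assumes "\<And>f. weyl_act P f = 0" shows "P = 0"
proof (rule ccontr)
  assume "P \<noteq> 0"
  define dg :: "mindex \<Rightarrow> nat" where "dg \<beta> = (\<Sum>i\<in>keys \<beta>. lookup \<beta> i)" for \<beta>
  have "snd ` keys P \<noteq> {}" using \<open>P \<noteq> 0\<close> by simp
  then obtain \<beta> where b: "\<beta> \<in> snd ` keys P" "\<And>\<beta>'. \<beta>' \<in> snd ` keys P \<Longrightarrow> dg \<beta> \<le> dg \<beta>'"
    using ex_has_least_nat[of "\<lambda>\<beta>. \<beta> \<in> snd ` keys P" _ dg] by blast
  then obtain \<alpha> where a: "(\<alpha>, \<beta>) \<in> keys P" by auto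
  have eq: "\<beta>' = \<beta>" if "\<beta>' \<in> snd ` keys P" "multi_falling \<beta>' \<beta> \<noteq> 0" for \<beta>'
  proof (rule ccontr)
    assume ne: "\<beta>' \<noteq> \<beta>"
    have le: "lookup \<beta>' i \<le> lookup \<beta> i" for i by (rule multi_falling_nonzero[OF that(2)])
    from ne obtain i where i: "lookup \<beta>' i \<noteq> lookup \<beta> i" by (meson poly_mapping_eqI)
    have "lookup \<beta>' i < lookup \<beta> i" using le[of i] i by simp
    then have ik: "i \<in> keys \<beta>" by (auto simp: in_keys_iff)
    have "dg \<beta>' = (\<Sum>i\<in>keys \<beta>. lookup \<beta>' i)"
      unfolding dg_def
    proof (rule sum.mono_neutral_left)
      show "keys \<beta>' \<subseteq> keys \<beta>"
      proof
        fix i assume "i \<in> keys \<beta>'"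
        then show "i \<in> keys \<beta>" using le[of i] by (auto simp: in_keys_iff)
      qed
    qed (auto simp: in_keys_iff)
    also have "\<dots> < dg \<beta>" unfolding dg_def
      by (rule sum_strict_mono_ex1) (use le ik \<open>lookup \<beta>' i < lookup \<beta> i\<close> in auto)
    finally show False using b(2)[OF that(1)] by simp
  qed
  have "weyl_act P (Poly_Mapping.single \<beta> 1) = (\<Sum>p\<in>keys P. weyl_act_monom p \<beta> (lookup P p))"
    by (subst weyl_act_eq_sum[of "keys P" P "{\<beta>}"]) (auto simp: in_keys_iff lookup_single)
  then have "0 = lookup (\<Sum>p\<in>keys P. weyl_act_monom p \<beta> (lookup P p)) \<alpha>" using assms by simp
  also have "\<dots> = (\<Sum>p\<in>keys P. lookup (weyl_act_monom p \<beta> (lookup P p)) \<alpha>)" by (rule lookup_sum)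
  also have "\<dots> = (\<Sum>p\<in>keys P. if p = (\<alpha>, \<beta>) then lookup P p * of_nat (multi_falling \<beta> \<beta>) else 0)"
  proof (rule sum.cong[OF refl])
    fix p assume p: "p \<in> keys P"
    show "lookup (weyl_act_monom p \<beta> (lookup P p)) \<alpha> = (if p = (\<alpha>, \<beta>) then lookup P p * of_nat (multi_falling \<beta> \<beta>) else 0)"
    proof (cases "multi_falling (snd p) \<beta> = 0")
      case True
      then show ?thesis by (auto simp: weyl_act_monom_def)
    next
      case False
      then have "snd p = \<beta>" using eq p by auto
      then show ?thesis by (cases p) (auto simp: weyl_act_monom_def lookup_single when_def)
    qed
  qed
  also have "\<dots> = lookup P (\<alpha>, \<beta>) * of_nat (multi_falling \<beta> \<beta>)" using a by simp
  finally have "multi_falling \<beta> \<beta> = 0" using a by (simp add: in_keys_iff)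
  then show False by (auto simp: multi_falling_def falling_def)
qed

lemma weyl_act_diff: "weyl_act (P - Q) f = weyl_act P f - weyl_act Q f"
  by (metis weyl_act_add_left add_diff_cancel diff_add_cancel)

lemma weyl_mult_assoc: "weyl_mult (weyl_mult P Q) R = weyl_mult P (weyl_mult Q R)"
  using weyl_act_faithful[of "weyl_mult (weyl_mult P Q) R - weyl_mult P (weyl_mult Q R)"]
  by (simp add: weyl_act_diff weyl_act_mult)

lemma weyl_act_one: "weyl_act (Poly_Mapping.single 0 1) f = f"
proof -
  have "weyl_act (Poly_Mapping.single 0 1) (Poly_Mapping.single \<mu> e) = Poly_Mapping.single \<mu> e" for \<mu> e
    by (simp add: weyl_act_single weyl_act_monom_def multi_falling_def del: single_one)
  from additive_eq[of "weyl_act (Poly_Mapping.single 0 1)" "\<lambda>f. f", OF weyl_act_sum_right refl this]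
  show ?thesis .
qed

lemma weyl_act_1: "weyl_act 1 f = f"
  using weyl_act_one[of f] by simp

lemma weyl_mult_one: "weyl_mult (Poly_Mapping.single 0 1) P = P"
    "weyl_mult P (Poly_Mapping.single 0 1) = P"
  using weyl_act_faithful[of "weyl_mult (Poly_Mapping.single 0 1) P - P"]
    weyl_act_faithful[of "weyl_mult P (Poly_Mapping.single 0 1) - P"]
  by (simp_all add: weyl_act_diff weyl_act_mult weyl_act_1)

lemma mindices_closed: "\<alpha> \<in> mindices n \<Longrightarrow> \<beta> \<in> mindices n \<Longrightarrow> \<alpha> + \<beta> \<in> mindices n"
    "\<alpha> \<in> mindices n \<Longrightarrow> \<alpha> - \<kappa> \<in> mindices n"
  unfolding mindices_def by (auto simp: in_keys_iff lookup_add lookup_minus subset_iff)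

lemma weyl_carrier_sum:
  "(\<And>s. s \<in> S \<Longrightarrow> keys (f s) \<subseteq> K) \<Longrightarrow> keys (\<Sum>s\<in>S. f s :: weyl_elem) \<subseteq> K"
  using Poly_Mapping.keys_sum by fast

lemma weyl_mult_closed:
  assumes "P \<in> carrier (weyl n)" "Q \<in> carrier (weyl n)" shows "weyl_mult P Q \<in> carrier (weyl n)"
proof -
  have m: "keys (weyl_monom_mult p q c) \<subseteq> mindices n \<times> mindices n"
    if "p \<in> mindices n \<times> mindices n" "q \<in> mindices n \<times> mindices n" for p q c
    unfolding weyl_monom_mult_def using that
    by (intro weyl_carrier_sum) (auto split: if_splits intro!: mindices_closed)
  have "keys (weyl_mult P Q) \<subseteq> mindices n \<times> mindices n"
    unfolding weyl_mult_def using assms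
    by (intro weyl_carrier_sum m) (auto simp: weyl_def simp del: mem_Times_iff)
  then show ?thesis by (simp add: weyl_def)
qed

lemma weyl_ring: "ring (weyl n)"
proof (rule ringI)
  show "abelian_group (weyl n)"
  proof (rule abelian_groupI)
    fix x y assume "x \<in> carrier (weyl n)" "y \<in> carrier (weyl n)"
    then show "x \<oplus>\<^bsub>weyl n\<^esub> y \<in> carrier (weyl n)"
      using Poly_Mapping.keys_add[of x y] by (auto simp: weyl_def)
  next
    fix x assume "x \<in> carrier (weyl n)"
    then show "\<exists>y\<in>carrier (weyl n). y \<oplus>\<^bsub>weyl n\<^esub> x = \<zero>\<^bsub>weyl n\<^esub>"
      by (intro bexI[of _ "- x"]) (simp_all add: weyl_def)
  qed (auto simp: weyl_def add_ac)
  show "monoid (weyl n)"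
  proof (rule monoidI)
    show "\<one>\<^bsub>weyl n\<^esub> \<in> carrier (weyl n)"
      by (auto simp: weyl_def mindices_def zero_prod_def)
  qed (use weyl_mult_closed in \<open>auto simp: weyl_def weyl_mult_assoc weyl_mult_one weyl_mult_one[simplified]\<close>)
qed (auto simp: weyl_def weyl_mult_add_left weyl_mult_add_right)

lemma weyl_comm: "weyl_mult (dvar i) (xvar j) - weyl_mult (xvar j) (dvar i)
   = (if i = j then Poly_Mapping.single 0 1 else 0)"
proof -
  have "weyl_act (weyl_mult (dvar i) (xvar j) - weyl_mult (xvar j) (dvar i)
   - (if i = j then Poly_Mapping.single 0 1 else 0)) f = 0" for f
  proof -
    have A: "weyl_act (weyl_mult (dvar i) (xvar j) - weyl_mult (xvar j) (dvar i)
       - (if i = j then Poly_Mapping.single 0 1 else 0)) (Poly_Mapping.single \<mu> e) = 0" for \<mu> e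
    proof (cases "i = j")
      case True
      have "lookup \<mu> i \<noteq> 0 \<Longrightarrow> Poly_Mapping.single i (Suc 0) + (\<mu> - Poly_Mapping.single i (Suc 0)) = \<mu>"
        by (rule poly_mapping_eqI) (auto simp: lookup_add lookup_minus lookup_single when_def)
      moreover have "Poly_Mapping.single i (Suc 0) + \<mu> - Poly_Mapping.single i (Suc 0) = \<mu>"
        by (rule poly_mapping_eqI) (auto simp: lookup_add lookup_minus lookup_single when_def)
      ultimately show ?thesis using True
        apply (cases "lookup \<mu> i = 0")
        by (simp_all add: weyl_act_diff weyl_act_mult xvar_def dvar_def weyl_act_single weyl_act_monom_def multi_falling_def falling_def weyl_act_1 lookup_add
         weyl_act_0 distrib_left single_add)
    next
      case False
      have "lookup \<mu> i \<noteq> 0 \<Longrightarrow> Poly_Mapping.single j (Suc 0) + \<mu> - Poly_Mapping.single i (Suc 0) = Poly_Mapping.single j (Suc 0) + (\<mu> - Poly_Mapping.single i (Suc 0))"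
        by (rule poly_mapping_eqI) (use False in \<open>auto simp: lookup_add lookup_minus lookup_single when_def\<close>)
      then show ?thesis using False
        apply (cases "lookup \<mu> i = 0")
        by (simp_all add: weyl_act_diff weyl_act_mult xvar_def dvar_def weyl_act_single weyl_act_monom_def multi_falling_def falling_def weyl_act_1 weyl_act_0 lookup_add lookup_single when_def)
    qed
    show ?thesis
      by (rule additive_eq[where G = "\<lambda>_. 0"]) (simp_all only: weyl_act_sum_right A sum.neutral_const)
  qed
  from weyl_act_faithful[OF this] show ?thesis by simp
qed

end

theory Submission
  imports Defs "HOL-Analysis.Continuum_Not_Denumerable"
    "HOL-Computational_Algebra.Fundamental_Theorem_Algebra" "Jordan_Normal_Form.Char_Poly"
begin

text \<open>
  Near the origin, the non-characteristic condition says that the symbols \<open>p(0, \<xi>)\<close>, with \<open>p\<close> in the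
  annihilator of the module graded by order, vanish on \<open>\<xi>\<^sub>1 = \<dots> = \<xi>\<^sub>r = 0\<close> only at \<open>\<xi> = 0\<close>. Since all
  weights are equal, the leading part for the \<open>V\<close>-filtration of an operator of order \<open>d\<close> is its symbol
  with the coefficients frozen at the origin; hence powers of the operators \<open>p(0, \<partial>)\<close> kill the classes
  of the generators in \<open>gr\<^sup>U M\<close>. By the Nullstellensatz and a determinant argument, for every \<open>j > r\<close>
  there is then an operator \<open>P\<^sub>j\<close> in \<open>\<partial>\<^sub>1, \<dots>, \<partial>\<^sub>r, \<partial>\<^sub>j\<close>, homogeneous, with constant coefficients and monic
  in \<open>\<partial>\<^sub>j\<close>, that kills these classes. It acts locally nilpotently on \<open>gr\<^sup>U M\<close> and commutes with the
  other \<open>x\<^sub>l\<close>, \<open>l > r\<close>. Commuting a power of \<open>P\<^sub>j\<close> with \<open>x\<^sub>j\<close> repeatedly ends in a nonzero constant, so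
  \<open>x\<^sub>n, \<dots>, x\<^sub>r\<^sub>+\<^sub>1\<close> is a regular sequence on \<open>gr\<^sup>U M\<close>. Therefore \<open>\<Sum> x\<^sub>j M\<close> meets \<open>U\<^sub>k M\<close> in
  \<open>\<Sum> x\<^sub>j U\<^sub>k\<^sub>+\<^sub>c M\<close> with \<open>c\<close> the common weight, which is the injectivity of \<open>i\<^sup>* gr\<^sup>U M \<rightarrow> gr\<^sup>U (i\<^sup>* M)\<close>.
  The operators \<open>P\<^sub>j\<close> have constant coefficients, so all of this holds on the whole space and
  \<open>f = 1\<close> works.
\<close>

section \<open>Polynomials in countably many variables\<close>

text \<open>Two filtrations have to be reconciled. The annihilator behind the characteristic variety
  belongs to an arbitrarily chosen good filtration \<open>F\<close> for the order, and the only link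
  with \<open>U\<close> is an inclusion of \<open>F k\<close> in \<open>U (c k + C)\<close>. The
  constant \<open>C\<close> can be beaten only by iterating, so powers of the operators
  \<open>p(0, \<partial>)\<close> are obtained and not the operators themselves; a Nullstellensatz
  absorbs this loss. It is proved in countably many variables, from the uncountability of the
  complex numbers, so that one polynomial type serves all \<open>n\<close>; variables beyond
  \<open>n\<close> act as zero. The monic operator \<open>P_j\<close> is a characteristic
  polynomial: modulo the annihilator, the polynomials are finite over those in the first
  \<open>r\<close> variables, and Cayley-Hamilton applies to multiplication by the variable
  \<open>j\<close>. The index of \<open>U\<close> is real, so lowering a level step by step needs an
  integer measure. Since all weights are multiples of \<open>c\<close>, levels change only at the
  points of the progressions \<open>\<kappa> l + c Z\<close>, and \<open>jumps\<close> increases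
  exactly there.\<close>

type_synonym cpoly = "mindex \<Rightarrow>\<^sub>0 complex"

abbreviation single :: "'a \<Rightarrow> 'b::zero \<Rightarrow> 'a \<Rightarrow>\<^sub>0 'b" where
  "single \<equiv> Poly_Mapping.single"

definition var :: "nat \<Rightarrow> cpoly" where
  "var i = single (single i 1) 1"

abbreviation const_poly :: "complex \<Rightarrow> cpoly" where
  "const_poly c \<equiv> single 0 c"

definition mindex_eval :: "(nat \<Rightarrow> complex) \<Rightarrow> mindex \<Rightarrow> complex" where
  "mindex_eval a \<beta> = (\<Prod>i\<in>keys \<beta>. a i ^ lookup \<beta> i)"

definition cpoly_eval :: "cpoly \<Rightarrow> (nat \<Rightarrow> complex) \<Rightarrow> complex" where
  "cpoly_eval p a = (\<Sum>\<beta>\<in>keys p. lookup p \<beta> * mindex_eval a \<beta>)"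

definition is_ideal :: "'a::comm_ring_1 set \<Rightarrow> bool" where
  "is_ideal I \<longleftrightarrow> 0 \<in> I \<and> (\<forall>x\<in>I. \<forall>y\<in>I. x + y \<in> I) \<and> (\<forall>c. \<forall>x\<in>I. c * x \<in> I)"

lemma is_idealD:
  assumes "is_ideal I"
  shows "0 \<in> I" "x \<in> I \<Longrightarrow> y \<in> I \<Longrightarrow> x + y \<in> I" "x \<in> I \<Longrightarrow> c * x \<in> I"
    "x \<in> I \<Longrightarrow> x * c \<in> I" "x \<in> I \<Longrightarrow> - x \<in> I" "x \<in> I \<Longrightarrow> y \<in> I \<Longrightarrow> x - y \<in> I"
proof -
  show a: "0 \<in> I" "\<And>x y. x \<in> I \<Longrightarrow> y \<in> I \<Longrightarrow> x + y \<in> I" "\<And>c x. x \<in> I \<Longrightarrow> c * x \<in> I"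
    using assms by (auto simp: is_ideal_def)
  show "x \<in> I \<Longrightarrow> x * c \<in> I" using a(3) by (metis mult.commute)
  show b: "- x \<in> I" if "x \<in> I" for x using a(3)[OF that, of "-1"] by simp
  show "x \<in> I \<Longrightarrow> y \<in> I \<Longrightarrow> x - y \<in> I" using a(2)[OF _ b] by force
qed

lemma is_ideal_sum: "is_ideal I \<Longrightarrow> (\<And>s. s \<in> S \<Longrightarrow> f s \<in> I) \<Longrightarrow> sum f S \<in> I"
  by (induction S rule: infinite_finite_induct) (auto dest: is_idealD)

lemma mindex_eval_superset:
  "finite S \<Longrightarrow> keys \<beta> \<subseteq> S \<Longrightarrow> mindex_eval a \<beta> = (\<Prod>i\<in>S. a i ^ lookup \<beta> i)"
  unfolding mindex_eval_def by (intro prod.mono_neutral_left) (auto simp: in_keys_iff)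

lemma mindex_eval_add: "mindex_eval a (\<beta> + \<gamma>) = mindex_eval a \<beta> * mindex_eval a \<gamma>"
  using Poly_Mapping.keys_add[of \<beta> \<gamma>]
  by (simp add: mindex_eval_superset[of "keys \<beta> \<union> keys \<gamma>"] lookup_add power_add prod.distrib)

lemma cpoly_eval_superset:
  "finite S \<Longrightarrow> keys p \<subseteq> S \<Longrightarrow> cpoly_eval p a = (\<Sum>\<beta>\<in>S. lookup p \<beta> * mindex_eval a \<beta>)"
  unfolding cpoly_eval_def by (intro sum.mono_neutral_left) (auto simp: in_keys_iff)

lemma cpoly_eval_single: "cpoly_eval (single \<beta> c) a = c * mindex_eval a \<beta>"
  by (subst cpoly_eval_superset[of "{\<beta>}"]) (auto simp: lookup_single)

lemma cpoly_eval_add: "cpoly_eval (p + q) a = cpoly_eval p a + cpoly_eval q a"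
  using Poly_Mapping.keys_add[of p q]
  by (simp add: cpoly_eval_superset[of "keys p \<union> keys q"] lookup_add sum.distrib distrib_right)

lemma cpoly_eval_0: "cpoly_eval 0 a = 0"
  by (simp add: cpoly_eval_def)

lemma cpoly_eval_sum: "cpoly_eval (sum f S) a = (\<Sum>s\<in>S. cpoly_eval (f s) a)"
  by (induction S rule: infinite_finite_induct) (simp_all add: cpoly_eval_0 cpoly_eval_add)

lemma cpoly_eval_mult: "cpoly_eval (p * q) a = cpoly_eval p a * cpoly_eval q a"
proof -
  have 1: "cpoly_eval (single \<beta> c * single \<gamma> d) a
    = cpoly_eval (single \<beta> c) a * cpoly_eval (single \<gamma> d) a" for \<beta> \<gamma> c d
    by (simp add: mult_single cpoly_eval_single mindex_eval_add)
  have 2: "cpoly_eval (single \<beta> c * q) a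
    = cpoly_eval (single \<beta> c) a * cpoly_eval q a" for \<beta> c
    by (rule additive_eq[of "\<lambda>q. cpoly_eval (single \<beta> c * q) a"])
      (simp_all only: 1 cpoly_eval_sum sum_distrib_left)
  show ?thesis
    by (rule additive_eq[of "\<lambda>p. cpoly_eval (p * q) a"])
      (simp_all only: 2 cpoly_eval_sum sum_distrib_left sum_distrib_right)
qed

lemma cpoly_eval_1: "cpoly_eval 1 a = 1"
  using cpoly_eval_single[of 0 1] by (simp add: mindex_eval_def)

lemma cpoly_eval_power: "cpoly_eval (p ^ k) a = cpoly_eval p a ^ k"
  by (induction k) (simp_all add: cpoly_eval_1 cpoly_eval_mult)

lemma cpoly_eval_var: "cpoly_eval (var i) a = a i"
  by (simp add: var_def cpoly_eval_single mindex_eval_def)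

lemma var_power: "var i ^ k = single (single i k) 1"
  by (induction k) (simp_all add: var_def mult_single single_add[symmetric])

lemma single_eq_prod_var: "single \<beta> c = const_poly c * (\<Prod>i\<in>keys \<beta>. var i ^ lookup \<beta> i)"
proof -
  have "(\<Prod>i\<in>S. single (single i (f i)) 1)
    = (single (\<Sum>i\<in>S. single i (f i)) 1 :: cpoly)" if "finite S" for S and f :: "nat \<Rightarrow> nat"
    using that by (induction S) (simp_all add: mult_single)
  moreover have "(\<Sum>i\<in>keys \<beta>. single i (lookup \<beta> i)) = \<beta>"
    by (rule poly_mapping_eqI) (auto simp: lookup_sum lookup_single when_def in_keys_iff sum.If_cases)
  ultimately show ?thesis by (simp add: var_power mult_single)
qed

text \<open>A multi-index is determined by its graph over its support, a finite set of pairs of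
  naturals. Countability feeds the pigeonhole step of the Nullstellensatz.\<close>

lemma countable_mindex: "countable (UNIV :: mindex set)"
proof -
  have "inj (\<lambda>\<beta>::mindex. (\<lambda>i. (i, lookup \<beta> i)) ` keys \<beta>)"
  proof (rule injI)
    fix \<beta> \<gamma> :: mindex
    assume e: "(\<lambda>i. (i, lookup \<beta> i)) ` keys \<beta> = (\<lambda>i. (i, lookup \<gamma> i)) ` keys \<gamma>"
    show "\<beta> = \<gamma>"
    proof (rule poly_mapping_eqI)
      fix i
      have "(i, lookup \<beta> i) \<in> (\<lambda>i. (i, lookup \<beta> i)) ` keys \<beta> \<longleftrightarrow> i \<in> keys \<beta>"
        "(i, lookup \<gamma> i) \<in> (\<lambda>i. (i, lookup \<gamma> i)) ` keys \<gamma> \<longleftrightarrow> i \<in> keys \<gamma>" by auto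
      then have "i \<in> keys \<beta> \<longleftrightarrow> i \<in> keys \<gamma>" using e by auto
      moreover have "i \<in> keys \<beta> \<Longrightarrow> lookup \<beta> i = lookup \<gamma> i" using e by auto
      ultimately show "lookup \<beta> i = lookup \<gamma> i" by (auto simp: in_keys_iff)
    qed
  qed
  moreover have "countable ((\<lambda>\<beta>::mindex. (\<lambda>i. (i, lookup \<beta> i)) ` keys \<beta>) ` UNIV)"
    by (rule countable_subset[OF _ countable_Collect_finite]) auto
  ultimately show ?thesis using countable_image_inj_on by blast
qed

text \<open>Polynomials supported in one finite set \<open>F\<close> lie in a space of dimension at
  most \<open>card F\<close>, so infinitely many distinct ones are dependent. Injectivity of
  \<open>q\<close> lets the relation be indexed by \<open>C\<close>.\<close>

lemma finite_dependence:
  fixes q :: "'i \<Rightarrow> cpoly"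
  assumes C: "infinite C" and "inj_on q C" and F: "finite F" "\<And>c. c \<in> C \<Longrightarrow> keys (q c) \<subseteq> F"
  obtains T lam where "finite T" "T \<subseteq> C" "(\<Sum>c\<in>T. const_poly (lam c) * q c) = 0" "\<exists>c\<in>T. lam c \<noteq> 0"
proof -
  interpret V: vector_space "\<lambda>(c::complex) (p::cpoly). const_poly c * p"
    by unfold_locales (simp_all add: algebra_simps single_add mult_single mult.assoc[symmetric])
  have sub: "q ` C \<subseteq> V.span ((\<lambda>\<beta>. single \<beta> 1) ` F)"
  proof safe
    fix c assume "c \<in> C"
    have "q c = (\<Sum>\<beta>\<in>keys (q c). const_poly (lookup (q c) \<beta>) * single \<beta> 1)"
      using poly_mapping_sum_single[of "q c"] by (simp add: mult_single)
    also have "\<dots> \<in> V.span ((\<lambda>\<beta>. single \<beta> 1) ` F)"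
      using F(2)[OF \<open>c \<in> C\<close>] by (intro V.span_sum V.span_scale V.span_base) auto
    finally show "q c \<in> V.span ((\<lambda>\<beta>. single \<beta> 1) ` F)" .
  qed
  have "V.dependent (q ` C)"
  proof (rule ccontr)
    assume "\<not> V.dependent (q ` C)"
    from V.independent_span_bound[OF finite_imageI[OF F(1)] this sub]
    have "finite C" using finite_imageD[OF _ \<open>inj_on q C\<close>] by blast
    then show False using C by blast
  qed
  then obtain T' \<mu> where T': "finite T'" "T' \<subseteq> q ` C" "(\<Sum>v\<in>T'. const_poly (\<mu> v) * v) = 0" "\<exists>v\<in>T'. \<mu> v \<noteq> 0"
    unfolding V.dependent_explicit by blast
  obtain T where T: "T \<subseteq> C" "T' = q ` T" using T'(2) by (meson subset_imageE)
  have inj: "inj_on q T" using \<open>inj_on q C\<close> T(1) by (rule inj_on_subset)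
  show ?thesis
  proof (rule that[of T "\<mu> \<circ> q"])
    show "finite T" using T'(1) T(2) inj finite_imageD by auto
    show "(\<Sum>c\<in>T. const_poly ((\<mu> \<circ> q) c) * q c) = 0"
      using T'(3) unfolding T(2) sum.reindex[OF inj] by simp
  qed (use T T'(4) in auto)
qed

section \<open>The Nullstellensatz\<close>

text \<open>Over the complex numbers \<open>R\<close> splits into linear factors, and a prime ideal
  containing \<open>R(p)\<close> contains one of the factors \<open>p - z\<close>. In degree 0 a
  unit would lie in \<open>m\<close>.\<close>

lemma complex_poly_root_in_prime:
  fixes R :: "complex poly" and p :: cpoly
  assumes "R \<noteq> 0"
    and m: "is_ideal m" "1 \<notin> m" "\<And>x y. x * y \<in> m \<Longrightarrow> x \<in> m \<or> y \<in> m"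
    and "poly (map_poly const_poly R) p \<in> m"
  shows "\<exists>c. p - const_poly c \<in> m"
  using assms(1,5)
proof (induction "degree R" arbitrary: R)
  case 0
  then obtain c where c: "R = [:c:]" "c \<noteq> 0" by (metis degree_eq_zeroE pCons_0_0)
  then have "const_poly c \<in> m" using 0 by (simp add: map_poly_pCons)
  then have "const_poly (inverse c) * const_poly c \<in> m" using m(1) is_idealD by blast
  then show ?case using m(2) c(2) by (simp add: mult_single)
next
  case (Suc d)
  have hom: "map_poly const_poly (A * B) = map_poly const_poly A * map_poly const_poly B" for A B :: "complex poly"
    by (rule poly_eqI) (simp add: coeff_map_poly coeff_mult single_sum mult_single)
  have "\<not> constant (poly R)" using Suc(2) constant_degree[of R] by simp
  then obtain z where "poly R z = 0" using fundamental_theorem_of_algebra by blast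
  then obtain R' where R': "R = [:- z, 1:] * R'" by (metis dvdE poly_eq_0_iff_dvd)
  have "R' \<noteq> 0" using R' Suc(3) by auto
  have "degree R = Suc (degree R')" unfolding R' using \<open>R' \<noteq> 0\<close> by (subst degree_mult_eq) auto
  then have d: "d = degree R'" using Suc(2) by simp
  have "poly (map_poly const_poly R) p = (p - const_poly z) * poly (map_poly const_poly R') p"
    unfolding R' hom by (simp add: map_poly_pCons single_uminus algebra_simps)
  then have "p - const_poly z \<in> m \<or> poly (map_poly const_poly R') p \<in> m" using Suc(4) m(3) by metis
  then show ?case using Suc(1)[OF d \<open>R' \<noteq> 0\<close>] by blast
qed

text \<open>Zorn's lemma. For \<open>x\<close> outside \<open>m\<close> the ideal generated by
  \<open>m\<close> and \<open>x\<close> must contain a power of \<open>s\<close>. This is the last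
  conclusion, and it says that \<open>x\<close> becomes invertible in the residue ring once
  \<open>s\<close> is inverted; it replaces the extra variable of Rabinowitsch's trick.\<close>

lemma exists_maximal_avoiding:
  fixes A :: "'a::comm_ring_1 set"
  assumes "is_ideal A" "\<And>N. s ^ N \<notin> A"
  obtains m where "is_ideal m" "A \<subseteq> m" "\<And>N. s ^ N \<notin> m"
    "\<And>x. x \<notin> m \<Longrightarrow> \<exists>y N. y * x - s ^ N \<in> m"
proof -
  let ?P = "{I. is_ideal I \<and> A \<subseteq> I \<and> (\<forall>N. s ^ N \<notin> I)}"
  have "\<exists>M\<in>?P. \<forall>X\<in>?P. M \<subseteq> X \<longrightarrow> X = M"
  proof (rule subset_Zorn_nonempty)
    show "?P \<noteq> {}" using assms by blast
  next
    fix C assume C: "C \<noteq> {}" "subset.chain ?P C"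
    have ch: "X \<subseteq> Y \<or> Y \<subseteq> X" if "X \<in> C" "Y \<in> C" for X Y
      using C(2) that by (auto simp: subset.chain_def)
    have id: "is_ideal X" if "X \<in> C" for X using C(2) that by (auto simp: subset.chain_def)
    have "is_ideal (\<Union>C)" unfolding is_ideal_def
    proof (intro conjI ballI allI)
      show "0 \<in> \<Union>C" using C(1) id is_idealD(1) by blast
    next
      fix x y assume "x \<in> \<Union>C" "y \<in> \<Union>C"
      then obtain X Y where XY: "X \<in> C" "x \<in> X" "Y \<in> C" "y \<in> Y" by blast
      from ch[OF XY(1,3)] show "x + y \<in> \<Union>C"
      proof
        assume "X \<subseteq> Y" then have "x + y \<in> Y" using XY id[OF XY(3)] is_idealD(2) by blast
        then show ?thesis using XY by blast
      next
        assume "Y \<subseteq> X" then have "x + y \<in> X" using XY id[OF XY(1)] is_idealD(2) by blast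
        then show ?thesis using XY by blast
      qed
    next
      fix c x assume "x \<in> \<Union>C" then show "c * x \<in> \<Union>C" using id is_idealD(3) by blast
    qed
    then show "\<Union>C \<in> ?P" using C by (auto simp: subset.chain_def)
  qed
  then obtain m where mP: "m \<in> ?P" and mX: "\<forall>X\<in>?P. m \<subseteq> X \<longrightarrow> X = m" by (rule bexE)
  from mP have m: "is_ideal m" "A \<subseteq> m" "\<And>N. s ^ N \<notin> m" by simp_all
  have max: "X = m" if "is_ideal X" "A \<subseteq> X" "\<And>N. s ^ N \<notin> X" "m \<subseteq> X" for X
    using bspec[OF mX, of X] that by simp
  have "\<exists>y N. y * x - s ^ N \<in> m" if "x \<notin> m" for x
  proof (rule ccontr)
    assume neg: "\<not> ?thesis"
    let ?X = "{y * x + z | y z. z \<in> m}"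
    have "is_ideal ?X" unfolding is_ideal_def
    proof (intro conjI ballI allI)
      show "0 \<in> ?X" using is_idealD(1)[OF m(1)] by (auto intro!: exI[of _ 0])
    next
      fix u v assume "u \<in> ?X" "v \<in> ?X"
      then obtain y z y' z' where "u = y * x + z" "z \<in> m" "v = y' * x + z'" "z' \<in> m" by blast
      then have "u + v = (y + y') * x + (z + z')" "z + z' \<in> m"
        using is_idealD(2)[OF m(1)] by (auto simp: algebra_simps)
      then show "u + v \<in> ?X" by blast
    next
      fix c u assume "u \<in> ?X"
      then obtain y z where "u = y * x + z" "z \<in> m" by blast
      then have "c * u = (c * y) * x + c * z" "c * z \<in> m"
        using is_idealD(3)[OF m(1)] by (simp_all only: distrib_left mult.assoc)
      then show "c * u \<in> ?X" by blast
    qed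
    moreover have sub: "m \<subseteq> ?X"
    proof
      fix z assume "z \<in> m"
      then have "z = 0 * x + z \<and> z \<in> m" by simp
      then show "z \<in> ?X" by blast
    qed
    moreover have "s ^ N \<notin> ?X" for N
    proof
      assume "s ^ N \<in> ?X"
      then obtain y z where "s ^ N = y * x + z" "z \<in> m" by blast
      then have "y * x - s ^ N = - z" "- z \<in> m" using is_idealD(5)[OF m(1)] by (auto simp: algebra_simps)
      then show False using neg by metis
    qed
    ultimately have "?X = m" using max[of ?X] m(2) by (meson order_trans)
    moreover have "x = 1 * x + 0 \<and> 0 \<in> m" using is_idealD(1)[OF m(1)] by simp
    ultimately show False using that by blast
  qed
  with m that show ?thesis by blast
qed

text \<open>
  An ideal that is maximal among those avoiding the powers of \<open>s\<close> is prime, and its residue ring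
  localized at \<open>s\<close> is a field of countable dimension over the complex numbers. A transcendental
  element \<open>p\<close> would give the uncountable independent family \<open>1 / (p - c)\<close>.
\<close>

theorem nullstellensatz:
  fixes A :: "cpoly set"
  assumes A: "is_ideal A"
    and van: "\<And>a. (\<And>p. p \<in> A \<Longrightarrow> cpoly_eval p a = 0) \<Longrightarrow> cpoly_eval s a = 0"
  shows "\<exists>N. s ^ N \<in> A"
proof (rule ccontr)
  assume "\<nexists>N. s ^ N \<in> A"
  then obtain m where m: "is_ideal m" "A \<subseteq> m" "\<And>N. s ^ N \<notin> m"
    and max: "\<And>x. x \<notin> m \<Longrightarrow> \<exists>y N. y * x - s ^ N \<in> m"
    using exists_maximal_avoiding[OF A, of s] by metis
  note mI = is_idealD[OF m(1)]
  have one: "1 \<notin> m" using m(3)[of 0] by simp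
  \<comment> \<open>If multiples of \<open>x\<close> and of \<open>y\<close> are powers of
    \<open>s\<close> modulo \<open>m\<close>, then so is a multiple of \<open>x * y\<close>.\<close>
  have prime: "x \<in> m \<or> y \<in> m" if xy: "x * y \<in> m" for x y
  proof (rule ccontr)
    assume "\<not> ?thesis"
    then obtain u N v K where uv: "u * x - s ^ N \<in> m" "v * y - s ^ K \<in> m" using max by metis
    have "(u * x - s ^ N) * (v * y) + s ^ N * (v * y - s ^ K) \<in> m"
      by (rule mI(2)[OF mI(4)[OF uv(1)] mI(3)[OF uv(2)]])
    moreover have "(u * x - s ^ N) * (v * y) + s ^ N * (v * y - s ^ K) = (u * v) * (x * y) - s ^ (N + K)"
      by (simp add: algebra_simps power_add)
    ultimately have "(u * v) * (x * y) - s ^ (N + K) \<in> m" by simp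
    then have "(u * v) * (x * y) - ((u * v) * (x * y) - s ^ (N + K)) \<in> m" by (rule mI(6)[OF mI(3)[OF xy]])
    then show False using m(3)[of "N + K"] by simp
  qed
  have const: "c = 0" if "const_poly c \<in> m" for c
  proof (rule ccontr)
    assume "c \<noteq> 0"
    have "const_poly (inverse c) * const_poly c \<in> m" by (rule mI(3)[OF that])
    then show False using one \<open>c \<noteq> 0\<close> by (simp add: mult_single)
  qed
  have ex: "\<exists>c. p - const_poly c \<in> m" for p
  proof (rule ccontr)
    assume neg: "\<not> ?thesis"
    then have "\<forall>c. \<exists>y N. y * (p - const_poly c) - s ^ N \<in> m" using max by blast
    \<comment> \<open>Modulo \<open>m\<close>, the fraction \<open>q c / s ^ N c\<close> is the
      inverse of \<open>p - c\<close>.\<close>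
    then obtain q N where q: "\<And>c. q c * (p - const_poly c) - s ^ N c \<in> m" by metis
    \<comment> \<open>There are countably many pairs of an exponent and a support but uncountably
      many \<open>c\<close>, so one pair is shared by infinitely many \<open>c\<close>; their
      \<open>q c\<close> then live in one finite-dimensional space.\<close>
    have "countable (range (\<lambda>c. (N c, keys (q c))))"
    proof (rule countable_subset)
      have "countable {F :: mindex set. finite F \<and> F \<subseteq> UNIV}"
        by (rule countable_Collect_finite_subset[OF countable_mindex])
      then show "countable (UNIV \<times> {F :: mindex set. finite F \<and> F \<subseteq> UNIV} :: (nat \<times> _) set)" by simp
    qed auto
    moreover have "\<not> countable (UNIV :: complex set)"
    proof
      assume "countable (UNIV :: complex set)"
      then have "countable (range complex_of_real)" by (rule countable_subset[OF subset_UNIV])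
      then have "countable (UNIV :: real set)" by (rule countable_image_inj_on) (simp add: inj_on_def)
      then show False using uncountable_UNIV_real by blast
    qed
    ultimately obtain K F where inf: "infinite {c. (N c, keys (q c)) = (K, F)}"
    proof -
      have "\<exists>z. \<not> countable {c. (N c, keys (q c)) = z}"
      proof (rule ccontr)
        assume "\<not> ?thesis"
        then have "countable (\<Union>z\<in>range (\<lambda>c. (N c, keys (q c))). {c. (N c, keys (q c)) = z})"
          using \<open>countable (range _)\<close> by (intro countable_UN) auto
        moreover have "(\<Union>z\<in>range (\<lambda>c. (N c, keys (q c))). {c. (N c, keys (q c)) = z}) = UNIV" by auto
        ultimately show False using \<open>\<not> countable UNIV\<close> by simp
      qed
      then obtain z where "\<not> countable {c. (N c, keys (q c)) = z}" by blast
      then show ?thesis using that[of "fst z" "snd z"] uncountable_infinite by auto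
    qed
    let ?C = "{c. (N c, keys (q c)) = (K, F)}"
    have qC: "q c * (p - const_poly c) - s ^ K \<in> m" if "c \<in> ?C" for c using q[of c] that by simp
    \<comment> \<open>A common value for \<open>c\<close> and \<open>d\<close> would put
      \<open>(c - d) q c\<close>, hence \<open>q c\<close> and then \<open>s ^ K\<close>, into
      \<open>m\<close>.\<close>
    have inj: "inj_on q ?C"
    proof (rule inj_onI, rule ccontr)
      fix c d assume cd: "c \<in> ?C" "d \<in> ?C" "q c = q d" "c \<noteq> d"
      have "(q c * (p - const_poly d) - s ^ K) - (q c * (p - const_poly c) - s ^ K) \<in> m"
        using mI(6)[OF qC[OF cd(2)] qC[OF cd(1)]] unfolding cd(3) .
      moreover have "(q c * (p - const_poly d) - s ^ K) - (q c * (p - const_poly c) - s ^ K) = q c * const_poly (c - d)"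
        by (simp add: algebra_simps single_diff)
      ultimately have "q c \<in> m" using prime[of "q c" "const_poly (c - d)"] const[of "c - d"] cd(4) by auto
      then have "q c * (p - const_poly c) - (q c * (p - const_poly c) - s ^ K) \<in> m" by (rule mI(6)[OF mI(4) qC[OF cd(1)]])
      then show False using m(3)[of K] by simp
    qed
    have "finite F" using inf by (metis (mono_tags, lifting) Collect_empty_eq finite.emptyI finite_keys prod.inject)
    obtain T lam where T: "finite T" "T \<subseteq> ?C" "(\<Sum>c\<in>T. const_poly (lam c) * q c) = 0" "\<exists>c\<in>T. lam c \<noteq> 0"
      by (rule finite_dependence[OF inf inj \<open>finite F\<close>]) auto
    let ?g = "\<lambda>c. \<Prod>d\<in>T - {c}. p - const_poly d"
    let ?h = "\<Prod>d\<in>T. p - const_poly d"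
    \<comment> \<open>Clearing denominators in the relation among the inverses of the
      \<open>p - c\<close> gives \<open>R(p)\<close>. At a \<open>c\<close> with
      \<open>lam c\<close> nonzero only one summand of \<open>R\<close> survives, so
      \<open>R\<close> is nonzero.\<close>
    define R :: "complex poly" where "R = (\<Sum>c\<in>T. smult (lam c) (\<Prod>d\<in>T - {c}. [:- d, 1:]))"
    have hom0: "map_poly const_poly (a + b) = map_poly const_poly a + map_poly const_poly b" for a b :: "complex poly"
      by (rule poly_eqI) (simp add: coeff_map_poly single_add)
    have hom1: "map_poly const_poly (a * b) = map_poly const_poly a * map_poly const_poly b" for a b :: "complex poly"
      by (rule poly_eqI) (simp add: coeff_map_poly coeff_mult single_sum mult_single)
    have hsum: "map_poly const_poly (\<Sum>c\<in>S. f c) = (\<Sum>c\<in>S. map_poly const_poly (f c))" for S :: "complex set" and f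
      by (induction S rule: infinite_finite_induct) (simp_all add: hom0)
    have hprod: "map_poly const_poly (\<Prod>c\<in>S. f c) = (\<Prod>c\<in>S. map_poly const_poly (f c))" for S :: "complex set" and f
      by (induction S rule: infinite_finite_induct) (simp_all add: hom1)
    have "poly (map_poly const_poly R) p = (\<Sum>c\<in>T. const_poly (lam c) * ?g c)"
    proof -
      have "map_poly const_poly (smult a b) = smult (const_poly a) (map_poly const_poly b)" for a and b :: "complex poly"
        by (rule poly_eqI) (simp add: coeff_map_poly mult_single)
      then show ?thesis unfolding R_def
        by (simp add: hsum hprod poly_sum poly_prod map_poly_pCons single_uminus)
    qed
    moreover have "s ^ K * (\<Sum>c\<in>T. const_poly (lam c) * ?g c) \<in> m"
    proof -
      have "(\<Sum>c\<in>T. (const_poly (lam c) * ?g c) * (q c * (p - const_poly c) - s ^ K)) \<in> m"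
        by (intro is_ideal_sum[OF m(1)] mI(3) qC) (use T(2) in blast)
      also have "(\<Sum>c\<in>T. (const_poly (lam c) * ?g c) * (q c * (p - const_poly c) - s ^ K))
        = (\<Sum>c\<in>T. const_poly (lam c) * q c) * ?h - s ^ K * (\<Sum>c\<in>T. const_poly (lam c) * ?g c)"
      proof -
        have "(const_poly (lam c) * ?g c) * (q c * (p - const_poly c) - s ^ K)
          = const_poly (lam c) * q c * ?h - s ^ K * (const_poly (lam c) * ?g c)" if "c \<in> T" for c
          by (simp add: prod.remove[OF T(1) that] algebra_simps)
        then show ?thesis by (simp add: sum_subtractf sum_distrib_left sum_distrib_right)
      qed
      finally have "- (s ^ K * (\<Sum>c\<in>T. const_poly (lam c) * ?g c)) \<in> m" unfolding T(3) by simp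
      then show ?thesis using mI(5) by fastforce
    qed
    ultimately have "poly (map_poly const_poly R) p \<in> m" using prime m(3) by metis
    moreover have "R \<noteq> 0"
    proof -
      obtain c where c: "c \<in> T" "lam c \<noteq> 0" using T(4) by blast
      have "poly R c = (\<Sum>b\<in>T. lam b * (\<Prod>d\<in>T - {b}. c - d))" unfolding R_def by (simp add: poly_sum poly_prod)
      also have "\<dots> = (\<Sum>b\<in>T. if b = c then lam c * (\<Prod>d\<in>T - {c}. c - d) else 0)"
      proof (rule sum.cong[OF refl])
        fix b assume "b \<in> T"
        have "b \<noteq> c \<Longrightarrow> (\<Prod>d\<in>T - {b}. c - d) = 0" using c(1) T(1) by (intro prod_zero) auto
        then show "lam b * (\<Prod>d\<in>T - {b}. c - d) = (if b = c then lam c * (\<Prod>d\<in>T - {c}. c - d) else 0)" by auto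
      qed
      also have "\<dots> = lam c * (\<Prod>d\<in>T - {c}. c - d)" using c T(1) by simp
      finally have "poly R c \<noteq> 0" using c T(1) by auto
      then show ?thesis by auto
    qed
    ultimately show False using complex_poly_root_in_prime[OF _ m(1) one prime] neg by blast
  qed
  \<comment> \<open>\<open>h\<close> is the residue map onto the complex numbers, a ring
    homomorphism. Its values on the variables form a point of the zero set of \<open>A\<close> at
    which \<open>s\<close> cannot vanish.\<close>
  then obtain h where h: "\<And>p. p - const_poly (h p) \<in> m" by metis
  have uniq: "h p = c" if "p - const_poly c \<in> m" for p c
  proof -
    have "(p - const_poly c) - (p - const_poly (h p)) \<in> m" by (rule mI(6)[OF that h])
    then have "const_poly (h p - c) \<in> m" by (simp add: single_diff)
    then show ?thesis using const[of "h p - c"] by simp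
  qed
  have hadd: "h (p + q) = h p + h q" for p q
    using mI(2)[OF h[of p] h[of q]] by (intro uniq) (simp add: single_add algebra_simps)
  have hmult: "h (p * q) = h p * h q" for p q
  proof (rule uniq)
    have "(p - const_poly (h p)) * q + const_poly (h p) * (q - const_poly (h q)) \<in> m"
      by (rule mI(2)[OF mI(4)[OF h] mI(3)[OF h]])
    then show "p * q - const_poly (h p * h q) \<in> m" by (simp add: algebra_simps mult_single)
  qed
  have hconst: "h (const_poly c) = c" for c using mI(1) by (intro uniq) simp
  have h1: "h 1 = 1" using hconst[of 1] by simp
  have hpow: "h (p ^ k) = h p ^ k" for p k by (induction k) (simp_all add: h1 hmult)
  have hprod: "h (prod f S) = (\<Prod>i\<in>S. h (f i))" for f and S :: "nat set"
    by (induction S rule: infinite_finite_induct) (simp_all add: h1 hmult)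
  have h0: "h 0 = 0" using hconst[of 0] by simp
  have hsum: "h (sum f S) = (\<Sum>i\<in>S. h (f i))" for f and S :: "mindex set"
    by (induction S rule: infinite_finite_induct) (simp_all add: h0 hadd)
  let ?a = "\<lambda>i. h (var i)"
  have ev: "cpoly_eval p ?a = h p" for p
  proof (rule additive_eq[of "\<lambda>p. cpoly_eval p ?a"])
    fix \<beta> c show "cpoly_eval (single \<beta> c) ?a = h (single \<beta> c)"
      by (subst (2) single_eq_prod_var) (simp add: cpoly_eval_single hmult hconst hprod hpow mindex_eval_def)
  qed (simp_all only: cpoly_eval_sum hsum)
  have "cpoly_eval s ?a = 0"
  proof (rule van)
    fix p assume "p \<in> A"
    then have "p - const_poly 0 \<in> m" using m(2) by auto
    then show "cpoly_eval p ?a = 0" unfolding ev by (rule uniq)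
  qed
  then have "h s = 0" unfolding ev .
  then have "s \<in> m" using h[of s] by simp
  then show False using m(3)[of 1] by simp
qed

section \<open>Integral dependence over a polynomial subring\<close>

text \<open>Generic in the key type, so that it covers both the homogeneous components of
  polynomials and the weight components \<open>weyl_comp\<close> of operators.\<close>

definition keep :: "('a \<Rightarrow> bool) \<Rightarrow> ('a \<Rightarrow>\<^sub>0 'b::comm_monoid_add) \<Rightarrow> ('a \<Rightarrow>\<^sub>0 'b)" where
  "keep Q p = (\<Sum>k | k \<in> keys p \<and> Q k. single k (lookup p k))"

lemma lookup_keep: "lookup (keep Q p) k = (if Q k then lookup p k else 0)"
proof -
  have "finite {k. k \<in> keys p \<and> Q k}" by simp
  then show ?thesis
    by (auto simp: keep_def lookup_sum lookup_single when_def sum.If_cases in_keys_iff)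
qed

lemma keys_keep: "keys (keep Q p) = {k \<in> keys p. Q k}"
  by (auto simp: in_keys_iff lookup_keep split: if_splits)

lemma keep_add: "keep Q (p + q) = keep Q p + keep Q q"
  by (rule poly_mapping_eqI) (simp add: lookup_keep lookup_add)

lemma keep_0: "keep Q 0 = 0"
  by (rule poly_mapping_eqI) (simp add: lookup_keep)

lemma keep_sum: "keep Q (sum f S) = (\<Sum>s\<in>S. keep Q (f s))"
  by (induction S rule: infinite_finite_induct) (simp_all add: keep_0 keep_add)

lemma keep_single: "keep Q (single k c) = (if Q k then single k c else 0)"
  by (rule poly_mapping_eqI) (auto simp: lookup_keep lookup_single when_def)

definition mdeg :: "mindex \<Rightarrow> nat" where
  "mdeg \<beta> = (\<Sum>i\<in>keys \<beta>. lookup \<beta> i)"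

lemma mdeg_superset: "finite S \<Longrightarrow> keys \<beta> \<subseteq> S \<Longrightarrow> mdeg \<beta> = (\<Sum>i\<in>S. lookup \<beta> i)"
  unfolding mdeg_def by (intro sum.mono_neutral_left) (auto simp: in_keys_iff)

lemma mdeg_add: "mdeg (\<beta> + \<gamma>) = mdeg \<beta> + mdeg \<gamma>"
  using Poly_Mapping.keys_add[of \<beta> \<gamma>]
  by (simp add: mdeg_superset[of "keys \<beta> \<union> keys \<gamma>"] lookup_add sum.distrib)

lemma mdeg_single: "mdeg (single i k) = k"
  by (subst mdeg_superset[of "{i}"]) (auto simp: lookup_single)

lemma mdeg_0: "mdeg 0 = 0"
  by (simp add: mdeg_def)

lemma mdeg_eq_0: "mdeg \<beta> = 0 \<longleftrightarrow> \<beta> = 0"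
  by (auto simp: mdeg_def in_keys_iff intro!: poly_mapping_eqI)

abbreviation hcomp :: "nat \<Rightarrow> cpoly \<Rightarrow> cpoly" where
  "hcomp d \<equiv> keep (\<lambda>\<beta>. mdeg \<beta> = d)"

definition homog :: "nat \<Rightarrow> cpoly \<Rightarrow> bool" where
  "homog d p \<longleftrightarrow> (\<forall>\<beta>\<in>keys p. mdeg \<beta> = d)"

lemma homog_hcomp: "homog d (hcomp d p)"
  by (simp add: homog_def keys_keep)

lemma homog_mult: "homog d p \<Longrightarrow> homog e q \<Longrightarrow> homog (d + e) (p * q)"
  using keys_mult[of p q] by (fastforce simp: homog_def mdeg_add)

lemma homog_1: "homog 0 1"
  by (simp add: homog_def mdeg_0)

lemma homog_power: "homog d p \<Longrightarrow> homog (k * d) (p ^ k)"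
  by (induction k) (auto simp: homog_1 intro: homog_mult)

lemma keys_add_mindex: "keys (\<beta> + \<gamma> :: mindex) = keys \<beta> \<union> keys \<gamma>"
  by (auto simp: in_keys_iff lookup_add)

definition monos_in :: "nat set \<Rightarrow> cpoly set" where
  "monos_in V = {p. \<forall>\<beta>\<in>keys p. keys \<beta> \<subseteq> V}"

lemma monos_in_subring:
  "0 \<in> monos_in V" "1 \<in> monos_in V" "p \<in> monos_in V \<Longrightarrow> q \<in> monos_in V \<Longrightarrow> p + q \<in> monos_in V"
  "p \<in> monos_in V \<Longrightarrow> - p \<in> monos_in V" "p \<in> monos_in V \<Longrightarrow> q \<in> monos_in V \<Longrightarrow> p * q \<in> monos_in V"
  "i \<in> V \<Longrightarrow> var i \<in> monos_in V" "const_poly c \<in> monos_in V"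
proof -
  show "p \<in> monos_in V \<Longrightarrow> q \<in> monos_in V \<Longrightarrow> p + q \<in> monos_in V"
    using Poly_Mapping.keys_add[of p q] by (auto simp: monos_in_def)
  show "p \<in> monos_in V \<Longrightarrow> q \<in> monos_in V \<Longrightarrow> p * q \<in> monos_in V"
    unfolding monos_in_def using keys_mult[of p q]
    by (fastforce simp: keys_add_mindex dest!: subsetD[of "keys (p * q)"])
qed (auto simp: monos_in_def var_def)

lemma monos_in_sum: "(\<And>s. s \<in> S \<Longrightarrow> f s \<in> monos_in V) \<Longrightarrow> sum f S \<in> monos_in V"
  by (induction S rule: infinite_finite_induct) (auto intro: monos_in_subring)

lemma monos_in_power: "p \<in> monos_in V \<Longrightarrow> p ^ k \<in> monos_in V"
  by (induction k) (auto intro: monos_in_subring)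

text \<open>The ideal generated by the variables outside \<open>W\<close>; modulo it only
  polynomials in the variables of \<open>W\<close> remain.\<close>

definition outside_monos :: "nat set \<Rightarrow> cpoly set" where
  "outside_monos W = {p. \<forall>\<beta>\<in>keys p. \<not> keys \<beta> \<subseteq> W}"

lemma outside_monos_ideal: "is_ideal (outside_monos W)"
  unfolding is_ideal_def outside_monos_def
proof (intro conjI ballI allI; (elim CollectE)?; intro CollectI ballI)
  fix c p :: cpoly and \<beta>
  assume "\<forall>\<beta>\<in>keys p. \<not> keys \<beta> \<subseteq> W" "\<beta> \<in> keys (c * p)"
  then show "\<not> keys \<beta> \<subseteq> W" using keys_mult[of c p]
    by (auto simp: keys_add_mindex dest!: subsetD[of "keys (c * p)"])
next
  fix p q :: cpoly and \<beta>
  assume "\<forall>\<beta>\<in>keys p. \<not> keys \<beta> \<subseteq> W" "\<forall>\<beta>\<in>keys q. \<not> keys \<beta> \<subseteq> W" "\<beta> \<in> keys (p + q)"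
  then show "\<not> keys \<beta> \<subseteq> W" using Poly_Mapping.keys_add[of p q] by auto
qed simp

text \<open>
  Graded Nakayama: if a power of each variable in \<open>W\<close> lies in \<open>I\<close> modulo the variables outside
  \<open>W\<close>, then finitely many monomials in \<open>W\<close> span modulo \<open>I\<close> over the polynomials in \<open>V\<close>.
\<close>

lemma finite_monomial_spanning_set:
  fixes I :: "cpoly set"
  assumes I: "is_ideal I" and hom: "\<And>p d. p \<in> I \<Longrightarrow> hcomp d p \<in> I"
    and W: "finite W" and rest: "\<And>i. i \<notin> V \<union> W \<Longrightarrow> var i \<in> I"
    and pow: "\<And>j. j \<in> W \<Longrightarrow> \<exists>N. \<exists>p\<in>I. var j ^ N - p \<in> outside_monos W"
  shows "\<exists>E. finite E \<and> 0 \<in> E \<and>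
    (\<forall>p. \<exists>b. (\<forall>e\<in>E. b e \<in> monos_in V) \<and> p - (\<Sum>e\<in>E. b e * single e 1) \<in> I)"
proof -
  note mI = is_idealD[OF I]
  have "\<exists>N q. 0 < N \<and> var j ^ N - q \<in> I \<and> q \<in> outside_monos W \<and> homog N q" if j: "j \<in> W" for j
  proof -
    obtain N p where p: "p \<in> I" "var j ^ N - p \<in> outside_monos W" using pow[OF j] by blast
    \<comment> \<open>The extra factor \<open>var j\<close> makes the exponent positive, so that the
      exponent \<open>0\<close> of the monomial 1 belongs to \<open>E\<close> below. Passing to the
      component of degree \<open>Suc N\<close> makes the relation homogeneous, as the induction on
      the degree requires.\<close>
    let ?q = "hcomp (Suc N) (var j ^ Suc N - var j * p)"
    have "var j ^ Suc N - var j * p = var j * (var j ^ N - p)" by (simp add: algebra_simps)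
    then have "var j ^ Suc N - var j * p \<in> outside_monos W"
      using is_idealD(3)[OF outside_monos_ideal p(2)] by metis
    then have "?q \<in> outside_monos W" by (auto simp: outside_monos_def keys_keep)
    moreover have "var j ^ Suc N - ?q = hcomp (Suc N) (var j * p)"
      by (rule poly_mapping_eqI) (simp only: var_power lookup_minus lookup_keep, simp add: lookup_single when_def, auto simp: mdeg_single)
    ultimately show ?thesis using hom mI(3) p(1) homog_hcomp by (metis zero_less_Suc)
  qed
  then obtain N q where N: "\<And>j. j \<in> W \<Longrightarrow> 0 < N j" "\<And>j. j \<in> W \<Longrightarrow> var j ^ N j - q j \<in> I"
    and q: "\<And>j. j \<in> W \<Longrightarrow> q j \<in> outside_monos W" "\<And>j. j \<in> W \<Longrightarrow> homog (N j) (q j)"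
    by metis
  define E :: "mindex set" where "E = {\<beta>. keys \<beta> \<subseteq> W \<and> (\<forall>i\<in>W. lookup \<beta> i < N i)}"
  obtain b :: mindex where b: "\<And>i. lookup b i = (if i \<in> W then N i else 0)"
    using mindex_of_fun[OF W] by blast
  have "E \<subseteq> leibniz_set b b"
  proof
    fix \<beta> assume e: "\<beta> \<in> E"
    have "lookup \<beta> i \<le> lookup b i" for i
      using e by (cases "i \<in> W") (auto simp: E_def b in_keys_iff less_imp_le)
    then show "\<beta> \<in> leibniz_set b b" by (simp add: leibniz_set_def)
  qed
  then have finE: "finite E" using finite_leibniz_set finite_subset by blast
  define S where "S = {p. \<exists>b. (\<forall>e\<in>E. b e \<in> monos_in V) \<and> p - (\<Sum>e\<in>E. b e * single e 1) \<in> I}"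
  have S_I: "p \<in> S" if "p \<in> I" for p
    unfolding S_def using that monos_in_subring(1) by (intro CollectI exI[of _ "\<lambda>_. 0"]) simp
  have S_E: "single e 1 \<in> S" if "e \<in> E" for e
    unfolding S_def using that finE mI(1) monos_in_subring(1,2)
    by (intro CollectI exI[of _ "\<lambda>d. if d = e then 1 else 0"]) (simp add: if_distrib if_distribR sum.delta cong: if_cong)
  have S_add: "p + p' \<in> S" if pp: "p \<in> S" "p' \<in> S" for p p'
  proof -
    obtain b b' where b: "\<forall>e\<in>E. b e \<in> monos_in V" "p - (\<Sum>e\<in>E. b e * single e 1) \<in> I"
      "\<forall>e\<in>E. b' e \<in> monos_in V" "p' - (\<Sum>e\<in>E. b' e * single e 1) \<in> I"
      using pp unfolding S_def by blast
    have "p + p' - (\<Sum>e\<in>E. (b e + b' e) * single e 1) \<in> I"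
      using mI(2)[OF b(2,4)] by (simp add: distrib_right sum.distrib algebra_simps)
    moreover have "\<forall>e\<in>E. b e + b' e \<in> monos_in V" using b monos_in_subring(3) by blast
    ultimately show ?thesis unfolding S_def by (intro CollectI exI[of _ "\<lambda>e. b e + b' e"]) simp
  qed
  have S_mult: "c * p \<in> S" if c: "c \<in> monos_in V" and p: "p \<in> S" for c p
  proof -
    obtain b where b: "\<forall>e\<in>E. b e \<in> monos_in V" "p - (\<Sum>e\<in>E. b e * single e 1) \<in> I"
      using p unfolding S_def by blast
    have "c * p - (\<Sum>e\<in>E. (c * b e) * single e 1) \<in> I"
      using mI(3)[OF b(2), of c] by (simp add: right_diff_distrib sum_distrib_left mult.assoc)
    moreover have "\<forall>e\<in>E. c * b e \<in> monos_in V" using b c monos_in_subring(5) by blast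
    ultimately show ?thesis unfolding S_def by (intro CollectI exI[of _ "\<lambda>e. c * b e"]) simp
  qed
  have S_sum: "sum f T \<in> S" if "\<And>t. t \<in> T \<Longrightarrow> f t \<in> S" for f :: "mindex \<Rightarrow> cpoly" and T
    using that by (induction T rule: infinite_finite_induct) (auto intro: S_I mI S_add)
  have S_single: "single \<gamma> c \<in> S" if "single \<gamma> 1 \<in> S" for \<gamma> c
    using S_mult[OF monos_in_subring(7) that, of c] by (simp add: mult_single)
  have "\<forall>\<gamma>. mdeg \<gamma> = d \<longrightarrow> single \<gamma> 1 \<in> S" for d
  proof (induction d rule: less_induct)
    case (less d)
    \<comment> \<open>A variable outside \<open>W\<close> is stripped off: it is a coefficient if it
      lies in \<open>V\<close> and zero modulo \<open>I\<close> otherwise, and the degree drops. The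
      other reduction replaces \<open>var i ^ N i\<close> by \<open>q i\<close> without lowering the
      degree, but each resulting monomial has a variable outside \<open>W\<close>, so it is covered
      by this case.\<close>
    have A: "single \<gamma> 1 \<in> S" if g: "mdeg \<gamma> = d" "\<not> keys \<gamma> \<subseteq> W" for \<gamma>
    proof -
      obtain i where i: "i \<in> keys \<gamma>" "i \<notin> W" using g(2) by blast
      define \<gamma>' where "\<gamma>' = \<gamma> - single i 1"
      have e: "\<gamma> = single i 1 + \<gamma>'"
        using i(1) by (intro poly_mapping_eqI) (auto simp: \<gamma>'_def lookup_add lookup_minus lookup_single when_def in_keys_iff)
      have v: "single \<gamma> 1 = var i * single \<gamma>' 1"
        by (subst e) (simp add: var_def mult_single)
      have "mdeg \<gamma>' < d" using g(1) e mdeg_add[of "single i 1" \<gamma>'] by (simp add: mdeg_single)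
      then have *: "single \<gamma>' 1 \<in> S" using less by blast
      show ?thesis
      proof (cases "i \<in> V")
        case True then show ?thesis unfolding v by (intro S_mult * monos_in_subring(6))
      next
        case False then show ?thesis unfolding v using rest[of i] i(2) mI(4) S_I by blast
      qed
    qed
    show ?case
    proof (intro allI impI)
      fix \<gamma> assume g: "mdeg \<gamma> = d"
      consider "\<not> keys \<gamma> \<subseteq> W" | "\<gamma> \<in> E" | i where "keys \<gamma> \<subseteq> W" "i \<in> W" "N i \<le> lookup \<gamma> i"
        unfolding E_def by force
      then show "single \<gamma> 1 \<in> S"
      proof cases
        case (3 i)
        define \<gamma>' where "\<gamma>' = \<gamma> - single i (N i)"
        have e: "\<gamma> = single i (N i) + \<gamma>'"
          using 3(3) by (intro poly_mapping_eqI) (auto simp: \<gamma>'_def lookup_add lookup_minus lookup_single when_def)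
        have d: "d = N i + mdeg \<gamma>'" using g e mdeg_add[of "single i (N i)" \<gamma>'] by (simp add: mdeg_single)
        have "single \<gamma> 1 = (var i ^ N i - q i) * single \<gamma>' 1 + q i * single \<gamma>' 1"
          by (subst e) (simp add: var_power mult_single left_diff_distrib)
        also have "\<dots> \<in> S"
        proof (rule S_add)
          show "(var i ^ N i - q i) * single \<gamma>' 1 \<in> S" using N(2)[OF 3(2)] mI(4) S_I by blast
          let ?z = "q i * single \<gamma>' 1"
          have z: "?z \<in> outside_monos W" using q(1)[OF 3(2)] is_idealD(4)[OF outside_monos_ideal] by blast
          have "homog (mdeg \<gamma>') (single \<gamma>' 1)" by (simp add: homog_def)
          then have "homog d ?z" unfolding d by (intro homog_mult q(2) 3(2))
          then have "single \<beta> 1 \<in> S" if "\<beta> \<in> keys ?z" for \<beta>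
            using z that by (intro A) (auto simp: homog_def outside_monos_def)
          then have "(\<Sum>\<beta>\<in>keys ?z. single \<beta> (lookup ?z \<beta>)) \<in> S"
            by (rule S_sum[OF S_single])
          then show "?z \<in> S" unfolding poly_mapping_sum_single[of ?z, symmetric] .
        qed
        finally show ?thesis .
      qed (use A g S_E in auto)
    qed
  qed
  then have all: "single \<gamma> c \<in> S" for \<gamma> c by (simp add: S_single)
  have "p \<in> S" for p
  proof -
    have "(\<Sum>\<beta>\<in>keys p. single \<beta> (lookup p \<beta>)) \<in> S" by (rule S_sum) (rule all)
    then show ?thesis unfolding poly_mapping_sum_single[of p, symmetric] .
  qed
  then have "\<exists>b. (\<forall>e\<in>E. b e \<in> monos_in V) \<and> p - (\<Sum>e\<in>E. b e * single e 1) \<in> I" for p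
    unfolding S_def mem_Collect_eq .
  moreover have "0 \<in> E" using N(1) by (simp add: E_def)
  ultimately show ?thesis using finE by (intro exI[of _ E] conjI allI)
qed

text \<open>The Leibniz expansion uses only ring operations. Coefficient rings such as
  \<open>monos_in V\<close> are sets and not types, so the closure of determinants is stated for a
  subset \<open>B\<close>.\<close>

lemma det_in_subring:
  fixes A :: "'a::comm_ring_1 mat"
  assumes A: "A \<in> carrier_mat n n" "\<And>i j. i < n \<Longrightarrow> j < n \<Longrightarrow> A $$ (i, j) \<in> B"
    and B: "0 \<in> B" "1 \<in> B" "\<And>p q. p \<in> B \<Longrightarrow> q \<in> B \<Longrightarrow> p + q \<in> B"
      "\<And>p. p \<in> B \<Longrightarrow> - p \<in> B" "\<And>p q. p \<in> B \<Longrightarrow> q \<in> B \<Longrightarrow> p * q \<in> B"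
  shows "det A \<in> B"
proof -
  have s: "sum f S \<in> B" if "\<And>s. s \<in> S \<Longrightarrow> f s \<in> B" for f :: "'c \<Rightarrow> 'a" and S
    using that by (induction S rule: infinite_finite_induct) (auto intro: B)
  have p: "prod f S \<in> B" if "\<And>s. s \<in> S \<Longrightarrow> f s \<in> B" for f :: "'c \<Rightarrow> 'a" and S
    using that by (induction S rule: infinite_finite_induct) (auto intro: B)
  show ?thesis unfolding det_def'[OF A(1)]
  proof (intro s)
    fix \<pi> assume "\<pi> \<in> {\<pi>. \<pi> permutes {0..<n}}"
    then have \<pi>: "\<pi> i < n" if "i < n" for i using that by (simp add: permutes_nat_less)
    have *: "(\<Prod>i = 0..<n. A $$ (i, \<pi> i)) \<in> B"
      by (rule p) (simp add: A(2) \<pi>)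
    have "signof \<pi> = (1 :: 'a) \<or> signof \<pi> = (- 1 :: 'a)" by (cases \<pi> rule: sign_cases) simp_all
    then show "signof \<pi> * (\<Prod>i = 0..<n. A $$ (i, \<pi> i)) \<in> B"
    proof
      assume "signof \<pi> = (1 :: 'a)" then show ?thesis using * by (simp only: mult_1_left)
    next
      assume "signof \<pi> = (- 1 :: 'a)" then show ?thesis using B(4)[OF *] by (simp only: mult_minus_left mult_1_left)
    qed
  qed
qed

text \<open>Cayley-Hamilton: multiplication by \<open>var j\<close> on a finite spanning set modulo
  \<open>I\<close> has a matrix with entries in \<open>monos_in V\<close>, and its characteristic
  polynomial at \<open>var j\<close> lies in \<open>I\<close>. It is monic of degree
  \<open>card E\<close>, and the component of that degree keeps the term
  \<open>var j ^ card E\<close>.\<close>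

theorem homogeneous_integral_equation:
  fixes I :: "cpoly set"
  assumes I: "is_ideal I" and hom: "\<And>p d. p \<in> I \<Longrightarrow> hcomp d p \<in> I"
    and W: "finite W" and VW: "V \<inter> W = {}" and rest: "\<And>i. i \<notin> V \<union> W \<Longrightarrow> var i \<in> I"
    and pow: "\<And>j. j \<in> W \<Longrightarrow> \<exists>N. \<exists>p\<in>I. var j ^ N - p \<in> outside_monos W"
    and j: "j \<in> W"
  shows "\<exists>N. \<exists>P\<in>I. homog N P \<and> P \<in> monos_in (insert j V) \<and> lookup P (single j N) = 1"
proof -
  note mI = is_idealD[OF I]
  have "\<exists>E. finite E \<and> 0 \<in> E \<and> (\<forall>p. \<exists>b. (\<forall>e\<in>E. b e \<in> monos_in V)
      \<and> p - (\<Sum>e\<in>E. b e * single e 1) \<in> I)"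
    by (rule finite_monomial_spanning_set[OF I hom W rest pow])
  then obtain E where E: "finite E" "0 \<in> E"
    and span: "\<forall>p. \<exists>b. (\<forall>e\<in>E. b e \<in> monos_in V) \<and> p - (\<Sum>e\<in>E. b e * single e 1) \<in> I"
    by (elim exE conjE)
  obtain e where e: "bij_betw e {0..<card E} E" using ex_bij_betw_nat_finite[OF E(1)] by blast
  let ?Q = "card E"
  have "\<forall>q. \<exists>b. (\<forall>e\<in>E. b e \<in> monos_in V)
      \<and> var j * single q 1 - (\<Sum>e\<in>E. b e * single e 1) \<in> I"
    by (rule allI) (rule spec[OF span])
  then obtain c where c: "\<And>q d. d \<in> E \<Longrightarrow> c q d \<in> monos_in V"
    "\<And>q. var j * single q 1 - (\<Sum>d\<in>E. c q d * single d 1) \<in> I"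
    unfolding choice_iff by blast
  define A where "A = mat ?Q ?Q (\<lambda>(k, l). c (e k) (e l))"
  define X where "X = mat ?Q ?Q (\<lambda>(k, l). (if k = l then var j else 0) - c (e k) (e l))"
  have AX: "A \<in> carrier_mat ?Q ?Q" "X \<in> carrier_mat ?Q ?Q" by (simp_all add: A_def X_def)
  have eE: "e k \<in> E" if "k < ?Q" for k using e that by (auto simp: bij_betw_def)
  define f where "f k = (single (e k) 1 :: cpoly)" for k
  have row: "(\<Sum>l<?Q. X $$ (k, l) * f l) \<in> I" if k: "k < ?Q" for k
  proof -
    have "(\<Sum>l<?Q. X $$ (k, l) * f l) = (\<Sum>l<?Q. (if k = l then var j * f l else 0) - c (e k) (e l) * f l)"
      using k by (intro sum.cong refl) (simp add: X_def algebra_simps)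
    also have "\<dots> = var j * f k - (\<Sum>l<?Q. c (e k) (e l) * f l)"
      using k by (simp add: sum_subtractf)
    also have "(\<Sum>l<?Q. c (e k) (e l) * f l) = (\<Sum>d\<in>E. c (e k) d * single d 1)"
      using sum.reindex_bij_betw[OF e, of "\<lambda>d. c (e k) d * single d 1"]
      by (simp add: f_def atLeast0LessThan)
    finally show ?thesis using c(2)[of "e k"] by (simp add: f_def)
  qed
  \<comment> \<open>Multiplying the rows by the adjugate shows that \<open>det X\<close> times any
    spanning monomial lies in \<open>I\<close>. The monomial 1 is one of them, because
    \<open>0\<close> is in \<open>E\<close>, and it yields \<open>det X\<close> itself.\<close>
  have detI: "det X \<in> I"
  proof -
    have "0 \<in> e ` {0..<?Q}" using bij_betw_imp_surj_on[OF e] E(2) by simp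
    then obtain z where z: "z < ?Q" "e z = 0" by auto
    let ?J = "adj_mat X"
    have J: "?J \<in> carrier_mat ?Q ?Q" "?J * X = det X \<cdot>\<^sub>m 1\<^sub>m ?Q" using adj_mat[OF AX(2)] by auto
    have "(\<Sum>k<?Q. ?J $$ (z, k) * (\<Sum>l<?Q. X $$ (k, l) * f l)) \<in> I"
      by (intro is_ideal_sum[OF I] mI(3) row) simp
    also have "(\<Sum>k<?Q. ?J $$ (z, k) * (\<Sum>l<?Q. X $$ (k, l) * f l))
      = (\<Sum>l<?Q. (\<Sum>k<?Q. ?J $$ (z, k) * X $$ (k, l)) * f l)"
      unfolding sum_distrib_left sum_distrib_right
      by (subst sum.swap) (simp add: mult.assoc)
    also have "\<dots> = (\<Sum>l<?Q. (?J * X) $$ (z, l) * f l)"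
      using z J(1) AX(2) by (intro sum.cong refl) (auto simp: scalar_prod_def atLeast0LessThan)
    also have "\<dots> = (\<Sum>l<?Q. if l = z then det X * f z else 0)"
      unfolding J(2) using z by (intro sum.cong refl) auto
    also have "\<dots> = det X" using z by (simp add: f_def)
    finally show ?thesis .
  qed
  \<comment> \<open>The determinant is recognised as a characteristic polynomial evaluated at
    \<open>var j\<close>, which supplies its degree and leading coefficient.\<close>
  let ?\<chi> = "char_poly A"
  have deg: "degree ?\<chi> = ?Q" "coeff ?\<chi> ?Q = 1" using degree_monic_char_poly[OF AX(1)] by auto
  have "?\<chi> \<in> {p. \<forall>i. coeff p i \<in> monos_in V}"
    unfolding char_poly_def
  proof (rule det_in_subring)
    show "char_poly_matrix A \<in> carrier_mat ?Q ?Q" using AX(1) by simp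
    fix k l assume kl: "k < ?Q" "l < ?Q"
    have "coeff (char_poly_matrix A $$ (k, l)) i \<in> monos_in V" for i
      using kl c(1)[OF eE[OF kl(2)]]
      by (auto simp: char_poly_matrix_def A_def coeff_pCons monos_in_subring split: nat.split)
    then show "char_poly_matrix A $$ (k, l) \<in> {p. \<forall>i. coeff p i \<in> monos_in V}" by blast
  qed (auto simp: monos_in_subring coeff_pCons coeff_mult intro!: monos_in_sum split: nat.split)
  then have coef: "coeff ?\<chi> i \<in> monos_in V" for i by blast
  have "det X = poly ?\<chi> (var j)"
    unfolding char_poly_def
    by (rule poly_det_cong[symmetric]) (use AX in \<open>auto simp: char_poly_matrix_def A_def X_def\<close>)
  then have X: "det X = (\<Sum>i\<le>?Q. coeff ?\<chi> i * var j ^ i)" by (simp add: poly_altdef deg(1))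
  have jV: "j \<notin> V" using VW j by blast
  \<comment> \<open>The coefficients do not involve the variable \<open>j\<close>, so a term below
    the top cannot contain the pure power \<open>var j ^ card E\<close>.\<close>
  have lk: "lookup (coeff ?\<chi> i * var j ^ i) (single j ?Q) = 0" if "i < ?Q" for i
  proof (rule ccontr)
    assume "\<not> ?thesis"
    then have "single j ?Q \<in> keys (coeff ?\<chi> i * var j ^ i)" by (simp add: in_keys_iff)
    then obtain \<beta> where \<beta>: "\<beta> \<in> keys (coeff ?\<chi> i)" "single j ?Q = \<beta> + single j i"
      using keys_mult[of "coeff ?\<chi> i" "var j ^ i"] unfolding var_power by auto
    have "keys \<beta> \<subseteq> V" using coef[of i] \<beta>(1) by (simp add: monos_in_def)
    then have "lookup \<beta> j = 0" using jV by (auto simp: in_keys_iff)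
    moreover have "?Q = lookup \<beta> j + i" using arg_cong[OF \<beta>(2), of "\<lambda>x. lookup x j"] by (simp add: lookup_add)
    ultimately show False using that by simp
  qed
  have "lookup (det X) (single j ?Q)
    = (\<Sum>i\<le>?Q. if i = ?Q then lookup (coeff ?\<chi> i * var j ^ i) (single j ?Q) else 0)"
    unfolding X lookup_sum using lk by (intro sum.cong refl) auto
  also have "\<dots> = 1" by (simp add: deg(2) var_power)
  finally have 1: "lookup (hcomp ?Q (det X)) (single j ?Q) = 1" by (simp add: lookup_keep mdeg_single)
  have "monos_in V \<subseteq> monos_in (insert j V)" by (auto simp: monos_in_def)
  then have "det X \<in> monos_in (insert j V)"
    unfolding X using coef by (intro monos_in_sum monos_in_subring(5) monos_in_power monos_in_subring(6)) auto
  then have "hcomp ?Q (det X) \<in> monos_in (insert j V)" by (auto simp: monos_in_def keys_keep)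
  then show ?thesis using 1 hom[OF detI] homog_hcomp by metis
qed

section \<open>Constant coefficient operators\<close>

lemma weyl_simps [simp]:
  "monoid.mult (weyl n) = weyl_mult" "one (weyl n) = single 0 1"
  "zero (weyl n) = 0" "add (weyl n) = (+)"
  by (simp_all add: weyl_def)

lemma weyl_carrier_iff: "P \<in> carrier (weyl n) \<longleftrightarrow> keys P \<subseteq> mindices n \<times> mindices n"
  by (simp add: weyl_def)

text \<open>The operator \<open>q(\<partial>)\<close> in the \<open>n\<close>-th Weyl algebra.
  Monomials with a variable outside \<open>1..n\<close> are sent to 0, which gives a ring
  homomorphism on all of \<open>cpoly\<close>.\<close>

definition const_op :: "nat \<Rightarrow> cpoly \<Rightarrow> weyl_elem" where
  "const_op n q = (\<Sum>\<beta>\<in>keys q. if \<beta> \<in> mindices n then single (0, \<beta>) (lookup q \<beta>) else 0)"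

lemma const_op_superset:
  "finite S \<Longrightarrow> keys q \<subseteq> S \<Longrightarrow>
    const_op n q = (\<Sum>\<beta>\<in>S. if \<beta> \<in> mindices n then single (0, \<beta>) (lookup q \<beta>) else 0)"
  unfolding const_op_def by (rule sum.mono_neutral_left) (auto simp: in_keys_iff)

lemma const_op_single:
  "const_op n (single \<beta> c) = (if \<beta> \<in> mindices n then single (0, \<beta>) c else 0)"
  by (subst const_op_superset[of "{\<beta>}"]) auto

lemma const_op_0: "const_op n 0 = 0"
  by (simp add: const_op_def)

lemma const_op_add: "const_op n (p + q) = const_op n p + const_op n q"
proof -
  let ?S = "keys p \<union> keys q"
  have "const_op n (p + q) = (\<Sum>\<beta>\<in>?S. (if \<beta> \<in> mindices n then single (0, \<beta>) (lookup p \<beta>) else 0)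
      + (if \<beta> \<in> mindices n then single (0, \<beta>) (lookup q \<beta>) else 0))"
    using Poly_Mapping.keys_add[of p q]
    by (subst const_op_superset[of ?S]) (auto simp: lookup_add single_add intro!: sum.cong)
  then show ?thesis by (simp add: sum.distrib const_op_superset[of ?S])
qed

lemma const_op_sum: "const_op n (sum f S) = (\<Sum>s\<in>S. const_op n (f s))"
  by (induction S rule: infinite_finite_induct) (simp_all add: const_op_0 const_op_add)

lemma const_op_1: "const_op n 1 = single 0 1"
proof -
  have "const_op n (single 0 1) = single 0 1"
    unfolding const_op_single by (simp add: mindices_def zero_prod_def)
  then show ?thesis by simp
qed

lemma lookup_const_op:
  "lookup (const_op n q) p = (if fst p = 0 \<and> snd p \<in> mindices n then lookup q (snd p) else 0)"
proof -
  obtain \<alpha> \<beta> where p: "p = (\<alpha>, \<beta>)" by (cases p)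
  have "lookup (const_op n q) p
    = (\<Sum>\<gamma>\<in>keys q. if \<gamma> = \<beta> then (if \<alpha> = 0 \<and> \<beta> \<in> mindices n then lookup q \<beta> else 0) else 0)"
    unfolding const_op_def lookup_sum p by (intro sum.cong refl) (auto simp: lookup_single when_def)
  then show ?thesis by (auto simp: p in_keys_iff)
qed

lemma const_op_closed: "const_op n q \<in> carrier (weyl n)"
proof -
  have "p \<in> mindices n \<times> mindices n" if "p \<in> keys (const_op n q)" for p
  proof -
    have "lookup (const_op n q) p \<noteq> 0" using that by (simp add: in_keys_iff)
    then have "fst p = 0" "snd p \<in> mindices n" by (simp_all add: lookup_const_op split: if_splits)
    moreover have "0 \<in> mindices n" by (simp add: mindices_def)
    ultimately show ?thesis by (cases p) simp
  qed
  then show ?thesis unfolding weyl_carrier_iff by blast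
qed

lemma leibniz_set_0: "leibniz_set \<beta> 0 = {0}" "leibniz_set 0 \<beta> = {0}"
  by (auto simp: leibniz_set_def intro!: poly_mapping_eqI)

lemma weyl_monom_mult_eq:
  "weyl_monom_mult (\<alpha>, \<beta>) (\<gamma>, \<delta>) c = (\<Sum>\<kappa>\<in>leibniz_set \<beta> \<gamma>.
     single (\<alpha> + (\<gamma> - \<kappa>), \<beta> - \<kappa> + \<delta>) (c * of_nat (leibniz_coef \<beta> \<gamma> \<kappa>)))"
  by (simp add: weyl_monom_mult_def leibniz_set_def leibniz_coef_def)

lemma weyl_mult_single_trivial:
  "\<beta> = 0 \<or> \<gamma> = 0 \<Longrightarrow> weyl_mult (single (\<alpha>, \<beta>) c) (single (\<gamma>, \<delta>) d)
    = single (\<alpha> + \<gamma>, \<beta> + \<delta>) (c * d)"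
  by (auto simp: weyl_mult_single weyl_monom_mult_eq leibniz_set_0 leibniz_coef_def)

text \<open>Both directions matter: they make the truncation in \<open>const_op\<close>
  multiplicative.\<close>

lemma mindices_add_iff: "\<beta> + \<gamma> \<in> mindices n \<longleftrightarrow> \<beta> \<in> mindices n \<and> \<gamma> \<in> mindices n"
  by (simp add: mindices_def keys_add_mindex)

lemma const_op_mult: "const_op n (p * q) = weyl_mult (const_op n p) (const_op n q)"
proof -
  have 1: "const_op n (single \<beta> c * single \<gamma> d)
    = weyl_mult (const_op n (single \<beta> c)) (const_op n (single \<gamma> d))" for \<beta> \<gamma> c d
    by (simp add: mult_single const_op_single mindices_add_iff weyl_mult_0 weyl_mult_single_trivial)
  have 2: "const_op n (single \<beta> c * q)
    = weyl_mult (const_op n (single \<beta> c)) (const_op n q)" for \<beta> c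
    by (rule additive_eq[of "\<lambda>q. const_op n (single \<beta> c * q)"])
      (simp_all only: 1 const_op_sum sum_distrib_left weyl_mult_sum_right)
  show ?thesis
    by (rule additive_eq[of "\<lambda>p. const_op n (p * q)"])
      (simp_all only: 2 const_op_sum sum_distrib_right weyl_mult_sum_left)
qed

text \<open>The formal partial derivative, which arises as the commutator of
  \<open>q(\<partial>)\<close> with \<open>x_i\<close>. The truncated subtraction does no harm,
  since the coefficient vanishes when the exponent of \<open>i\<close> is 0.\<close>

definition pdiff :: "nat \<Rightarrow> cpoly \<Rightarrow> cpoly" where
  "pdiff i q = (\<Sum>\<beta>\<in>keys q. single (\<beta> - single i 1) (lookup q \<beta> * of_nat (lookup \<beta> i)))"

lemma pdiff_superset:
  "finite S \<Longrightarrow> keys q \<subseteq> S \<Longrightarrow>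
    pdiff i q = (\<Sum>\<beta>\<in>S. single (\<beta> - single i 1) (lookup q \<beta> * of_nat (lookup \<beta> i)))"
  unfolding pdiff_def by (rule sum.mono_neutral_left) (auto simp: in_keys_iff)

lemma pdiff_single:
  "pdiff i (single \<beta> c) = single (\<beta> - single i 1) (c * of_nat (lookup \<beta> i))"
  by (subst pdiff_superset[of "{\<beta>}"]) auto

lemma pdiff_0: "pdiff i 0 = 0"
  by (simp add: pdiff_def)

lemma pdiff_add: "pdiff i (p + q) = pdiff i p + pdiff i q"
proof -
  let ?S = "keys p \<union> keys q"
  show ?thesis
    using Poly_Mapping.keys_add[of p q]
    by (simp add: pdiff_superset[of ?S] lookup_add distrib_right single_add sum.distrib)
qed

lemma pdiff_sum: "pdiff i (sum f S) = (\<Sum>s\<in>S. pdiff i (f s))"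
  by (induction S rule: infinite_finite_induct) (simp_all add: pdiff_0 pdiff_add)

lemma mindex_shift:
  fixes \<beta> :: mindex
  shows "0 < lookup \<beta> i \<Longrightarrow> \<beta> = \<beta> - single i 1 + single i 1"
  by (rule poly_mapping_eqI) (auto simp: lookup_add lookup_minus lookup_single when_def)

lemma lookup_pdiff:
  "lookup (pdiff i q) \<beta> = of_nat (Suc (lookup \<beta> i)) * lookup q (\<beta> + single i 1)"
proof -
  let ?b = "\<beta> + single i 1"
  have "lookup (pdiff i q) \<beta> = (\<Sum>\<gamma>\<in>keys q. if \<gamma> = ?b then of_nat (Suc (lookup \<beta> i)) * lookup q ?b else 0)"
    unfolding pdiff_def lookup_sum
  proof (intro sum.cong refl)
    fix \<gamma> assume "\<gamma> \<in> keys q"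
    show "lookup (single (\<gamma> - single i 1) (lookup q \<gamma> * of_nat (lookup \<gamma> i))) \<beta>
      = (if \<gamma> = ?b then of_nat (Suc (lookup \<beta> i)) * lookup q ?b else 0)"
    proof (cases "\<gamma> = ?b")
      case True
      then show ?thesis by (simp add: lookup_add)
    next
      case False
      then have "lookup \<gamma> i = 0 \<or> \<gamma> - single i 1 \<noteq> \<beta>" using mindex_shift[of \<gamma> i] by auto
      then show ?thesis using False by (auto simp: lookup_single when_def)
    qed
  qed
  then show ?thesis by (auto simp: in_keys_iff)
qed

lemma keys_pdiff: "\<beta> \<in> keys (pdiff i q) \<Longrightarrow> \<beta> + single i 1 \<in> keys q"
  by (simp add: in_keys_iff lookup_pdiff)

lemma homog_pdiff: "homog (Suc d) q \<Longrightarrow> homog d (pdiff i q)"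
  by (fastforce simp: homog_def mdeg_add mdeg_single dest!: keys_pdiff)

lemma pdiff_monos_in: "q \<in> monos_in V \<Longrightarrow> pdiff i q \<in> monos_in V"
  by (fastforce simp: monos_in_def keys_add_mindex dest!: keys_pdiff)

lemma pdiff_eq_0:
  assumes "q \<in> monos_in V" "i \<notin> V" shows "pdiff i q = 0"
proof -
  have "\<beta> \<notin> keys (pdiff i q)" for \<beta>
  proof
    assume "\<beta> \<in> keys (pdiff i q)"
    then have "keys (\<beta> + single i 1) \<subseteq> V" using assms(1) keys_pdiff by (simp add: monos_in_def)
    then show False using assms(2) by (simp add: keys_add_mindex)
  qed
  then have "keys (pdiff i q) = {}" by blast
  then show ?thesis by simp
qed

text \<open>A single factor \<open>x_i\<close> admits at most one contraction, so commuting past it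
  leaves two terms of the Leibniz formula.\<close>

lemma leibniz_set_single_1:
  "leibniz_set \<beta> (single i 1) = (if lookup \<beta> i = 0 then {0} else {0, single i 1})"
proof -
  have z: "\<kappa> = 0 \<or> \<kappa> = single i 1" if "\<kappa> \<in> leibniz_set \<beta> (single i 1)" for \<kappa>
  proof -
    have *: "lookup \<kappa> l \<le> (if l = i then 1 else 0)" for l
      using that by (auto simp: leibniz_set_def lookup_single when_def dest: spec[of _ l] split: if_splits)
    show ?thesis
    proof (cases "lookup \<kappa> i = 0")
      case True
      have "\<kappa> = 0" by (rule poly_mapping_eqI) (metis * True le_zero_eq lookup_zero)
      then show ?thesis ..
    next
      case False
      then have "lookup \<kappa> i = 1" using *[of i] by simp
      then have "\<kappa> = single i 1"
        using * by (intro poly_mapping_eqI) (metis le_zero_eq lookup_single_eq lookup_single_not_eq)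
      then show ?thesis ..
    qed
  qed
  have "lookup \<kappa> i \<le> lookup \<beta> i" if "\<kappa> \<in> leibniz_set \<beta> (single i 1)" for \<kappa>
    using that by (auto simp: leibniz_set_def)
  with z have 1: "leibniz_set \<beta> (single i 1) \<subseteq> (if lookup \<beta> i = 0 then {0} else {0, single i 1})"
    by fastforce
  have 2: "lookup \<beta> i \<noteq> 0 \<Longrightarrow> single i 1 \<in> leibniz_set \<beta> (single i 1)"
    by (auto simp: leibniz_set_def lookup_single when_def)
  have 3: "0 \<in> leibniz_set \<beta> (single i 1)" by (auto simp: leibniz_set_def)
  from 1 2 3 show ?thesis by auto
qed

lemma xvar_eq: "xvar i = single (single i 1, 0) 1"
  by (simp add: xvar_def)

lemma const_op_xvar:
  assumes i: "i \<in> {1..n}"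
  shows "weyl_mult (const_op n q) (xvar i) = weyl_mult (xvar i) (const_op n q) + const_op n (pdiff i q)"
proof (rule additive_eq[of "\<lambda>q. weyl_mult (const_op n q) (xvar i)"])
  fix \<beta> c
  let ?e = "single i (1::nat)"
  show "weyl_mult (const_op n (single \<beta> c)) (xvar i)
    = weyl_mult (xvar i) (const_op n (single \<beta> c)) + const_op n (pdiff i (single \<beta> c))"
  proof (cases "\<beta> \<in> mindices n")
    case False
    \<comment> \<open>As \<open>i\<close> is at most \<open>n\<close>, lowering the exponent of
      \<open>i\<close> cannot bring a truncated monomial back into range, so the derivative term is
      truncated as well.\<close>
    have "lookup \<beta> i = 0 \<or> \<beta> - ?e \<notin> mindices n"
    proof (rule ccontr)
      assume a: "\<not> ?thesis"
      then have "\<beta> - ?e \<in> mindices n" "?e \<in> mindices n" using i by (auto simp: mindices_def)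
      then have "\<beta> - ?e + ?e \<in> mindices n" by (rule mindices_closed(1))
      moreover have "\<beta> = \<beta> - ?e + ?e" using a by (intro mindex_shift) simp
      ultimately show False using False by metis
    qed
    then show ?thesis using False by (auto simp: const_op_single pdiff_single weyl_mult_0)
  next
    case True
    have "weyl_mult (single (0, \<beta>) c) (xvar i)
      = (\<Sum>\<kappa>\<in>leibniz_set \<beta> ?e. single (?e - \<kappa>, \<beta> - \<kappa>) (c * of_nat (leibniz_coef \<beta> ?e \<kappa>)))"
      by (simp add: xvar_eq weyl_mult_single weyl_monom_mult_eq)
    also have "\<dots> = single (?e, \<beta>) c + single (0, \<beta> - ?e) (c * of_nat (lookup \<beta> i))"
    proof (cases "lookup \<beta> i = 0")
      case True
      then show ?thesis unfolding leibniz_set_single_1 by (simp add: leibniz_coef_def)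
    next
      case False
      have "?e \<noteq> 0" by (metis lookup_single_eq lookup_zero zero_neq_one)
      then show ?thesis using False unfolding leibniz_set_single_1 by (simp add: leibniz_coef_def)
    qed
    also have "single (?e, \<beta>) c = weyl_mult (xvar i) (single (0, \<beta>) c)"
      by (simp add: xvar_eq weyl_mult_single_trivial)
    finally show ?thesis using True mindices_closed(2)[OF True, of ?e] by (simp add: const_op_single pdiff_single)
  qed
qed (simp_all only: const_op_sum pdiff_sum weyl_mult_sum_left weyl_mult_sum_right sum.distrib)

lemma const_op_commute:
  assumes "q \<in> monos_in V" "l \<notin> V" "l \<in> {1..n}"
  shows "weyl_mult (const_op n q) (xvar l) = weyl_mult (xvar l) (const_op n q)"
  using const_op_xvar[OF assms(3)] pdiff_eq_0[OF assms(1,2)] by (simp add: const_op_0)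

lemma xvar_closed: "i \<in> {1..n} \<Longrightarrow> xvar i \<in> carrier (weyl n)"
  by (auto simp: weyl_carrier_iff xvar_eq mindices_def)

lemma xvar_commute: "weyl_mult (xvar i) (xvar j) = weyl_mult (xvar j) (xvar i)"
  by (simp add: xvar_eq weyl_mult_single_trivial add.commute)

section \<open>Weights\<close>

lemma mindices_lookup: "\<alpha> \<in> mindices n \<Longrightarrow> i \<notin> {1..n} \<Longrightarrow> lookup \<alpha> i = 0"
  by (auto simp: mindices_def in_keys_iff)

lemma mdeg_mindices: "\<alpha> \<in> mindices n \<Longrightarrow> mdeg \<alpha> = (\<Sum>i = 1..n. lookup \<alpha> i)"
  by (rule mdeg_superset) (auto simp: mindices_def)

text \<open>Uniform in \<open>P\<close>: for \<open>P = 0\<close> the maximum in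
  \<open>weyl_ord\<close> runs over the empty set, whereas the condition on keys is vacuous.\<close>

lemma weyl_filt_iff:
  "P \<in> weyl_filt n uv k \<longleftrightarrow> P \<in> carrier (weyl n) \<and> (\<forall>p\<in>keys P. monom_weight n uv p \<le> k)"
proof (cases "P = 0")
  case True
  then show ?thesis by (simp add: weyl_filt_def weyl_carrier_iff)
next
  case False
  then have "keys P \<noteq> {}" by simp
  then show ?thesis using False by (simp add: weyl_filt_def weyl_ord_def)
qed

lemma weyl_filt_add: "P \<in> weyl_filt n uv k \<Longrightarrow> Q \<in> weyl_filt n uv k \<Longrightarrow> P + Q \<in> weyl_filt n uv k"
  using Poly_Mapping.keys_add[of P Q] by (auto simp: weyl_filt_iff weyl_carrier_iff)

lemma weyl_filt_mono: "k \<le> l \<Longrightarrow> weyl_filt n uv k \<subseteq> weyl_filt n uv l"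
  unfolding subset_iff weyl_filt_iff by (meson order_trans)

lemma zero_weyl_filt: "0 \<in> weyl_filt n uv k"
  by (simp add: weyl_filt_iff weyl_carrier_iff)

lemma weyl_comp_eq_keep: "weyl_comp n uv d P = keep (\<lambda>p. monom_weight n uv p = d) P"
  by (simp add: weyl_comp_def keep_def)

lemma weyl_comp_filt: "P \<in> carrier (weyl n) \<Longrightarrow> weyl_comp n uv d P \<in> weyl_filt n uv d"
  by (auto simp: weyl_comp_eq_keep weyl_filt_iff weyl_carrier_iff keys_keep)

lemma weyl_comp_closed: "P \<in> carrier (weyl n) \<Longrightarrow> weyl_comp n' uv d P \<in> carrier (weyl n)"
  by (auto simp: weyl_comp_eq_keep weyl_carrier_iff keys_keep)

lemma monom_weight_V_add:
  "monom_weight n (V_weight w) (\<alpha> + \<gamma>, \<beta> + \<delta>)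
    = monom_weight n (V_weight w) (\<alpha>, \<beta>) + monom_weight n (V_weight w) (\<gamma>, \<delta>)"
  by (simp add: monom_weight_def V_weight_def lookup_add sum.distrib[symmetric] algebra_simps)

lemma monom_weight_V_cancel: "monom_weight n (V_weight w) (\<kappa>, \<kappa>) = 0"
  by (simp add: monom_weight_def V_weight_def)

text \<open>A Leibniz contraction removes the same \<kappa> from an exponent of \<open>x\<close> and
  from one of \<open>\<partial>\<close>, and \<open>(\<kappa>, \<kappa>)\<close> has
  \<open>V\<close>-weight 0. Hence weights add exactly, for arbitrary \<open>w\<close>.\<close>

lemma keys_weyl_mult_V_weight:
  assumes "p \<in> keys (weyl_mult P Q)"
  shows "\<exists>a\<in>keys P. \<exists>b\<in>keys Q. monom_weight n (V_weight w) p
    = monom_weight n (V_weight w) a + monom_weight n (V_weight w) b"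
proof -
  have "keys (weyl_mult P Q) \<subseteq> (\<Union>a\<in>keys P. \<Union>b\<in>keys Q. keys (weyl_monom_mult a b (lookup P a * lookup Q b)))"
    unfolding weyl_mult_def by (intro weyl_carrier_sum) blast
  with assms obtain a b where ab: "a \<in> keys P" "b \<in> keys Q"
    "p \<in> keys (weyl_monom_mult a b (lookup P a * lookup Q b))" by blast
  obtain \<alpha> \<beta> \<gamma> \<delta> where e: "a = (\<alpha>, \<beta>)" "b = (\<gamma>, \<delta>)" by (metis surj_pair)
  have "keys (weyl_monom_mult a b (lookup P a * lookup Q b)) \<subseteq> (\<lambda>\<kappa>. (\<alpha> + (\<gamma> - \<kappa>), \<beta> - \<kappa> + \<delta>)) ` leibniz_set \<beta> \<gamma>"
    unfolding e weyl_monom_mult_eq by (intro weyl_carrier_sum) (auto split: if_splits)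
  then obtain \<kappa> where k: "\<kappa> \<in> leibniz_set \<beta> \<gamma>" "p = (\<alpha> + (\<gamma> - \<kappa>), \<beta> - \<kappa> + \<delta>)" using ab(3) by blast
  have le: "lookup \<kappa> i \<le> lookup \<beta> i" "lookup \<kappa> i \<le> lookup \<gamma> i" for i
    using k(1) by (simp_all add: leibniz_set_def)
  have "lookup (\<alpha> + (\<gamma> - \<kappa>) + \<kappa>) i = lookup (\<alpha> + \<gamma>) i"
    "lookup (\<beta> - \<kappa> + \<delta> + \<kappa>) i = lookup (\<beta> + \<delta>) i" for i
    using le[of i] by (simp_all add: lookup_add lookup_minus)
  then have "\<alpha> + (\<gamma> - \<kappa>) + \<kappa> = \<alpha> + \<gamma>" "\<beta> - \<kappa> + \<delta> + \<kappa> = \<beta> + \<delta>"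
    by (blast intro: poly_mapping_eqI)+
  then have "monom_weight n (V_weight w) p = monom_weight n (V_weight w) (\<alpha> + \<gamma>, \<beta> + \<delta>)"
    using monom_weight_V_add[of n w "\<alpha> + (\<gamma> - \<kappa>)" \<kappa> "\<beta> - \<kappa> + \<delta>" \<kappa>] monom_weight_V_cancel[of n w \<kappa>] k(2) by simp
  then show ?thesis using ab(1,2) unfolding e monom_weight_V_add by blast
qed

lemma weyl_filt_V_mult:
  assumes "P \<in> weyl_filt n (V_weight w) a" "Q \<in> weyl_filt n (V_weight w) b"
  shows "weyl_mult P Q \<in> weyl_filt n (V_weight w) (a + b)"
proof -
  have "weyl_mult P Q \<in> carrier (weyl n)" using assms weyl_mult_closed by (auto simp: weyl_filt_iff)
  moreover have "monom_weight n (V_weight w) p \<le> a + b" if p: "p \<in> keys (weyl_mult P Q)" for p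
  proof -
    obtain x y where xy: "x \<in> keys P" "y \<in> keys Q" "monom_weight n (V_weight w) p
      = monom_weight n (V_weight w) x + monom_weight n (V_weight w) y"
      using keys_weyl_mult_V_weight[OF p, of n w] by blast
    have "monom_weight n (V_weight w) x \<le> a" "monom_weight n (V_weight w) y \<le> b"
      using assms xy(1,2) by (simp_all add: weyl_filt_iff)
    then show ?thesis using xy(3) by simp
  qed
  ultimately show ?thesis by (simp add: weyl_filt_iff)
qed

text \<open>Equality of the weights enters through this formula: it ties the \<open>V\<close>-weight
  to the order, and makes every weight an integral multiple of \<open>c\<close>.\<close>

lemma monom_weight_V_const:
  assumes w: "\<And>i. i \<in> {1..n} \<Longrightarrow> w i = c" and p: "\<alpha> \<in> mindices n" "\<beta> \<in> mindices n"
  shows "monom_weight n (V_weight w) (\<alpha>, \<beta>) = c * (real (mdeg \<beta>) - real (mdeg \<alpha>))"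
proof -
  have "monom_weight n (V_weight w) (\<alpha>, \<beta>) = (\<Sum>i = 1..n. c * (real (lookup \<beta> i) - real (lookup \<alpha> i)))"
    unfolding monom_weight_def V_weight_def using w by (intro sum.cong refl) (simp add: algebra_simps)
  then show ?thesis by (simp add: mdeg_mindices[OF p(1)] mdeg_mindices[OF p(2)] sum_distrib_left[symmetric] sum_subtractf)
qed

lemma monom_weight_order:
  "\<beta> \<in> mindices n \<Longrightarrow> monom_weight n order_weight (\<alpha>, \<beta>) = real (mdeg \<beta>)"
  by (simp add: monom_weight_def order_weight_def mdeg_mindices)

lemma pdiff_mult: "pdiff i (p * q) = pdiff i p * q + p * pdiff i q"
proof -
  let ?e = "single i (1::nat)"
  have 1: "pdiff i (single \<beta> c * single \<gamma> d)
    = pdiff i (single \<beta> c) * single \<gamma> d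
      + single \<beta> c * pdiff i (single \<gamma> d)" for \<beta> \<gamma> c d
  proof -
    \<comment> \<open>The two exponents agree unless the entry of \<beta> at \<open>i\<close> is 0,
      and then the coefficient is 0.\<close>
    have a: "single (\<beta> + \<gamma> - ?e) (c * d * of_nat (lookup \<beta> i))
      = single (\<beta> - ?e + \<gamma>) (c * d * of_nat (lookup \<beta> i))" for \<beta> \<gamma> :: mindex and c d :: complex
    proof (cases "lookup \<beta> i = 0")
      case False
      then have "\<beta> + \<gamma> - ?e = \<beta> - ?e + \<gamma>"
        by (intro poly_mapping_eqI) (auto simp: lookup_add lookup_minus lookup_single when_def)
      then show ?thesis by simp
    qed simp
    show ?thesis
      using a[of \<beta> \<gamma> c d] a[of \<gamma> \<beta> c d]
      by (simp add: mult_single pdiff_single lookup_add distrib_left single_add add.commute mult_ac)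
  qed
  have 2: "pdiff i (single \<beta> c * q)
    = pdiff i (single \<beta> c) * q + single \<beta> c * pdiff i q" for \<beta> c
    by (rule additive_eq[of "\<lambda>q. pdiff i (single \<beta> c * q)"])
      (simp_all only: 1 pdiff_sum sum_distrib_left sum.distrib)
  show ?thesis
    by (rule additive_eq[of "\<lambda>p. pdiff i (p * q)"])
      (simp_all only: 2 pdiff_sum sum_distrib_right sum.distrib)
qed

lemma pdiff_power: "pdiff i (p ^ Suc k) = p ^ k * (of_nat (Suc k) * pdiff i p)"
proof (induction k)
  case (Suc k)
  have "pdiff i (p ^ Suc (Suc k)) = pdiff i p * p ^ Suc k + p * pdiff i (p ^ Suc k)"
    by (simp add: pdiff_mult)
  then show ?case unfolding Suc by (simp add: algebra_simps)
qed simp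

text \<open>Every other monomial of degree \<open>d\<close> vanishes at the \<open>i\<close>-th unit
  vector. Reading the coefficient as a value makes it multiplicative, which gives the pure-power
  coefficient of \<open>P ^ K\<close>.\<close>

lemma cpoly_eval_homog:
  assumes "homog d p"
  shows "cpoly_eval p (\<lambda>l. if l = i then 1 else 0) = lookup p (single i d)"
proof -
  let ?a = "\<lambda>l. if l = i then 1 else 0 :: complex"
  have "lookup p \<beta> * mindex_eval ?a \<beta>
    = (if \<beta> = single i d then lookup p (single i d) else 0)"
    if b: "\<beta> \<in> keys p" for \<beta>
  proof (cases "keys \<beta> \<subseteq> {i}")
    case True
    have "\<beta> = single i (lookup \<beta> i)"
      using True by (intro poly_mapping_eqI) (auto simp: lookup_single when_def in_keys_iff)
    moreover have "lookup \<beta> i = mdeg \<beta>" using mdeg_superset[OF _ True] by simp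
    ultimately have "\<beta> = single i d" using b assms by (simp add: homog_def)
    moreover have "mindex_eval ?a \<beta> = 1" using mindex_eval_superset[OF _ True, of ?a] by simp
    ultimately show ?thesis by simp
  next
    case False
    then obtain l where "l \<in> keys \<beta>" "l \<noteq> i" by blast
    then have "mindex_eval ?a \<beta> = 0"
      unfolding mindex_eval_def by (intro prod_zero) (auto simp: in_keys_iff intro!: bexI[of _ l])
    moreover have "\<beta> \<noteq> single i d" using False by (auto split: if_splits)
    ultimately show ?thesis by simp
  qed
  then have "cpoly_eval p ?a = (\<Sum>\<beta>\<in>keys p. if \<beta> = single i d then lookup p (single i d) else 0)"
    unfolding cpoly_eval_def by (rule sum.cong[OF refl])
  then show ?thesis by (simp add: in_keys_iff)
qed

section \<open>Modules over the Weyl algebra\<close>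

lemma (in abelian_monoid) finsum_mem:
  assumes "H \<subseteq> carrier G" "\<zero> \<in> H" "\<And>x y. x \<in> H \<Longrightarrow> y \<in> H \<Longrightarrow> x \<oplus> y \<in> H"
    and "\<And>i. i \<in> S \<Longrightarrow> f i \<in> H"
  shows "(\<Oplus>i\<in>S. f i) \<in> H"
  using assms(4)
proof (induction S rule: infinite_finite_induct)
  case (insert x S)
  then have "f \<in> S \<rightarrow> carrier G" "f x \<in> carrier G" using assms(1) by auto
  then show ?case using insert assms(3) by (simp add: finsum_insert)
qed (simp_all add: assms(2))

context left_module
begin

lemma smult_l_null: "x \<in> carrier M \<Longrightarrow> \<zero>\<^bsub>R\<^esub> \<odot>\<^bsub>M\<^esub> x = \<zero>\<^bsub>M\<^esub>"
  using smult_l_distr[of "\<zero>\<^bsub>R\<^esub>" "\<zero>\<^bsub>R\<^esub>" x] smult_closed[of "\<zero>\<^bsub>R\<^esub>" x]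
  by (metis R.zero_closed R.l_zero M.add.l_cancel_one')

lemma smult_r_null: "a \<in> carrier R \<Longrightarrow> a \<odot>\<^bsub>M\<^esub> \<zero>\<^bsub>M\<^esub> = \<zero>\<^bsub>M\<^esub>"
  using smult_r_distr[of a "\<zero>\<^bsub>M\<^esub>" "\<zero>\<^bsub>M\<^esub>"] smult_closed[of a "\<zero>\<^bsub>M\<^esub>"]
  by (metis M.zero_closed M.l_zero M.add.l_cancel_one')

lemma smult_l_minus:
  assumes "a \<in> carrier R" "x \<in> carrier M"
  shows "(\<ominus>\<^bsub>R\<^esub> a) \<odot>\<^bsub>M\<^esub> x = \<ominus>\<^bsub>M\<^esub> (a \<odot>\<^bsub>M\<^esub> x)"
proof (rule M.minus_equality[symmetric])
  show "(\<ominus>\<^bsub>R\<^esub> a) \<odot>\<^bsub>M\<^esub> x \<oplus>\<^bsub>M\<^esub> a \<odot>\<^bsub>M\<^esub> x = \<zero>\<^bsub>M\<^esub>"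
    using smult_l_distr[of "\<ominus>\<^bsub>R\<^esub> a" a x] assms by (simp add: R.l_neg smult_l_null)
qed (use assms smult_closed in auto)

lemma smult_finsum:
  assumes "a \<in> carrier R" "f \<in> S \<rightarrow> carrier M"
  shows "a \<odot>\<^bsub>M\<^esub> (\<Oplus>\<^bsub>M\<^esub>i\<in>S. f i) = (\<Oplus>\<^bsub>M\<^esub>i\<in>S. a \<odot>\<^bsub>M\<^esub> f i)"
  using assms(2)
proof (induction S rule: infinite_finite_induct)
  case (insert x S)
  then have "f \<in> S \<rightarrow> carrier M" "f x \<in> carrier M" by auto
  moreover have "(\<lambda>i. a \<odot>\<^bsub>M\<^esub> f i) \<in> S \<rightarrow> carrier M" using calculation(1) assms(1) smult_closed by auto
  ultimately show ?case using insert assms(1)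
    by (simp add: M.finsum_insert smult_r_distr smult_closed M.finsum_closed)
qed (simp_all add: smult_r_null assms(1))

text \<open>Inverses come from the scalar \<open>-1\<close>, so for sets stable under constants no
  separate argument for negation is needed.\<close>

lemma additive_subgroup_smult:
  assumes "H \<subseteq> carrier M" "\<zero>\<^bsub>M\<^esub> \<in> H" "\<And>x y. x \<in> H \<Longrightarrow> y \<in> H \<Longrightarrow> x \<oplus>\<^bsub>M\<^esub> y \<in> H"
    and neg: "\<And>x. x \<in> H \<Longrightarrow> (\<ominus>\<^bsub>R\<^esub> \<one>\<^bsub>R\<^esub>) \<odot>\<^bsub>M\<^esub> x \<in> H"
  shows "additive_subgroup H M"
proof (rule additive_subgroup.intro, rule subgroup.intro)
  fix x assume "x \<in> H"
  then have "(\<ominus>\<^bsub>R\<^esub> \<one>\<^bsub>R\<^esub>) \<odot>\<^bsub>M\<^esub> x = \<ominus>\<^bsub>M\<^esub> x" using assms(1) by (simp add: smult_l_minus smult_one subset_iff)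
  then show "inv\<^bsub>add_monoid M\<^esub> x \<in> H" using neg[OF \<open>x \<in> H\<close>] by (simp add: a_inv_def)
qed (use assms in auto)

end

lemma weyl_minus_one: "\<ominus>\<^bsub>weyl n\<^esub> \<one>\<^bsub>weyl n\<^esub> = - 1"
proof -
  interpret ring "weyl n" by (rule weyl_ring)
  have 1: "1 \<in> carrier (weyl n)" using one_closed by simp
  then have "- 1 \<in> carrier (weyl n)" by (simp add: weyl_carrier_iff)
  then show ?thesis using 1 by (intro minus_equality) simp_all
qed

lemma minus_one_eq_const_op: "\<ominus>\<^bsub>weyl n\<^esub> \<one>\<^bsub>weyl n\<^esub> = const_op n (const_poly (- 1))"
  unfolding weyl_minus_one const_op_single by (simp add: mindices_def single_uminus zero_prod_def[symmetric])

lemma const_filt: "single 0 c \<in> weyl_filt n uv 0"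
  by (auto simp: weyl_filt_iff weyl_carrier_iff mindices_def monom_weight_def zero_prod_def)

text \<open>With \<open>A\<close> the whole carrier this is the subgroup divided out by the
  restriction; with \<open>A\<close> a level of the filtration it also records the size of the
  coefficients. Strictness compares the two.\<close>

definition xspan :: "nat \<Rightarrow> nat \<Rightarrow> (weyl_elem, 'm) module \<Rightarrow> 'm set \<Rightarrow> 'm set" where
  "xspan j n M A = {\<Oplus>\<^bsub>M\<^esub>l\<in>{j+1..n}. xvar l \<odot>\<^bsub>M\<^esub> a l | a. a \<in> {j+1..n} \<rightarrow> A}"

lemma restr_sub_eq_xspan: "restr_sub j n M = xspan j n M (carrier M)"
  by (simp add: restr_sub_def xspan_def)

locale weyl_module = left_module "weyl n" M for n and M :: "(weyl_elem, 'm) module" (structure)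
begin

abbreviation X :: "nat \<Rightarrow> 'm \<Rightarrow> 'm" where "X i u \<equiv> xvar i \<odot> u"
abbreviation D :: "cpoly \<Rightarrow> 'm \<Rightarrow> 'm" where "D q u \<equiv> const_op n q \<odot> u"

lemma smult_add: "P \<in> carrier (weyl n) \<Longrightarrow> Q \<in> carrier (weyl n) \<Longrightarrow> x \<in> carrier M \<Longrightarrow>
    (P + Q) \<odot> x = P \<odot> x \<oplus> Q \<odot> x"
  using smult_l_distr by simp

lemma smult_mult: "P \<in> carrier (weyl n) \<Longrightarrow> Q \<in> carrier (weyl n) \<Longrightarrow> x \<in> carrier M \<Longrightarrow>
    weyl_mult P Q \<odot> x = P \<odot> (Q \<odot> x)"
  using smult_assoc by simp

lemma smult_0: "x \<in> carrier M \<Longrightarrow> 0 \<odot> x = \<zero>"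
  using smult_l_null by simp

lemma smult_sum:
  assumes "\<And>s. s \<in> S \<Longrightarrow> f s \<in> carrier (weyl n)" "x \<in> carrier M"
  shows "(\<Sum>s\<in>S. f s) \<odot> x = (\<Oplus>s\<in>S. f s \<odot> x)"
  using assms(1)
proof (induction S rule: infinite_finite_induct)
  case (insert s S)
  have "sum f S \<in> carrier (weyl n)"
    unfolding weyl_carrier_iff using insert(4) by (intro weyl_carrier_sum) (auto simp: weyl_carrier_iff[symmetric])
  then show ?case using insert assms(2)
    by (simp add: smult_add, subst M.finsum_insert) (auto simp: smult_closed)
qed (simp_all add: smult_0 assms(2))

lemma D_closed: "u \<in> carrier M \<Longrightarrow> D q u \<in> carrier M"
  by (simp add: smult_closed const_op_closed)

lemma D_mult: "u \<in> carrier M \<Longrightarrow> D (p * q) u = D p (D q u)"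
  by (simp add: const_op_mult smult_mult const_op_closed)

lemma D_1: "u \<in> carrier M \<Longrightarrow> D 1 u = u"
  using smult_one by (simp add: const_op_1)

lemma X_closed: "i \<in> {1..n} \<Longrightarrow> u \<in> carrier M \<Longrightarrow> X i u \<in> carrier M"
  by (intro smult_closed xvar_closed)

lemma D_X: "i \<in> {1..n} \<Longrightarrow> u \<in> carrier M \<Longrightarrow> D q (X i u) = X i (D q u) \<oplus> D (pdiff i q) u"
  using arg_cong[OF const_op_xvar[of i n q], of "\<lambda>P. P \<odot> u"]
  by (simp add: smult_mult smult_add weyl_mult_closed const_op_closed xvar_closed del: atLeastAtMost_iff)

lemma xspan_n: "xspan n n M A = {\<zero>}"
  by (auto simp: xspan_def)

lemma xspan_sub: "A \<subseteq> carrier M \<Longrightarrow> xspan j n M A \<subseteq> carrier M"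
  unfolding xspan_def by (auto intro!: M.finsum_closed X_closed)

lemma xspan_mono: "A \<subseteq> B \<Longrightarrow> xspan j n M A \<subseteq> xspan j n M B"
  unfolding xspan_def by blast

text \<open>Prepares the downward induction on \<open>j\<close> in \<open>xspan_strict\<close>,
  where the coefficient of \<open>x_(j+1)\<close> is treated apart from the later ones.\<close>

lemma xspan_Suc:
  assumes "j < n" "A \<subseteq> carrier M"
  shows "xspan j n M A = {X (Suc j) a \<oplus> y | a y. a \<in> A \<and> y \<in> xspan (Suc j) n M A}"
proof -
  have I: "{j+1..n} = insert (Suc j) {Suc j + 1..n}" using assms(1) by auto
  have fs: "(\<Oplus>l\<in>{j+1..n}. X l (a l)) = X (Suc j) (a (Suc j)) \<oplus> (\<Oplus>l\<in>{Suc j+1..n}. X l (a l))"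
    if "a \<in> {j+1..n} \<rightarrow> A" for a
  proof -
    have "X l (a l) \<in> carrier M" if "l \<in> {j+1..n}" for l
      using that \<open>a \<in> _\<close> assms(2) by (intro X_closed) auto
    then show ?thesis unfolding I by (subst M.finsum_insert) auto
  qed
  show ?thesis
  proof safe
    fix x assume "x \<in> xspan j n M A"
    then obtain a where a: "a \<in> {j+1..n} \<rightarrow> A" "x = (\<Oplus>l\<in>{j+1..n}. X l (a l))" unfolding xspan_def by blast
    have "a (Suc j) \<in> A" "a \<in> {Suc j + 1..n} \<rightarrow> A" using a(1) I by auto
    then show "\<exists>b y. x = X (Suc j) b \<oplus> y \<and> b \<in> A \<and> y \<in> xspan (Suc j) n M A"
      unfolding a(2) fs[OF a(1)] xspan_def by blast
  next
    fix b y assume b: "b \<in> A" "y \<in> xspan (Suc j) n M A"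
    then obtain a where a: "a \<in> {Suc j+1..n} \<rightarrow> A" "y = (\<Oplus>l\<in>{Suc j+1..n}. X l (a l))" unfolding xspan_def by blast
    let ?a = "a(Suc j := b)"
    have f: "?a \<in> {j+1..n} \<rightarrow> A" using a(1) b(1) by auto
    have "(\<Oplus>l\<in>{Suc j+1..n}. X l (?a l)) = (\<Oplus>l\<in>{Suc j+1..n}. X l (a l))"
      using a(1) assms(2) by (intro M.finsum_cong') (auto intro!: X_closed)
    then have "X (Suc j) b \<oplus> y = (\<Oplus>l\<in>{j+1..n}. X l (?a l))" unfolding fs[OF f] a(2) by simp
    then show "X (Suc j) b \<oplus> y \<in> xspan j n M A" unfolding xspan_def using f by blast
  qed
qed

lemma xspan_zero: "A \<subseteq> carrier M \<Longrightarrow> \<zero> \<in> A \<Longrightarrow> \<zero> \<in> xspan j n M A"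
proof -
  assume "\<zero> \<in> A"
  have "(\<Oplus>l\<in>{j+1..n}. X l \<zero>) = (\<Oplus>l\<in>{j+1..n}. \<zero>)"
    by (rule M.finsum_cong') (auto intro!: smult_r_null xvar_closed)
  then have "\<zero> = (\<Oplus>l\<in>{j+1..n}. X l \<zero>)" by simp
  then show ?thesis unfolding xspan_def using \<open>\<zero> \<in> A\<close>
    by (intro CollectI exI[of _ "\<lambda>_. \<zero>"]) auto
qed

lemma xspan_add:
  assumes "A \<subseteq> carrier M" "\<And>x y. x \<in> A \<Longrightarrow> y \<in> A \<Longrightarrow> x \<oplus> y \<in> A"
    and "x \<in> xspan j n M A" "y \<in> xspan j n M A"
  shows "x \<oplus> y \<in> xspan j n M A"
proof -
  obtain a b where a: "a \<in> {j+1..n} \<rightarrow> A" "x = (\<Oplus>l\<in>{j+1..n}. X l (a l))"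
    and b: "b \<in> {j+1..n} \<rightarrow> A" "y = (\<Oplus>l\<in>{j+1..n}. X l (b l))"
    using assms(3,4) unfolding xspan_def by blast
  have cl: "a l \<in> carrier M" "b l \<in> carrier M" if "l \<in> {j+1..n}" for l
    using that a(1) b(1) assms(1) by auto
  have "x \<oplus> y = (\<Oplus>l\<in>{j+1..n}. X l (a l) \<oplus> X l (b l))"
    unfolding a(2) b(2) using cl by (intro M.finsum_addf[symmetric]) (auto intro!: X_closed)
  also have "\<dots> = (\<Oplus>l\<in>{j+1..n}. X l (a l \<oplus> b l))"
  proof (rule M.finsum_cong'[OF refl])
    fix l assume l: "l \<in> {j+1..n}"
    then have "l \<in> {1..n}" by auto
    then show "X l (a l) \<oplus> X l (b l) = X l (a l \<oplus> b l)"
      using cl[OF l] by (intro smult_r_distr[symmetric] xvar_closed)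
  qed (use cl in \<open>auto intro!: X_closed\<close>)
  finally show ?thesis unfolding xspan_def using a(1) b(1) assms(2)
    by (intro CollectI exI[of _ "\<lambda>l. a l \<oplus> b l"]) auto
qed

lemma xspan_act:
  assumes "A \<subseteq> carrier M" "Q \<in> carrier (weyl n)" "\<And>x. x \<in> A \<Longrightarrow> Q \<odot> x \<in> B"
    and comm: "\<And>l. l \<in> {j+1..n} \<Longrightarrow> weyl_mult Q (xvar l) = weyl_mult (xvar l) Q"
    and x: "x \<in> xspan j n M A"
  shows "Q \<odot> x \<in> xspan j n M B"
proof -
  obtain a where a: "a \<in> {j+1..n} \<rightarrow> A" "x = (\<Oplus>l\<in>{j+1..n}. X l (a l))"
    using x unfolding xspan_def by blast
  have cl: "a l \<in> carrier M" if "l \<in> {j+1..n}" for l using that a(1) assms(1) by auto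
  have "Q \<odot> x = (\<Oplus>l\<in>{j+1..n}. Q \<odot> X l (a l))"
    unfolding a(2) using cl by (intro smult_finsum assms(2)) (auto intro!: X_closed)
  also have "\<dots> = (\<Oplus>l\<in>{j+1..n}. X l (Q \<odot> a l))"
  proof (rule M.finsum_cong'[OF refl])
    fix l assume l: "l \<in> {j+1..n}"
    then have "xvar l \<in> carrier (weyl n)" by (intro xvar_closed) auto
    then show "Q \<odot> X l (a l) = X l (Q \<odot> a l)"
      using smult_mult[OF assms(2) _ cl[OF l]] smult_mult[OF _ assms(2) cl[OF l]] comm[OF l] by metis
  qed (use cl assms(2) in \<open>auto intro!: smult_closed xvar_closed\<close>)
  finally show ?thesis unfolding xspan_def using a(1) assms(3)
    by (intro CollectI exI[of _ "\<lambda>l. Q \<odot> a l"]) auto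
qed

end

lemma weyl_add_closed: "P \<in> carrier (weyl n) \<Longrightarrow> Q \<in> carrier (weyl n) \<Longrightarrow> P + Q \<in> carrier (weyl n)"
  using Poly_Mapping.keys_add[of P Q] by (auto simp: weyl_carrier_iff)

section \<open>Filtered modules\<close>

text \<open>No generators are mentioned: these axioms suffice to form the associated graded module,
  and they pass to the restriction, for which no generating family has to be produced.\<close>

locale V_filtered = weyl_module n M for n and M :: "(weyl_elem, 'm) module" (structure) +
  fixes w :: "nat \<Rightarrow> real" and U :: "real \<Rightarrow> 'm set"
  assumes U_sub: "U k \<subseteq> carrier M"
    and U_zero: "\<zero> \<in> U k"
    and U_add: "x \<in> U k \<Longrightarrow> y \<in> U k \<Longrightarrow> x \<oplus> y \<in> U k"
    and U_mono: "k \<le> l \<Longrightarrow> U k \<subseteq> U l"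
    and U_act: "P \<in> weyl_filt n (V_weight w) a \<Longrightarrow> x \<in> U b \<Longrightarrow> P \<odot> x \<in> U (a + b)"
begin

abbreviation UL :: "real \<Rightarrow> 'm set" where "UL \<equiv> filt_less U"

lemma UL_iff: "x \<in> UL k \<longleftrightarrow> (\<exists>j<k. x \<in> U j)"
  by (auto simp: filt_less_def)

lemma UL_sub_U: "UL k \<subseteq> U k"
  unfolding subset_iff UL_iff using U_mono[OF less_imp_le] by blast

lemma UL_sub: "UL k \<subseteq> carrier M"
  using UL_sub_U U_sub by blast

lemma U_sub_UL: "k < l \<Longrightarrow> U k \<subseteq> UL l"
  by (auto simp: UL_iff)

lemma UL_mono: "k \<le> l \<Longrightarrow> UL k \<subseteq> UL l"
  unfolding subset_iff UL_iff using less_le_trans by blast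

lemma UL_zero: "\<zero> \<in> UL k"
  using U_zero[of "k - 1"] by (auto simp: UL_iff intro!: exI[of _ "k - 1"])

lemma UL_add:
  assumes "x \<in> UL k" "y \<in> UL k" shows "x \<oplus> y \<in> UL k"
proof -
  obtain i j where ij: "i < k" "x \<in> U i" "j < k" "y \<in> U j" using assms by (auto simp: UL_iff)
  then have "x \<oplus> y \<in> U (max i j)" using U_mono[of i "max i j"] U_mono[of j "max i j"] by (intro U_add) auto
  then show ?thesis using ij by (auto simp: UL_iff intro!: exI[of _ "max i j"])
qed

lemma UL_act:
  assumes "P \<in> weyl_filt n (V_weight w) a" "x \<in> UL b" shows "P \<odot> x \<in> UL (a + b)"
proof -
  obtain j where "j < b" "x \<in> U j" using assms(2) by (auto simp: UL_iff)
  then have "P \<odot> x \<in> U (a + j)" "a + j < a + b" using U_act[OF assms(1)] by auto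
  then show ?thesis unfolding UL_iff by blast
qed

lemma UL_act_U:
  assumes "P \<in> weyl_filt n (V_weight w) a" "x \<in> U b" "a + b < k" shows "P \<odot> x \<in> UL k"
  unfolding UL_iff using U_act[OF assms(1,2)] assms(3) by blast

lemma minus_one_filt: "\<ominus>\<^bsub>weyl n\<^esub> \<one>\<^bsub>weyl n\<^esub> \<in> weyl_filt n uv 0"
proof -
  have "single 0 (- 1) \<in> weyl_filt n uv 0" by (rule const_filt)
  then show ?thesis unfolding weyl_minus_one by (simp add: single_uminus)
qed

lemma U_subgroup: "additive_subgroup (U k) M"
  using U_act[OF minus_one_filt, of _ k] by (intro additive_subgroup_smult U_sub U_zero U_add) auto

lemma UL_subgroup: "additive_subgroup (UL k) M"
  using UL_act[OF minus_one_filt, of _ k] by (intro additive_subgroup_smult UL_sub UL_zero UL_add) auto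

end

locale good_V_filtered = weyl_module n M for n and M :: "(weyl_elem, 'm) module" (structure) +
  fixes w :: "nat \<Rightarrow> real" and U :: "real \<Rightarrow> 'm set" and c :: real
    and s :: nat and m :: "nat \<Rightarrow> 'm" and \<kappa> :: "nat \<Rightarrow> real"
  assumes c_pos: "0 < c" and w_const: "i \<in> {1..n} \<Longrightarrow> w i = c"
    and m_closed: "l < s \<Longrightarrow> m l \<in> carrier M"
    and U_eq: "U k = {\<Oplus>l\<in>{..<s}. P l \<odot> m l | P. \<forall>l<s. P l \<in> weyl_filt n (V_weight w) (k - \<kappa> l)}"
begin

lemma finsum_gens_act:
  assumes Q: "Q \<in> carrier (weyl n)" and P: "\<And>l. l < s \<Longrightarrow> P l \<in> carrier (weyl n)"
  shows "Q \<odot> (\<Oplus>l\<in>{..<s}. P l \<odot> m l) = (\<Oplus>l\<in>{..<s}. weyl_mult Q (P l) \<odot> m l)"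
proof -
  have cl: "P l \<odot> m l \<in> carrier M" if "l < s" for l using that P m_closed by (simp add: smult_closed)
  have "Q \<odot> (\<Oplus>l\<in>{..<s}. P l \<odot> m l) = (\<Oplus>l\<in>{..<s}. Q \<odot> (P l \<odot> m l))"
    using cl by (intro smult_finsum Q) auto
  also have "\<dots> = (\<Oplus>l\<in>{..<s}. weyl_mult Q (P l) \<odot> m l)"
    using P m_closed by (intro M.finsum_cong' refl) (auto simp: smult_mult Q intro!: smult_closed weyl_mult_closed)
  finally show ?thesis .
qed

lemma finsum_gens_closed:
  "(\<And>l. l < s \<Longrightarrow> P l \<in> carrier (weyl n)) \<Longrightarrow> (\<Oplus>l\<in>{..<s}. P l \<odot> m l) \<in> carrier M"
  using m_closed by (intro M.finsum_closed) (auto intro!: smult_closed)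

sublocale V_filtered n M w U
proof
  fix k
  show sub: "U k \<subseteq> carrier M"
    unfolding U_eq by (auto intro!: finsum_gens_closed simp: weyl_filt_iff)
  show "\<zero> \<in> U k"
  proof -
    have "(\<Oplus>l\<in>{..<s}. 0 \<odot> m l) = (\<Oplus>l\<in>{..<s}. \<zero>)"
      using m_closed by (intro M.finsum_cong' refl) (auto simp: smult_0)
    then have "\<zero> = (\<Oplus>l\<in>{..<s}. 0 \<odot> m l)" by simp
    then show ?thesis unfolding U_eq by (intro CollectI exI[of _ "\<lambda>_. 0"]) (simp add: zero_weyl_filt)
  qed
  show "x \<oplus> y \<in> U k" if xy: "x \<in> U k" "y \<in> U k" for x y
  proof -
    obtain P Q where P: "\<forall>l<s. P l \<in> weyl_filt n (V_weight w) (k - \<kappa> l)" "x = (\<Oplus>l\<in>{..<s}. P l \<odot> m l)"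
      and Q: "\<forall>l<s. Q l \<in> weyl_filt n (V_weight w) (k - \<kappa> l)" "y = (\<Oplus>l\<in>{..<s}. Q l \<odot> m l)"
      using xy unfolding U_eq by blast
    have cl: "P l \<in> carrier (weyl n)" "Q l \<in> carrier (weyl n)" if "l < s" for l
      using P(1) Q(1) that by (auto simp: weyl_filt_iff)
    have "x \<oplus> y = (\<Oplus>l\<in>{..<s}. P l \<odot> m l \<oplus> Q l \<odot> m l)"
      unfolding P(2) Q(2) using cl m_closed by (intro M.finsum_addf[symmetric]) (auto intro!: smult_closed)
    also have "\<dots> = (\<Oplus>l\<in>{..<s}. (P l + Q l) \<odot> m l)"
      using cl m_closed by (intro M.finsum_cong' refl) (auto simp: smult_add intro!: smult_closed weyl_add_closed)
    finally show ?thesis unfolding U_eq using P(1) Q(1)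
      by (intro CollectI exI[of _ "\<lambda>l. P l + Q l"]) (auto intro: weyl_filt_add)
  qed
  show "U k \<subseteq> U l" if "k \<le> l" for l
  proof -
    have "weyl_filt n (V_weight w) (k - \<kappa> i) \<subseteq> weyl_filt n (V_weight w) (l - \<kappa> i)" for i
      using that by (intro weyl_filt_mono) simp
    then show ?thesis unfolding U_eq by blast
  qed
  show "Q \<odot> x \<in> U (a + k)" if Q: "Q \<in> weyl_filt n (V_weight w) a" and x: "x \<in> U k" for Q a x
  proof -
    obtain P where P: "\<forall>l<s. P l \<in> weyl_filt n (V_weight w) (k - \<kappa> l)" "x = (\<Oplus>l\<in>{..<s}. P l \<odot> m l)"
      using x unfolding U_eq by blast
    have "Q \<odot> x = (\<Oplus>l\<in>{..<s}. weyl_mult Q (P l) \<odot> m l)"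
      unfolding P(2) using P(1) Q by (intro finsum_gens_act) (auto simp: weyl_filt_iff)
    moreover have "weyl_mult Q (P l) \<in> weyl_filt n (V_weight w) (a + k - \<kappa> l)" if "l < s" for l
      using weyl_filt_V_mult[OF Q, of "P l" "k - \<kappa> l"] P(1) that by (simp add: algebra_simps)
    ultimately show ?thesis unfolding U_eq by (intro CollectI exI[of _ "\<lambda>l. weyl_mult Q (P l)"]) simp
  qed
qed

lemma m_in_U:
  assumes "l < s" shows "m l \<in> U (\<kappa> l)"
proof -
  let ?P = "\<lambda>i. if i = l then single 0 1 else 0"
  have "(\<Oplus>i\<in>{..<s}. ?P i \<odot> m i) = (\<Oplus>i\<in>{..<s}. if l = i then m i else \<zero>)"
    using m_closed smult_one by (intro M.finsum_cong' refl) (auto simp: smult_0)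
  also have "\<dots> = m l" using assms m_closed by (intro M.finsum_singleton) auto
  finally have "m l = (\<Oplus>i\<in>{..<s}. ?P i \<odot> m i)" ..
  moreover have "?P i \<in> weyl_filt n (V_weight w) (\<kappa> l - \<kappa> i)" for i
    using const_filt[of 1 n "V_weight w"] by (simp add: zero_weyl_filt del: single_one)
  ultimately show ?thesis unfolding U_eq by (intro CollectI exI[of _ ?P]) simp
qed

text \<open>Induction principle for a good filtration: a property stable under the filtered
  operations is checked only on the generators, each in its own degree.\<close>

lemma U_least:
  assumes "\<And>k. N k \<subseteq> carrier M" "\<And>k. \<zero> \<in> N k" "\<And>k x y. x \<in> N k \<Longrightarrow> y \<in> N k \<Longrightarrow> x \<oplus> y \<in> N k"
    and act: "\<And>P a b x. P \<in> weyl_filt n (V_weight w) a \<Longrightarrow> x \<in> N b \<Longrightarrow> P \<odot> x \<in> N (a + b)"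
    and gen: "\<And>l. l < s \<Longrightarrow> m l \<in> N (\<kappa> l)"
  shows "U k \<subseteq> N k"
proof
  fix x assume "x \<in> U k"
  then obtain P where P: "\<forall>l<s. P l \<in> weyl_filt n (V_weight w) (k - \<kappa> l)" "x = (\<Oplus>l\<in>{..<s}. P l \<odot> m l)"
    unfolding U_eq by blast
  show "x \<in> N k" unfolding P(2)
  proof (rule M.finsum_mem[OF assms(1-3)])
    fix l assume "l \<in> {..<s}"
    then have "P l \<odot> m l \<in> N (k - \<kappa> l + \<kappa> l)" using P(1) by (intro act gen) auto
    then show "P l \<odot> m l \<in> N k" by simp
  qed
qed

lemma const_op_filt:
  assumes "homog d q" shows "const_op n q \<in> weyl_filt n (V_weight w) (real d * c)"
  unfolding weyl_filt_iff
proof (intro conjI ballI const_op_closed)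
  fix p assume "p \<in> keys (const_op n q)"
  then have l: "lookup (const_op n q) p \<noteq> 0" by (simp add: in_keys_iff)
  then have p: "fst p = 0" "snd p \<in> mindices n" "snd p \<in> keys q"
    unfolding lookup_const_op by (simp_all add: in_keys_iff split: if_splits)
  have "monom_weight n (V_weight w) (0, snd p) = c * (real (mdeg (snd p)) - real (mdeg 0))"
    by (rule monom_weight_V_const[OF w_const _ p(2)]) (simp_all add: mindices_def)
  then show "monom_weight n (V_weight w) p \<le> real d * c"
    using p assms by (cases p) (simp add: homog_def mdeg_0)
qed

lemma pdiff_const_op_filt:
  assumes "homog d q" shows "const_op n (pdiff i q) \<in> weyl_filt n (V_weight w) ((real d - 1) * c)"
proof (cases d)
  case 0
  \<comment> \<open>Here the asserted level is \<open>-c\<close>, so the derivative of a constant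
    has to be exactly 0.\<close>
  have "\<beta> \<notin> keys (pdiff i q)" for \<beta>
  proof
    assume "\<beta> \<in> keys (pdiff i q)"
    then have "mdeg (\<beta> + single i 1) = 0" using keys_pdiff assms 0 by (simp add: homog_def)
    then show False by (simp add: mdeg_add mdeg_single)
  qed
  then have "keys (pdiff i q) = {}" by blast
  then have "pdiff i q = 0" by simp
  then show ?thesis by (simp add: const_op_0 zero_weyl_filt)
next
  case (Suc d')
  then have "homog d' (pdiff i q)" using assms homog_pdiff by simp
  then show ?thesis using const_op_filt[of d'] Suc by simp
qed

lemma xvar_filt:
  assumes "i \<in> {1..n}" shows "xvar i \<in> weyl_filt n (V_weight w) (- c)"
proof -
  have "monom_weight n (V_weight w) (single i 1, 0)
    = c * (real (mdeg 0) - real (mdeg (single i 1)))"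
    using assms by (intro monom_weight_V_const[OF w_const]) (auto simp: mindices_def)
  then show ?thesis using xvar_closed[OF assms] by (simp add: weyl_filt_iff xvar_eq mdeg_0 mdeg_single)
qed

lemma D_U: "homog d q \<Longrightarrow> u \<in> U k \<Longrightarrow> D q u \<in> U (k + real d * c)"
  using U_act[OF const_op_filt, of d q u k] by (simp add: add.commute)

lemma D_UL: "homog d q \<Longrightarrow> u \<in> UL k \<Longrightarrow> D q u \<in> UL (k + real d * c)"
  using UL_act[OF const_op_filt, of d q u k] by (simp add: add.commute)

lemma X_U: "i \<in> {1..n} \<Longrightarrow> u \<in> U k \<Longrightarrow> X i u \<in> U (k - c)"
  using U_act[OF xvar_filt, of i u k] by simp

lemma X_UL: "i \<in> {1..n} \<Longrightarrow> u \<in> UL k \<Longrightarrow> X i u \<in> UL (k - c)"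
  using UL_act[OF xvar_filt, of i u k] by simp

text \<open>
  Moving a power of \<open>P\<close> past \<open>x\<^sub>i\<close> produces a derivative of \<open>P\<close>, which commutes with \<open>P\<close>; so one more
  factor \<open>P\<close> makes up for each \<open>x\<^sub>i\<close>.
\<close>

lemma locally_nilpotent:
  assumes P: "homog N P" and gen: "\<And>l. l < s \<Longrightarrow> D P (m l) \<in> UL (\<kappa> l + real N * c)"
    and u: "u \<in> U k"
  shows "\<exists>K. D (P ^ K) u \<in> UL (k + real (K * N) * c)"
proof -
  \<comment> \<open>The exponent \<open>K\<close> may depend on \<open>u\<close>, as each factor
    \<open>x_i\<close> can raise it by one. \<open>Nil\<close> turns out to be stable under filtered
    operators, so it contains \<open>U\<close> by minimality.\<close>
  define Nil where "Nil k = {u \<in> U k. \<exists>K. D (P ^ K) u \<in> UL (k + real (K * N) * c)}" for k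
  have hp: "homog (K * N) (P ^ K)" for K using homog_power[OF P] .
  have Nil_U: "Nil k \<subseteq> U k" for k by (auto simp: Nil_def)
  have Nil_cl: "Nil k \<subseteq> carrier M" for k by (rule order_trans[OF Nil_U U_sub])
  have Nil_more: "D (P ^ (L + K)) u \<in> UL (k + real ((L + K) * N) * c)"
    if "u \<in> carrier M" "D (P ^ K) u \<in> UL (k + real (K * N) * c)" for u k K L
  proof -
    have "D (P ^ L) (D (P ^ K) u) \<in> UL (k + real (K * N) * c + real (L * N) * c)" by (rule D_UL[OF hp that(2)])
    moreover have "k + real (K * N) * c + real (L * N) * c = k + real ((L + K) * N) * c" by (simp add: algebra_simps)
    ultimately show ?thesis by (simp only: power_add D_mult[OF that(1)])
  qed
  have Nil_zero: "\<zero> \<in> Nil k" for k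
    unfolding Nil_def using U_zero UL_zero smult_r_null[OF const_op_closed] by auto
  have Nil_add: "x \<oplus> y \<in> Nil k" if xy: "x \<in> Nil k" "y \<in> Nil k" for x y k
  proof -
    obtain K L where K: "D (P ^ K) x \<in> UL (k + real (K * N) * c)" "D (P ^ L) y \<in> UL (k + real (L * N) * c)"
      using xy unfolding Nil_def by blast
    have cl: "x \<in> carrier M" "y \<in> carrier M" using xy Nil_cl by auto
    have "D (P ^ (L + K)) (x \<oplus> y) = D (P ^ (L + K)) x \<oplus> D (P ^ (L + K)) y"
      using cl by (intro smult_r_distr const_op_closed)
    also have "\<dots> \<in> UL (k + real ((L + K) * N) * c)"
      using Nil_more[OF cl(1) K(1), of L] Nil_more[OF cl(2) K(2), of K] by (intro UL_add) (simp_all add: add.commute)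
    finally show ?thesis using xy Nil_U U_add unfolding Nil_def by blast
  qed
  have Nil_mono: "Nil k \<subseteq> Nil l" if "k \<le> l" for k l
  proof -
    have "UL (k + real (K * N) * c) \<subseteq> UL (l + real (K * N) * c)" for K using that by (intro UL_mono) simp
    then show ?thesis using U_mono[OF that] unfolding Nil_def by blast
  qed
  have Nil_D: "D q u \<in> Nil (k + real d * c)" if q: "homog d q" and u: "u \<in> Nil k" for d q u k
  proof -
    obtain K where K: "D (P ^ K) u \<in> UL (k + real (K * N) * c)" using u unfolding Nil_def by blast
    have cl: "u \<in> carrier M" using u Nil_cl by auto
    have "D (P ^ K) (D q u) = D q (D (P ^ K) u)" using cl by (metis D_mult mult.commute)
    also have "\<dots> \<in> UL (k + real (K * N) * c + real d * c)" by (rule D_UL[OF q K])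
    finally have "D (P ^ K) (D q u) \<in> UL (k + real d * c + real (K * N) * c)" by (simp add: algebra_simps)
    moreover have "D q u \<in> U (k + real d * c)" using u Nil_U by (intro D_U[OF q]) blast
    ultimately show ?thesis unfolding Nil_def by blast
  qed
  have Nil_X: "X i u \<in> Nil (k - c)" if i: "i \<in> {1..n}" and u: "u \<in> Nil k" for i u k
  proof -
    obtain K where K: "D (P ^ K) u \<in> UL (k + real (K * N) * c)" using u unfolding Nil_def by blast
    have cl: "u \<in> carrier M" using u Nil_cl by auto
    \<comment> \<open>The level to be reached by \<open>P ^ Suc K\<close> on \<open>x_i u\<close>.
      The derivative of \<open>P ^ Suc K\<close> is \<open>P ^ K\<close> times a factor of degree
      \<open>N - 1\<close>; its level \<open>(N - 1) c\<close> accounts exactly for the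
      \<open>-c\<close> contributed by \<open>x_i\<close>.\<close>
    let ?k = "k - c + real (Suc K * N) * c"
    have "D (pdiff i (P ^ Suc K)) u = D (of_nat (Suc K) * pdiff i P) (D (P ^ K) u)"
      unfolding pdiff_power D_mult[OF cl, symmetric] by (simp add: mult.commute)
    also have "\<dots> = D (of_nat (Suc K)) (D (pdiff i P) (D (P ^ K) u))"
      using cl by (intro D_mult D_closed)
    also have "D (pdiff i P) (D (P ^ K) u) \<in> UL ((real N - 1) * c + (k + real (K * N) * c))"
      by (rule UL_act[OF pdiff_const_op_filt[OF P] K])
    then have "D (of_nat (Suc K)) (D (pdiff i P) (D (P ^ K) u)) \<in> UL ((real N - 1) * c + (k + real (K * N) * c) + real 0 * c)"
    proof (rule D_UL[rotated])
      show "homog 0 (of_nat (Suc K))" unfolding single_of_nat[symmetric] by (simp add: homog_def mdeg_0 del: single_of_nat)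
    qed
    finally have 1: "D (pdiff i (P ^ Suc K)) u \<in> UL ?k" by (simp add: algebra_simps)
    have "X i (D (P ^ Suc K) u) \<in> UL (k + real (Suc K * N) * c - c)"
      using Nil_more[OF cl K, of 1] by (intro X_UL i) simp
    then have 2: "X i (D (P ^ Suc K) u) \<in> UL ?k" by (simp add: algebra_simps)
    have "D (P ^ Suc K) (X i u) \<in> UL ?k" unfolding D_X[OF i cl] using 2 1 by (rule UL_add)
    moreover have "X i u \<in> U (k - c)" using u Nil_U by (intro X_U i) blast
    ultimately show ?thesis unfolding Nil_def by blast
  qed
  have Nil_monom: "\<forall>k u. u \<in> Nil k \<longrightarrow>
      single (\<alpha>, 0) 1 \<odot> u \<in> Nil (k - real (mdeg \<alpha>) * c)" if "\<alpha> \<in> mindices n" for \<alpha>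
    using that
  proof (induction "mdeg \<alpha>" arbitrary: \<alpha>)
    case 0
    then have "single (\<alpha>, 0) 1 = \<one>\<^bsub>weyl n\<^esub>" using mdeg_eq_0[of \<alpha>] by (simp add: zero_prod_def[symmetric])
    then show ?case using 0 smult_one Nil_cl by (simp add: subset_iff)
  next
    case (Suc d)
    then have "\<alpha> \<noteq> 0" by (metis mdeg_0 nat.distinct(1))
    then obtain i where i: "i \<in> keys \<alpha>" by (metis keys_eq_empty ex_in_conv)
    let ?a = "\<alpha> - single i 1"
    have e: "\<alpha> = ?a + single i 1" using i by (intro mindex_shift) (simp add: in_keys_iff)
    then have d: "mdeg \<alpha> = Suc (mdeg ?a)" using mdeg_add[of ?a "single i 1"] by (simp add: mdeg_single)
    have a: "?a \<in> mindices n" using Suc(3) by (rule mindices_closed(2))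
    have iV: "i \<in> {1..n}" using i Suc(3) by (auto simp: mindices_def)
    have "weyl_mult (xvar i) (single (?a, 0) 1) = single (?a + single i 1, 0) 1"
      unfolding xvar_eq by (subst weyl_mult_single_trivial) (simp_all add: add.commute)
    then have "weyl_mult (xvar i) (single (?a, 0) 1) = single (\<alpha>, 0) 1"
      unfolding e[symmetric] .
    then have f: "single (\<alpha>, 0) 1 \<odot> u = X i (single (?a, 0) 1 \<odot> u)" if "u \<in> carrier M" for u
      using smult_mult[of "xvar i" "single (?a, 0) 1" u] a that xvar_closed[OF iV]
      by (simp add: weyl_carrier_iff mindices_def)
    show ?case
    proof (intro allI impI)
      fix k u assume u: "u \<in> Nil k"
      have "single (?a, 0) 1 \<odot> u \<in> Nil (k - real (mdeg ?a) * c)" using Suc(1)[of ?a] Suc(2) d a u by simp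
      from Nil_X[OF iV this] show "single (\<alpha>, 0) 1 \<odot> u \<in> Nil (k - real (mdeg \<alpha>) * c)"
        using u Nil_cl f[of u] d by (simp add: subset_iff algebra_simps)
    qed
  qed
  \<comment> \<open>Normal order lets the \<open>\<partial>\<close>-part act before the
    \<open>x\<close>-part, so the two stability results compose.\<close>
  have Nil_single: "single p z \<odot> u \<in> Nil (k + monom_weight n (V_weight w) p)"
    if p: "p \<in> mindices n \<times> mindices n" and u: "u \<in> Nil k" for p z u k
  proof -
    obtain \<alpha> \<beta> where ab: "p = (\<alpha>, \<beta>)" "\<alpha> \<in> mindices n" "\<beta> \<in> mindices n" using p by blast
    have "weyl_mult (single (\<alpha>, 0) 1) (const_op n (single \<beta> z)) = single p z"
      using ab by (simp add: const_op_single weyl_mult_single_trivial)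
    then have "single p z \<odot> u = single (\<alpha>, 0) 1 \<odot> D (single \<beta> z) u"
      using smult_mult[of "single (\<alpha>, 0) 1" "const_op n (single \<beta> z)" u] u Nil_cl[of k] ab
      by (simp add: const_op_closed weyl_carrier_iff[of "single (\<alpha>, 0) 1"] subset_iff mindices_def)
    also have "\<dots> \<in> Nil (k + real (mdeg \<beta>) * c - real (mdeg \<alpha>) * c)"
      using Nil_monom[OF ab(2)] Nil_D[of "mdeg \<beta>" "single \<beta> z" u k] u by (simp add: homog_def)
    also have "k + real (mdeg \<beta>) * c - real (mdeg \<alpha>) * c = k + monom_weight n (V_weight w) p"
    proof -
      have "monom_weight n (V_weight w) (\<alpha>, \<beta>) = c * (real (mdeg \<beta>) - real (mdeg \<alpha>))"
        using ab(2,3) w_const by (rule monom_weight_V_const[rotated])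
      then show ?thesis by (simp add: ab(1) algebra_simps)
    qed
    finally show ?thesis .
  qed
  have "U k \<subseteq> Nil k" for k
  proof (rule U_least[OF Nil_cl Nil_zero Nil_add])
    fix Q a b x assume Q: "Q \<in> weyl_filt n (V_weight w) a" and x: "x \<in> Nil b"
    have cl: "single p (lookup Q p) \<in> carrier (weyl n)" if "p \<in> keys Q" for p
      using Q that by (auto simp: weyl_filt_iff weyl_carrier_iff)
    have "Q \<odot> x = (\<Sum>p\<in>keys Q. single p (lookup Q p)) \<odot> x"
      by (rule arg_cong[OF poly_mapping_sum_single, of "\<lambda>Q. Q \<odot> x"])
    also have "\<dots> = (\<Oplus>p\<in>keys Q. single p (lookup Q p) \<odot> x)"
      using x Nil_cl by (intro smult_sum cl) auto
    also have "\<dots> \<in> Nil (a + b)"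
    proof (rule M.finsum_mem[OF Nil_cl Nil_zero Nil_add])
      fix p assume p: "p \<in> keys Q"
      then have "p \<in> mindices n \<times> mindices n" "monom_weight n (V_weight w) p \<le> a"
        using Q by (auto simp: weyl_filt_iff weyl_carrier_iff)
      then show "single p (lookup Q p) \<odot> x \<in> Nil (a + b)"
        using Nil_single[of p x b] x Nil_mono[of "b + monom_weight n (V_weight w) p" "a + b"] by auto
    qed
    finally show "Q \<odot> x \<in> Nil (a + b)" .
  next
    fix l assume l: "l < s"
    then have "D (P ^ 1) (m l) \<in> UL (\<kappa> l + real (1 * N) * c)" using gen by simp
    then show "m l \<in> Nil (\<kappa> l)" unfolding Nil_def using m_in_U[OF l] by blast
  qed
  then show ?thesis using u unfolding Nil_def by blast
qed

end

section \<open>Regularity and strictness\<close>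

context good_V_filtered
begin

text \<open>
  The classes in degree \<open>k\<close> of the elements of \<open>T i k\<close> are the degree \<open>k\<close> part of
  \<open>\<Sum> x\<^sub>l gr\<^sup>U M\<close>, the sum over \<open>l > i\<close>.
\<close>

definition T :: "nat \<Rightarrow> real \<Rightarrow> 'm set" where
  "T i k = {u \<oplus> y | u y. u \<in> UL k \<and> y \<in> xspan i n M (U (k + c))}"

lemma add_minus_cancel_left:
  assumes "a \<in> carrier M" "b \<in> carrier M"
  shows "(a \<oplus> b) \<oplus> (\<ominus> a) = b"
  using assms by (simp add: M.a_comm[of a b] M.a_assoc M.r_neg)

lemma T_sub: "T i k \<subseteq> carrier M"
  unfolding T_def using UL_sub xspan_sub[OF U_sub] by blast

lemma UL_sub_T: "UL k \<subseteq> T i k"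
proof
  fix u assume "u \<in> UL k"
  then have "u \<in> carrier M" using UL_sub by blast
  then have "u = u \<oplus> \<zero>" by simp
  then show "u \<in> T i k" unfolding T_def using \<open>u \<in> UL k\<close> xspan_zero[OF U_sub U_zero] by blast
qed

lemma T_add:
  assumes "x \<in> T i k" "y \<in> T i k" shows "x \<oplus> y \<in> T i k"
proof -
  obtain u v u' v' where x: "x = u \<oplus> v" "u \<in> UL k" "v \<in> xspan i n M (U (k + c))"
    and y: "y = u' \<oplus> v'" "u' \<in> UL k" "v' \<in> xspan i n M (U (k + c))"
    using assms unfolding T_def by blast
  have cl: "u \<in> carrier M" "u' \<in> carrier M" "v \<in> carrier M" "v' \<in> carrier M"
    using x y UL_sub xspan_sub[OF U_sub] by blast+
  have "x \<oplus> y = (u \<oplus> u') \<oplus> (v \<oplus> v')"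
    unfolding x(1) y(1) using cl by (simp add: M.a_ac)
  moreover have "v \<oplus> v' \<in> xspan i n M (U (k + c))" by (rule xspan_add[OF U_sub U_add x(3) y(3)])
  ultimately show ?thesis unfolding T_def using UL_add[OF x(2) y(2)] by blast
qed

text \<open>Commutation is required with the later variables only; \<open>x_i\<close> itself may
  fail to commute with \<open>Q\<close>, and this is what the descent in \<open>regular_step\<close>
  exploits.\<close>

lemma T_act:
  assumes Q: "Q \<in> weyl_filt n (V_weight w) a"
    and comm: "\<And>l. l \<in> {i+1..n} \<Longrightarrow> weyl_mult Q (xvar l) = weyl_mult (xvar l) Q"
    and x: "x \<in> T i k"
  shows "Q \<odot> x \<in> T i (k + a)"
proof -
  obtain u v where uv: "x = u \<oplus> v" "u \<in> UL k" "v \<in> xspan i n M (U (k + c))"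
    using x unfolding T_def by blast
  have Qc: "Q \<in> carrier (weyl n)" using Q by (simp add: weyl_filt_iff)
  have cl: "u \<in> carrier M" "v \<in> carrier M" using uv UL_sub xspan_sub[OF U_sub] by blast+
  have "Q \<odot> v \<in> xspan i n M (U (k + a + c))"
    by (rule xspan_act[OF U_sub Qc _ comm uv(3)]) (use U_act[OF Q] in \<open>force simp: algebra_simps\<close>)
  moreover have "Q \<odot> u \<in> UL (k + a)" using UL_act[OF Q uv(2)] by (simp add: add.commute)
  ultimately show ?thesis unfolding T_def uv(1) smult_r_distr[OF Qc cl] by blast
qed

lemma T_subgroup: "additive_subgroup (T i k) M"
proof (rule additive_subgroup_smult[OF T_sub _ T_add])
  show "\<zero> \<in> T i k" using UL_sub_T UL_zero by blast
  fix x assume x: "x \<in> T i k"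
  have "weyl_mult (const_op n (const_poly (- 1))) (xvar l) = weyl_mult (xvar l) (const_op n (const_poly (- 1)))"
    if "l \<in> {i+1..n}" for l
    using that by (intro const_op_commute[OF monos_in_subring(7)[of _ "{}"]]) auto
  then show "(\<ominus>\<^bsub>weyl n\<^esub> \<one>\<^bsub>weyl n\<^esub>) \<odot> x \<in> T i k"
    using T_act[OF minus_one_filt, of i x k] x unfolding minus_one_eq_const_op by simp
qed

text \<open>Applying \<open>ad x\<^sub>i\<close> \<open>t\<close> times to \<open>q\<close> leaves the coefficient of \<open>\<partial>\<^sub>i\<^sup>t\<close>, times \<open>t!\<close>.\<close>

lemma regular_step:
  assumes i: "i \<in> {1..n}" and V: "V \<subseteq> {..i}"
    and u: "u \<in> U k" and Xu: "X i u \<in> T i (k - c)"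
    and q: "homog t q" "q \<in> monos_in V" "D q u \<in> T i (k + real t * c)"
      "lookup q (single i t) \<noteq> 0"
  shows "u \<in> T i k"
  using q
proof (induction t arbitrary: q)
  case 0
  \<comment> \<open>In degree 0 the operator is a nonzero constant, which can be inverted.\<close>
  let ?z = "lookup q 0"
  have "q = const_poly ?z"
    using 0(1) by (intro poly_mapping_eqI) (auto simp: homog_def mdeg_eq_0 in_keys_iff lookup_single when_def)
  then have "const_poly (inverse ?z) * q = 1"
    using 0(4) by (metis left_inverse mult_single add.right_neutral single_one single_zero)
  then have "u = D (const_poly (inverse ?z)) (D q u)" using u U_sub D_mult D_1 by (metis subsetD)
  moreover have "D (const_poly (inverse ?z)) (D q u) \<in> T i (k + 0)"
  proof (rule T_act)
    show "const_op n (const_poly (inverse ?z)) \<in> weyl_filt n (V_weight w) 0"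
      using const_op_filt[of 0 "const_poly (inverse ?z)"] by (simp add: homog_def mdeg_0)
    show "weyl_mult (const_op n (const_poly (inverse ?z))) (xvar l) = weyl_mult (xvar l) (const_op n (const_poly (inverse ?z)))"
      if "l \<in> {i+1..n}" for l
      using that by (intro const_op_commute[OF monos_in_subring(7)[of _ "{}"]]) auto
  qed (use 0(3) in simp)
  ultimately show ?case by simp
next
  case (Suc t)
  have cl: "u \<in> carrier M" using u U_sub by blast
  have "lookup (pdiff i q) (single i t) \<noteq> 0"
    using Suc(5) by (simp add: lookup_pdiff single_add[symmetric] del: of_nat_Suc)
  moreover have "D (pdiff i q) u \<in> T i (k + real t * c)"
  proof -
    have 1: "D q (X i u) \<in> T i (k - c + real (Suc t) * c)"
    proof (rule T_act[OF const_op_filt[OF Suc(2)] _ Xu])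
      show "weyl_mult (const_op n q) (xvar l) = weyl_mult (xvar l) (const_op n q)" if "l \<in> {i+1..n}" for l
        using that V by (intro const_op_commute[OF Suc(3)]) auto
    qed
    have 2: "X i (D q u) \<in> T i (k + real (Suc t) * c + (- c))"
      by (rule T_act[OF xvar_filt[OF i] xvar_commute Suc(4)])
    have e: "k - c + real (Suc t) * c = k + real t * c" "k + real (Suc t) * c + (- c) = k + real t * c"
      by (simp_all add: algebra_simps)
    \<comment> \<open>Both products lie in \<open>T i\<close>, one because \<open>x_i u\<close> does
      and the other because \<open>q(\<partial>) u\<close> does. Their difference is the derivative
      of \<open>q\<close> applied to \<open>u\<close>, whose degree is one lower.\<close>
    have "D q (X i u) \<ominus> X i (D q u) = D (pdiff i q) u"
    proof -
      have "X i (D q u) \<in> carrier M" "D (pdiff i q) u \<in> carrier M" using cl i by (auto intro!: X_closed D_closed)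
      then show ?thesis unfolding D_X[OF i cl] a_minus_def by (rule add_minus_cancel_left)
    qed
    moreover have "D q (X i u) \<ominus> X i (D q u) \<in> T i (k + real t * c)"
      unfolding a_minus_def
      by (rule T_add[OF 1[unfolded e] additive_subgroup.a_inv_closed[OF T_subgroup 2[unfolded e]]])
    ultimately show ?thesis by simp
  qed
  ultimately show ?case using Suc(1)[of "pdiff i q"] homog_pdiff[OF Suc(2)] pdiff_monos_in[OF Suc(3)] by blast
qed

text \<open>Local nilpotency provides a power of \<open>P\<close> that sends \<open>u\<close> into
  \<open>UL\<close>, hence into \<open>T i\<close>; its pure-power coefficient is 1, so the
  commutator descent applies. In each degree this is injectivity of \<open>x_i\<close> on the graded
  module modulo the later variables.\<close>

lemma x_regular:
  assumes i: "i \<in> {1..n}" and V: "V \<subseteq> {..i}"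
    and P: "homog N P" "P \<in> monos_in V" "lookup P (single i N) = 1"
      "\<And>l. l < s \<Longrightarrow> D P (m l) \<in> UL (\<kappa> l + real N * c)"
    and u: "u \<in> U k" and Xu: "X i u \<in> T i (k - c)"
  shows "u \<in> T i k"
proof -
  obtain K where K: "D (P ^ K) u \<in> UL (k + real (K * N) * c)" using locally_nilpotent[OF P(1,4) u] by blast
  have h: "homog (K * N) (P ^ K)" by (rule homog_power[OF P(1)])
  have "lookup (P ^ K) (single i (K * N)) = 1"
    unfolding cpoly_eval_homog[OF h, of i, symmetric] cpoly_eval_power cpoly_eval_homog[OF P(1)] P(3) by simp
  then show ?thesis
    using K UL_sub_T by (intro regular_step[OF i V u Xu h monos_in_power[OF P(2)]]) auto
qed

text \<open>The level \<open>U k\<close> can change only where some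
  \<open>(k - \<kappa> l) / c\<close> is an integer. This function steps up at those points, and
  being integer-valued it permits induction over a real index.\<close>

definition jumps :: "real \<Rightarrow> int" where
  "jumps k = (\<Sum>l<s. \<lfloor>(k - \<kappa> l) / c\<rfloor>)"

lemma floor_mono_c: "k \<le> k' \<Longrightarrow> \<lfloor>(k - \<kappa> l) / c\<rfloor> \<le> \<lfloor>(k' - \<kappa> l) / c\<rfloor>"
  using c_pos by (intro floor_mono divide_right_mono) auto

lemma jumps_mono: "k \<le> k' \<Longrightarrow> jumps k \<le> jumps k'"
  unfolding jumps_def by (intro sum_mono floor_mono_c)

text \<open>A weight \<open>c z\<close> with integral \<open>z\<close> is at most
  \<open>k - \<kappa> l\<close> exactly when \<open>z\<close> is at most the floor of
  \<open>(k - \<kappa> l) / c\<close>.\<close>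

lemma U_eq_if_floors:
  assumes "\<And>l. l < s \<Longrightarrow> \<lfloor>(k - \<kappa> l) / c\<rfloor> = \<lfloor>(k' - \<kappa> l) / c\<rfloor>"
  shows "U k' \<subseteq> U k"
proof -
  have "P \<in> weyl_filt n (V_weight w) (k - \<kappa> l)" if P: "P \<in> weyl_filt n (V_weight w) (k' - \<kappa> l)" and l: "l < s" for P l
    unfolding weyl_filt_iff
  proof (intro conjI ballI)
    show Pc: "P \<in> carrier (weyl n)" using P by (simp add: weyl_filt_iff)
    fix p assume p: "p \<in> keys P"
    obtain \<alpha> \<beta> where ab: "p = (\<alpha>, \<beta>)" "\<alpha> \<in> mindices n" "\<beta> \<in> mindices n"
      using p Pc by (auto simp: weyl_carrier_iff)
    define z where "z = int (mdeg \<beta>) - int (mdeg \<alpha>)"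
    have "monom_weight n (V_weight w) (\<alpha>, \<beta>) = c * (real (mdeg \<beta>) - real (mdeg \<alpha>))"
      using ab(2,3) w_const by (rule monom_weight_V_const[rotated])
    then have z: "monom_weight n (V_weight w) p = c * of_int z" by (simp add: ab(1) z_def)
    have "c * of_int z \<le> k' - \<kappa> l" using P p z by (auto simp: weyl_filt_iff)
    then have "of_int z \<le> (k' - \<kappa> l) / c" using c_pos by (simp add: pos_le_divide_eq mult.commute)
    then have "z \<le> \<lfloor>(k - \<kappa> l) / c\<rfloor>" unfolding assms[OF l] by (simp add: le_floor_iff)
    then have "of_int z \<le> (k - \<kappa> l) / c" by (simp add: le_floor_iff)
    then show "monom_weight n (V_weight w) p \<le> k - \<kappa> l" using c_pos by (simp add: z pos_le_divide_eq mult.commute)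
  qed
  then show ?thesis unfolding U_eq by blast
qed

text \<open>The floors are monotone in \<open>k\<close>, so equal sums force equal summands; a shift
  by \<open>c\<close> adds 1 to each floor.\<close>

lemma U_jumps:
  assumes "k \<le> k'" "jumps k = jumps k'" shows "U (k' + c) \<subseteq> U (k + c)"
proof (rule U_eq_if_floors)
  fix l assume l: "l < s"
  have "(\<Sum>l<s. \<lfloor>(k' - \<kappa> l) / c\<rfloor> - \<lfloor>(k - \<kappa> l) / c\<rfloor>) = 0"
    using assms(2) by (simp add: jumps_def sum_subtractf)
  then have "\<forall>l\<in>{..<s}. \<lfloor>(k' - \<kappa> l) / c\<rfloor> - \<lfloor>(k - \<kappa> l) / c\<rfloor> = 0"
    by (subst (asm) sum_nonneg_eq_0_iff) (use floor_mono_c[OF assms(1)] in auto)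
  then have "\<lfloor>(k - \<kappa> l) / c\<rfloor> = \<lfloor>(k' - \<kappa> l) / c\<rfloor>" using l by simp
  moreover have "(k + c - \<kappa> l) / c = (k - \<kappa> l) / c + 1" "(k' + c - \<kappa> l) / c = (k' - \<kappa> l) / c + 1"
    using c_pos by (simp_all add: field_simps)
  ultimately show "\<lfloor>(k + c - \<kappa> l) / c\<rfloor> = \<lfloor>(k' + c - \<kappa> l) / c\<rfloor>" by simp
qed

text \<open>\<open>K'\<close> is the largest point of the progressions
  \<open>\<kappa> l + c Z\<close> not exceeding \<open>K\<close>. Below it some floor is strictly
  smaller, while no floor changes between \<open>K'\<close> and \<open>K\<close>.\<close>

lemma last_jump:
  assumes "jumps k < jumps K" "k \<le> K"
  obtains K' where "k < K'" "K' \<le> K" "jumps K' = jumps K" "\<And>j. j < K' \<Longrightarrow> jumps j < jumps K"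
proof -
  \<comment> \<open>Different values of \<open>jumps\<close> exclude an empty family of generators,
    so the maximum below makes sense.\<close>
  have s: "{..<s} \<noteq> {}" using assms(1) by (auto simp: jumps_def)
  define f where "f l = \<kappa> l + c * of_int \<lfloor>(K - \<kappa> l) / c\<rfloor>" for l
  define K' where "K' = Max (f ` {..<s})"
  have fle: "f l \<le> K'" if "l < s" for l unfolding K'_def using that by (intro Max_ge) auto
  have "f l \<le> K" for l
  proof -
    have "c * of_int \<lfloor>(K - \<kappa> l) / c\<rfloor> \<le> c * ((K - \<kappa> l) / c)"
      using c_pos by (intro mult_left_mono) auto
    then show ?thesis using c_pos unfolding f_def by simp
  qed
  then have le: "K' \<le> K" unfolding K'_def using s by simp
  have fl: "\<lfloor>(K - \<kappa> l) / c\<rfloor> \<le> \<lfloor>(K' - \<kappa> l) / c\<rfloor>" if l: "l < s" for l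
  proof -
    have "of_int \<lfloor>(K - \<kappa> l) / c\<rfloor> \<le> (K' - \<kappa> l) / c"
      using fle[OF l] c_pos unfolding f_def by (simp add: pos_le_divide_eq mult.commute algebra_simps)
    then show ?thesis by (simp add: le_floor_iff)
  qed
  have eq: "jumps K' = jumps K"
    using jumps_mono[OF le] sum_mono[of "{..<s}" "\<lambda>l. \<lfloor>(K - \<kappa> l) / c\<rfloor>" "\<lambda>l. \<lfloor>(K' - \<kappa> l) / c\<rfloor>"] fl
    unfolding jumps_def by fastforce
  have lt: "jumps j < jumps K" if jK: "j < K'" for j
  proof -
    have "K' \<in> f ` {..<s}" unfolding K'_def using s by (intro Max_in) auto
    then obtain l where l: "l < s" "K' = f l" by auto
    have "(j - \<kappa> l) / c < of_int \<lfloor>(K - \<kappa> l) / c\<rfloor>"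
      using jK c_pos unfolding l(2) f_def by (simp add: pos_divide_less_eq mult.commute algebra_simps)
    then have "\<lfloor>(j - \<kappa> l) / c\<rfloor> < \<lfloor>(K - \<kappa> l) / c\<rfloor>" by (simp add: floor_less_iff)
    moreover have "j \<le> K" using jK le by simp
    ultimately show ?thesis unfolding jumps_def
      using l(1) by (intro sum_strict_mono_ex1) (auto intro: floor_mono_c)
  qed
  have "k < K'"
  proof (rule ccontr)
    assume "\<not> k < K'"
    then have "jumps K' \<le> jumps k" by (intro jumps_mono) simp
    then show False using eq assms(1) by simp
  qed
  with le eq lt that show ?thesis by blast
qed

text \<open>Finitely many coefficients occur, so one level contains them all.\<close>

lemma xspan_exhaust:
  assumes ex: "carrier M = (\<Union>k. U k)" and x: "x \<in> xspan j n M (carrier M)"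
  shows "\<exists>K\<ge>k. x \<in> xspan j n M (U (K + c))"
proof -
  obtain a where a: "a \<in> {j+1..n} \<rightarrow> carrier M" "x = (\<Oplus>l\<in>{j+1..n}. X l (a l))"
    using x unfolding xspan_def by blast
  have "\<forall>l\<in>{j+1..n}. \<exists>d. a l \<in> U d" using a(1) ex by auto
  then obtain d where d: "\<And>l. l \<in> {j+1..n} \<Longrightarrow> a l \<in> U (d l)" by metis
  define K where "K = Max (insert k ((\<lambda>l. d l - c) ` {j+1..n}))"
  have "k \<le> K" unfolding K_def by (intro Max_ge) auto
  moreover have "a l \<in> U (K + c)" if "l \<in> {j+1..n}" for l
  proof -
    have "d l - c \<le> K" unfolding K_def using that by (intro Max_ge) auto
    then show ?thesis using U_mono[of "d l" "K + c"] d[OF that] by auto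
  qed
  ultimately show ?thesis unfolding xspan_def a(2) by blast
qed

text \<open>
  A representation by elements of a level \<open>K > k\<close> is lowered to the previous jump of the filtration:
  its leading classes form a relation in the graded module, so by regularity the coefficient of
  \<open>x\<^sub>j\<^sub>+\<^sub>1\<close> can be reduced modulo the later variables, and induction on \<open>j\<close> treats the rest.
\<close>

theorem xspan_strict:
  assumes ex: "carrier M = (\<Union>k. U k)" and r: "r \<le> n"
    and P: "\<And>j. j \<in> {r+1..n} \<Longrightarrow> \<exists>N P. homog N P \<and> P \<in> monos_in (insert j {1..r})
      \<and> lookup P (single j N) = 1 \<and> (\<forall>l<s. D P (m l) \<in> UL (\<kappa> l + real N * c))"
    and j: "r \<le> j" "j \<le> n"
  shows "x \<in> U k \<Longrightarrow> x \<in> xspan j n M (carrier M) \<Longrightarrow> x \<in> xspan j n M (U (k + c))"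
  using j(2,1)
proof (induction j arbitrary: x k rule: inc_induct)
  case base
  then show ?case by (simp add: xspan_n)
next
  case (step j)
  have i: "Suc j \<in> {1..n}" using step(2) by auto
  obtain N P where NP: "homog N P" "P \<in> monos_in (insert (Suc j) {1..r})"
    "lookup P (single (Suc j) N) = 1" "\<And>l. l < s \<Longrightarrow> D P (m l) \<in> UL (\<kappa> l + real N * c)"
    using P[of "Suc j"] step(2,6) by auto
  have V: "insert (Suc j) {1..r} \<subseteq> {..Suc j}" using step(6) by auto
  \<comment> \<open>The outer induction treats the later variables at every level, so only the level
    \<open>K\<close> of the coefficients has to descend. The measure is the amount by which
    \<open>jumps\<close> still exceeds its value at \<open>k\<close>.\<close>
  have main: "x \<in> xspan j n M (U (k + c))"
    if "k \<le> K" "x \<in> xspan j n M (U (K + c))" for K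
    using that
  proof (induction "nat (jumps K - jumps k)" arbitrary: K rule: less_induct)
    case less
    show ?case
    proof (cases "jumps k = jumps K")
      case True
      then show ?thesis using U_jumps[OF less(2) True] xspan_mono less(3) by blast
    next
      case False
      then have "jumps k < jumps K" using jumps_mono[OF less(2)] by simp
      then obtain K' where K': "k < K'" "K' \<le> K" "jumps K' = jumps K" "\<And>j. j < K' \<Longrightarrow> jumps j < jumps K"
        using last_jump less(2) by metis
      have "x \<in> xspan j n M (U (K' + c))" using U_jumps[OF K'(2,3)] xspan_mono less(3) by blast
      then obtain a y where a: "x = X (Suc j) a \<oplus> y" "a \<in> U (K' + c)" "y \<in> xspan (Suc j) n M (U (K' + c))"
        unfolding xspan_Suc[OF step(2) U_sub] by blast
      have acl: "a \<in> carrier M" "y \<in> carrier M" using a U_sub xspan_sub[OF U_sub] by blast+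
      have Xa: "X (Suc j) a \<in> carrier M" using X_closed[OF i acl(1)] .
      \<comment> \<open>As \<open>k < K'\<close>, the class of \<open>x\<close> in degree
        \<open>K'\<close> is zero, which is why the leading classes form a relation.\<close>
      have xT: "x \<in> T (Suc j) K'" using step(4) U_sub_UL[OF K'(1)] UL_sub_T by blast
      have yT: "y \<in> T (Suc j) K'"
      proof -
        have "y = \<zero> \<oplus> y" using acl by simp
        then show ?thesis unfolding T_def using a(3) UL_zero by blast
      qed
      have "X (Suc j) a = x \<ominus> y" unfolding a(1) a_minus_def using Xa acl(2) by (simp add: M.a_assoc M.r_neg)
      also have "\<dots> \<in> T (Suc j) K'"
        unfolding a_minus_def using xT additive_subgroup.a_inv_closed[OF T_subgroup yT] by (rule T_add)
      finally have XT: "X (Suc j) a \<in> T (Suc j) (K' + c - c)" by simp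
      have "a \<in> T (Suc j) (K' + c)" by (rule x_regular[OF i V NP a(2) XT])
      then obtain u b where u: "a = u \<oplus> b" "u \<in> UL (K' + c)" "b \<in> xspan (Suc j) n M (U (K' + c + c))"
        unfolding T_def by blast
      have ucl: "u \<in> carrier M" "b \<in> carrier M" using u UL_sub xspan_sub[OF U_sub] by blast+
      obtain L where L: "L < K' + c" "u \<in> U L" using u(2) unfolding UL_iff by blast
      \<comment> \<open>The new coefficient \<open>u\<close> has level \<open>L < K' + c\<close>, so
        \<open>X (Suc j) u\<close> has level \<open>L - c < K'\<close>. The maximum with
        \<open>k\<close> keeps \<open>x\<close> itself inside \<open>U L'\<close>.\<close>
      define L' where "L' = max k (L - c)"
      have L': "k \<le> L'" "L' < K'" "L \<le> L' + c" using K'(1) L(1) by (auto simp: L'_def)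
      \<comment> \<open>\<open>z\<close> collects all terms in the later variables: \<open>b\<close>
        is a combination of these, and \<open>x_(j+1)\<close> commutes with them. Being the
        difference of \<open>x\<close> and \<open>X (Suc j) u\<close>, it lies in
        \<open>U L'\<close>, so the outer induction rewrites it with coefficients of level
        \<open>L' + c\<close>.\<close>
      define z where "z = X (Suc j) b \<oplus> y"
      have Xu: "X (Suc j) u \<in> carrier M" "X (Suc j) b \<in> carrier M" using X_closed[OF i] ucl by auto
      have zcl: "z \<in> carrier M" unfolding z_def using Xu acl by simp
      have "X (Suc j) a = X (Suc j) u \<oplus> X (Suc j) b"
        unfolding u(1) by (rule smult_r_distr[OF xvar_closed[OF i] ucl])
      then have xz: "x = X (Suc j) u \<oplus> z" unfolding a(1) z_def using Xu acl by (simp add: M.a_assoc)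
      have "X (Suc j) b \<in> xspan (Suc j) n M (carrier M)"
        using xspan_mono[OF U_sub] u(3)
        by (intro xspan_act[OF order_refl xvar_closed[OF i] X_closed[OF i] xvar_commute]) blast+
      moreover have "y \<in> xspan (Suc j) n M (carrier M)" using xspan_mono[OF U_sub] a(3) by blast
      ultimately have z1: "z \<in> xspan (Suc j) n M (carrier M)"
        unfolding z_def by (intro xspan_add) auto
      have "X (Suc j) u \<in> U (L - c)" by (rule X_U[OF i L(2)])
      then have "X (Suc j) u \<in> U L'" using U_mono[of "L - c" L'] by (auto simp: L'_def)
      moreover have "x \<in> U L'" using step(4) U_mono[OF L'(1)] by blast
      moreover have "z = x \<ominus> X (Suc j) u"
        unfolding xz a_minus_def by (rule add_minus_cancel_left[OF Xu(1) zcl, symmetric])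
      ultimately have "z \<in> U L'"
        unfolding a_minus_def by (simp add: U_add additive_subgroup.a_inv_closed[OF U_subgroup])
      then have "z \<in> xspan (Suc j) n M (U (L' + c))" using step(3)[of z L'] z1 step(6) by auto
      moreover have "u \<in> U (L' + c)" using L(2) U_mono[OF L'(3)] by blast
      ultimately have "x \<in> xspan j n M (U (L' + c))"
        unfolding xspan_Suc[OF step(2) U_sub] xz by blast
      \<comment> \<open>The measure drops strictly because \<open>L' < K'\<close> and
        \<open>K'\<close> is the last jump up to \<open>K\<close>.\<close>
      moreover have "nat (jumps L' - jumps k) < nat (jumps K - jumps k)"
        using K'(4)[OF L'(2)] jumps_mono[OF L'(1)] by simp
      ultimately show ?thesis using less(1) L'(1) by blast
    qed
  qed
  obtain K where "k \<le> K" "x \<in> xspan j n M (U (K + c))" using xspan_exhaust[OF ex step(5)] by blast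
  then show ?case by (rule main)
qed

end

section \<open>Consequences of the non-characteristic condition\<close>

lemma weyl_carrierE:
  assumes "P \<in> carrier (weyl n)" "q \<in> keys P"
  obtains \<alpha> \<beta> where "q = (\<alpha>, \<beta>)" "\<alpha> \<in> mindices n" "\<beta> \<in> mindices n"
  using assms unfolding weyl_carrier_iff by blast

text \<open>The symbol \<open>p(0, \<xi>)\<close>, with the coefficients frozen at the
  origin.\<close>

definition x_free :: "weyl_elem \<Rightarrow> cpoly" where
  "x_free p = (\<Sum>k\<in>keys p. if fst k = 0 then single (snd k) (lookup p k) else 0)"

lemma lookup_x_free: "lookup (x_free p) \<beta> = lookup p (0, \<beta>)"
proof -
  have "lookup (x_free p) \<beta> = (\<Sum>k\<in>keys p. if k = (0, \<beta>) then lookup p (0, \<beta>) else 0)"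
    unfolding x_free_def lookup_sum by (intro sum.cong refl) (auto simp: lookup_single when_def)
  then show ?thesis by (auto simp: in_keys_iff)
qed

lemma symbol_eval_at_0: "symbol_eval p (\<lambda>_. 0) a = cpoly_eval (x_free p) a"
proof -
  have "cpoly_eval (x_free p) a
    = (\<Sum>k\<in>keys p. if fst k = 0 then lookup p k * mindex_eval a (snd k) else 0)"
    unfolding x_free_def cpoly_eval_sum by (intro sum.cong refl) (simp add: cpoly_eval_single cpoly_eval_0)
  also have "\<dots> = symbol_eval p (\<lambda>_. 0) a"
    unfolding symbol_eval_def
  proof (intro sum.cong refl)
    fix k :: "mindex \<times> mindex"
    have "(\<Prod>i\<in>keys (fst k). 0 ^ lookup (fst k) i) = (0::complex)" if k: "fst k \<noteq> 0"
    proof -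
      have "keys (fst k) \<noteq> {}" using k by simp
      then obtain i where "i \<in> keys (fst k)" by blast
      then show ?thesis by (intro prod_zero) (auto simp: in_keys_iff intro!: bexI[of _ i])
    qed
    then show "(if fst k = 0 then lookup p k * mindex_eval a (snd k) else 0)
      = lookup p k * (\<Prod>i\<in>keys (fst k). 0 ^ lookup (fst k) i) * (\<Prod>i\<in>keys (snd k). a i ^ lookup (snd k) i)"
      by (auto simp: mindex_eval_def)
  qed
  finally show ?thesis ..
qed

lemma cpoly_eval_sum_hcomp: "cpoly_eval q a = (\<Sum>d\<in>mdeg ` keys q. cpoly_eval (hcomp d q) a)"
proof -
  have "q = (\<Sum>d\<in>mdeg ` keys q. hcomp d q)"
    by (rule poly_mapping_eqI) (auto simp: lookup_sum lookup_keep in_keys_iff)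
  then have "cpoly_eval q a = cpoly_eval (\<Sum>d\<in>mdeg ` keys q. hcomp d q) a" by simp
  then show ?thesis by (simp only: cpoly_eval_sum)
qed

context weyl_module
begin

text \<open>Finitely many coefficients have a common bound on their orders. An integral index is
  provided for the sake of the order filtration, whose levels are stepped through by
  integers.\<close>

lemma good_filtration_exhaust:
  assumes gen: "lmod_generates (weyl n) M s m"
    and F: "\<And>k. F k = {\<Oplus>l\<in>{..<s}. P l \<odot> m l | P. \<forall>l<s. P l \<in> weyl_filt n uv (k - \<kappa> l)}"
    and x: "x \<in> carrier M"
  shows "\<exists>k::int. x \<in> F (of_int k)"
proof -
  obtain P where P: "P \<in> {..<s} \<rightarrow> carrier (weyl n)" "x = (\<Oplus>l\<in>{..<s}. P l \<odot> m l)"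
    using x gen unfolding lmod_generates_def by auto
  \<comment> \<open>For \<open>P l = 0\<close> the value of \<open>e l\<close> is meaningless, but 0
    lies in every level.\<close>
  define e where "e l = weyl_ord n uv (P l)" for l
  have e: "P l \<in> weyl_filt n uv (e l)" if "l < s" for l
    using P(1) that by (auto simp: weyl_filt_def e_def)
  define b where "b = Max (insert 0 ((\<lambda>l. e l + \<kappa> l) ` {..<s}))"
  have "P l \<in> weyl_filt n uv (of_int \<lceil>b\<rceil> - \<kappa> l)" if l: "l < s" for l
  proof -
    have "e l + \<kappa> l \<le> b" unfolding b_def using l by (intro Max_ge) auto
    then have "e l + \<kappa> l \<le> of_int \<lceil>b\<rceil>" by (rule order_trans[OF _ le_of_int_ceiling])
    then have "e l \<le> of_int \<lceil>b\<rceil> - \<kappa> l" by simp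
    then show ?thesis using e[OF l] weyl_filt_mono by blast
  qed
  then have "x \<in> F (of_int \<lceil>b\<rceil>)" unfolding F P(2) by blast
  then show ?thesis ..
qed

lemma gr_class_closed:
  assumes F: "\<And>k. F k \<subseteq> carrier M" "\<And>k. \<zero> \<in> F k" and u: "u \<in> F k"
  shows "gr_class M F k u \<in> carrier (gr_module n uv M F)"
proof -
  have sub: "filt_less F k \<subseteq> carrier M" for k using F(1) by (auto simp: filt_less_def)
  have zero: "filt_less F k +> \<zero> = filt_less F k" for k
    using M.a_coset_add_zero[OF sub] .
  have "gr_class M F k u j \<in> (\<lambda>u. filt_less F j +> u) ` F j" for j
  proof (cases "j = k")
    case True
    then show ?thesis using u by (auto simp: gr_class_def)
  next
    case False
    then have "gr_class M F k u j = filt_less F j +> \<zero>" by (simp add: gr_class_def zero)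
    then show ?thesis using F(2)[of j] by (simp only:) blast
  qed
  moreover have "finite {j. gr_class M F k u j \<noteq> filt_less F j}"
    by (rule finite_subset[of _ "{k}"]) (auto simp: gr_class_def)
  ultimately show ?thesis by (simp add: gr_module_def)
qed

text \<open>Annihilation is tested on the class of \<open>u\<close> placed in degree
  \<open>k\<close>; in degree \<open>k + d\<close> the result sees only the component of weight
  \<open>d\<close>.\<close>

lemma annihilator_comp:
  assumes F: "\<And>k. F k \<subseteq> carrier M" "\<And>k. \<zero> \<in> F k" and u: "u \<in> F k"
    and p: "p \<in> carrier (weyl n)"
    and ann: "\<And>g. g \<in> carrier (gr_module n uv M F) \<Longrightarrow>
      p \<odot>\<^bsub>gr_module n uv M F\<^esub> g = \<zero>\<^bsub>gr_module n uv M F\<^esub>"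
  shows "weyl_comp n uv d p \<odot> u \<in> filt_less F (k + d)"
proof (cases "d \<in> monom_weight n uv ` keys p")
  case True
  let ?g = "gr_class M F k u" and ?degs = "monom_weight n uv ` keys p"
  \<comment> \<open>The graded action is a union over representatives; this choice puts
    \<open>u\<close> in the slot of \<open>d\<close> and 0 in all others.\<close>
  let ?v = "\<lambda>e. if e = d then u else \<zero>"
  have zF: "\<zero> \<in> filt_less F j" for j using F(2)[of "j - 1"] by (auto simp: filt_less_def intro!: bexI[of _ "j - 1"])
  have sub: "filt_less F k \<subseteq> carrier M" for k using F(1) by (auto simp: filt_less_def)
  have ucl: "u \<in> carrier M" using u F(1) by blast
  have pcl: "weyl_comp n uv e p \<odot> u \<in> carrier M" for e
    using weyl_comp_closed[OF p] ucl by (intro smult_closed)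
  have self: "x \<in> filt_less F j +> x" if "x \<in> carrier M" for x j
    unfolding a_r_coset_def' using zF[of j] that by (auto intro!: bexI[of _ "\<zero>"])
  have v: "?v \<in> (\<Pi> e\<in>?degs. ?g (k + d - e))"
  proof
    fix e assume "e \<in> ?degs"
    show "?v e \<in> ?g (k + d - e)"
      using self[OF ucl] zF by (cases "e = d") (auto simp: gr_class_def)
  qed
  have "(\<Oplus>e\<in>?degs. weyl_comp n uv e p \<odot> ?v e)
    = (\<Oplus>e\<in>?degs. if d = e then weyl_comp n uv e p \<odot> u else \<zero>)"
    using weyl_comp_closed[OF p] pcl by (intro M.finsum_cong' refl) (auto simp: smult_r_null)
  also have "\<dots> = weyl_comp n uv d p \<odot> u"
    using True pcl by (intro M.finsum_singleton) auto
  finally have sum: "(\<Oplus>e\<in>?degs. weyl_comp n uv e p \<odot> ?v e) = weyl_comp n uv d p \<odot> u" .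
  have "weyl_comp n uv d p \<odot> u \<in> filt_less F (k + d) +> (\<Oplus>e\<in>?degs. weyl_comp n uv e p \<odot> ?v e)"
    unfolding sum by (rule self[OF pcl])
  then have "weyl_comp n uv d p \<odot> u \<in> gr_smult n uv M F p ?g (k + d)"
    unfolding gr_smult_def Let_def using v by blast
  moreover have "gr_smult n uv M F p ?g = filt_less F"
    using ann[OF gr_class_closed[of F u k], OF F u] by (simp add: gr_module_def)
  ultimately show ?thesis by simp
next
  case False
  then have "weyl_comp n uv d p = 0"
    unfolding weyl_comp_eq_keep by (intro poly_mapping_eqI) (auto simp: lookup_keep in_keys_iff)
  moreover have "\<zero> \<in> filt_less F (k + d)"
    using F(2)[of "k + d - 1"] by (auto simp: filt_less_def intro!: bexI[of _ "k + d - 1"])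
  moreover have "u \<in> carrier M" using u F(1) by blast
  ultimately show ?thesis by (simp add: smult_0)
qed

end

context good_V_filtered
begin

text \<open>The annihilator, among constant-coefficient operators, of the classes of the generators
  in the graded module. Imposing the condition on every component makes the ideal homogeneous by
  construction.\<close>

definition gen_ann :: "cpoly set" where
  "gen_ann = {p. \<forall>d. \<forall>l<s. D (hcomp d p) (m l) \<in> UL (\<kappa> l + real d * c)}"

lemma hcomp_single_mult:
  "hcomp d (single \<beta> z * p) = (if mdeg \<beta> \<le> d then single \<beta> z * hcomp (d - mdeg \<beta>) p else 0)"
proof (rule additive_eq[of "\<lambda>p. hcomp d (single \<beta> z * p)"
      "\<lambda>p. if mdeg \<beta> \<le> d then single \<beta> z * hcomp (d - mdeg \<beta>) p else 0"])
  fix h :: "mindex \<Rightarrow> cpoly" and S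
  show "hcomp d (single \<beta> z * sum h S) = (\<Sum>s\<in>S. hcomp d (single \<beta> z * h s))"
    by (simp only: sum_distrib_left keep_sum)
  show "(if mdeg \<beta> \<le> d then single \<beta> z * hcomp (d - mdeg \<beta>) (sum h S) else 0)
    = (\<Sum>s\<in>S. if mdeg \<beta> \<le> d then single \<beta> z * hcomp (d - mdeg \<beta>) (h s) else 0)"
    by (simp add: sum_distrib_left keep_sum)
next
  fix \<gamma> y
  show "hcomp d (single \<beta> z * single \<gamma> y)
    = (if mdeg \<beta> \<le> d then single \<beta> z * hcomp (d - mdeg \<beta>) (single \<gamma> y) else 0)"
    by (auto simp: mult_single keep_single mdeg_add)
qed

lemma gen_ann_ideal: "is_ideal gen_ann"
proof -
  have z: "0 \<in> gen_ann" unfolding gen_ann_def using m_closed UL_zero by (simp add: keep_0 const_op_0 smult_0)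
  have a: "p + q \<in> gen_ann" if "p \<in> gen_ann" "q \<in> gen_ann" for p q
    using that m_closed UL_add unfolding gen_ann_def
    by (simp add: keep_add const_op_add smult_add const_op_closed)
  have b: "single \<beta> z * p \<in> gen_ann" if p: "p \<in> gen_ann" for p \<beta> z
    unfolding gen_ann_def
  proof (intro CollectI allI impI)
    fix d l assume l: "l < s"
    show "D (hcomp d (single \<beta> z * p)) (m l) \<in> UL (\<kappa> l + real d * c)"
    proof (cases "mdeg \<beta> \<le> d")
      case True
      have 1: "D (hcomp (d - mdeg \<beta>) p) (m l) \<in> UL (\<kappa> l + real (d - mdeg \<beta>) * c)"
        using p l unfolding gen_ann_def by blast
      have "homog (mdeg \<beta>) (single \<beta> z)" by (simp add: homog_def)
      from D_UL[OF this 1] True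
      have "D (single \<beta> z) (D (hcomp (d - mdeg \<beta>) p) (m l)) \<in> UL (\<kappa> l + real d * c)"
        by (simp add: of_nat_diff algebra_simps)
      then show ?thesis using True m_closed[OF l] by (simp add: hcomp_single_mult D_mult)
    next
      case False
      then show ?thesis using m_closed[OF l] UL_zero by (simp add: hcomp_single_mult const_op_0 smult_0)
    qed
  qed
  have s: "sum h S \<in> gen_ann" if "\<And>s. s \<in> S \<Longrightarrow> h s \<in> gen_ann" for h and S :: "mindex set"
    using that by (induction S rule: infinite_finite_induct) (simp_all add: z a)
  have "q * p \<in> gen_ann" if p: "p \<in> gen_ann" for p q
  proof -
    have "(\<Sum>\<beta>\<in>keys q. single \<beta> (lookup q \<beta>) * p) \<in> gen_ann" by (intro s b p)
    then show ?thesis unfolding sum_distrib_right[symmetric] poly_mapping_sum_single[of q, symmetric] .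
  qed
  with z a show ?thesis unfolding is_ideal_def by blast
qed

lemma hcomp_gen_ann:
  assumes "p \<in> gen_ann" shows "hcomp d p \<in> gen_ann"
proof -
  have e: "hcomp e (hcomp d p) = (if e = d then hcomp d p else 0)" for e
    by (rule poly_mapping_eqI) (auto simp: lookup_keep)
  show ?thesis using assms m_closed UL_zero unfolding gen_ann_def
    by (auto simp: e const_op_0 smult_0)
qed

lemma homog_in_gen_ann:
  assumes "homog d p" shows "p \<in> gen_ann \<longleftrightarrow> (\<forall>l<s. D p (m l) \<in> UL (\<kappa> l + real d * c))"
proof -
  have e: "hcomp e p = (if e = d then p else 0)" for e
    using assms by (intro poly_mapping_eqI) (auto simp: lookup_keep homog_def in_keys_iff)
  show ?thesis using m_closed UL_zero unfolding gen_ann_def by (auto simp: e const_op_0 smult_0)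
qed

lemma var_gen_ann:
  assumes "i \<notin> {1..n}" shows "var i \<in> gen_ann"
proof -
  have "homog 1 (var i)" by (simp add: homog_def var_def mdeg_single)
  moreover have "single i 1 \<notin> mindices n"
    using assms by (simp add: mindices_def del: atLeastAtMost_iff)
  then have "const_op n (var i) = 0" by (simp only: var_def const_op_single if_False)
  ultimately show ?thesis using homog_in_gen_ann m_closed UL_zero by (simp add: smult_0)
qed

text \<open>
  The coefficients at the origin of an operator of order \<open>d\<close> form its part of highest \<open>V\<close>-degree
  \<open>d c\<close>.
\<close>

lemma x_free_leading:
  assumes p: "p \<in> carrier (weyl n)" "\<And>k. k \<in> keys p \<Longrightarrow> mdeg (snd k) = d"
    and u: "u \<in> U k"
  shows "\<exists>e\<in>UL (k + real (t * d) * c). ((\<lambda>x. p \<odot> x) ^^ t) u = D (x_free p ^ t) u \<oplus> e"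
proof (induction t)
  case 0
  have "u \<in> carrier M" using u U_sub by blast
  then have "u = D (x_free p ^ 0) u \<oplus> \<zero>" by (simp add: D_1)
  then show ?case unfolding funpow_0 using UL_zero by blast
next
  case (Suc t)
  obtain e where e: "e \<in> UL (k + real (t * d) * c)"
    "((\<lambda>x. p \<odot> x) ^^ t) u = D (x_free p ^ t) u \<oplus> e" by (rule bexE[OF Suc])
  \<comment> \<open>\<open>R\<close> collects the terms with at least one factor \<open>x\<close>.
    Each such factor lowers the \<open>V\<close>-weight by \<open>c\<close>, so \<open>R\<close>
    contributes only to the error term.\<close>
  define R where "R = p - const_op n (x_free p)"
  have lR: "lookup R q = (if fst q = 0 then 0 else lookup p q)" for q
  proof (cases "fst q = 0 \<and> snd q \<notin> mindices n")
    case True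
    then have "q \<notin> mindices n \<times> mindices n" by (simp add: mem_Times_iff)
    then have "q \<notin> keys p" using p(1) unfolding weyl_carrier_iff by (rule contra_subsetD[rotated])
    then show ?thesis using True by (simp add: R_def lookup_minus lookup_const_op in_keys_iff)
  next
    case False
    have "lookup p (0, snd q) = lookup p q" if "fst q = 0" using that by (cases q) simp
    then show ?thesis using False by (auto simp: R_def lookup_minus lookup_const_op lookup_x_free)
  qed
  have kR: "keys R \<subseteq> keys p" by (auto simp: in_keys_iff lR split: if_splits)
  have Rcl: "R \<in> carrier (weyl n)" using p(1) kR by (auto simp: weyl_carrier_iff)
  have wt: "monom_weight n (V_weight w) q = c * (real (mdeg (snd q)) - real (mdeg (fst q)))"
    if q: "q \<in> keys p" for q
  proof -
    obtain \<alpha> \<beta> where ab: "q = (\<alpha>, \<beta>)" "\<alpha> \<in> mindices n" "\<beta> \<in> mindices n"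
      by (rule weyl_carrierE[OF p(1) q])
    then show ?thesis using monom_weight_V_const[of n w c \<alpha> \<beta>] w_const by simp
  qed
  have RV: "R \<in> weyl_filt n (V_weight w) (real d * c - c)"
    unfolding weyl_filt_iff
  proof (intro conjI ballI Rcl)
    fix q assume q: "q \<in> keys R"
    then have "fst q \<noteq> 0" by (auto simp: in_keys_iff lR split: if_splits)
    then have "1 \<le> mdeg (fst q)" using mdeg_eq_0[of "fst q"] by linarith
    then have "c * real 1 \<le> c * real (mdeg (fst q))" using c_pos by (intro mult_left_mono) auto
    then show "monom_weight n (V_weight w) q \<le> real d * c - c"
      using q kR wt[of q] p(2)[of q] by (auto simp: algebra_simps)
  qed
  have pV: "p \<in> weyl_filt n (V_weight w) (real d * c)"
    unfolding weyl_filt_iff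
  proof (intro conjI ballI p(1))
    fix q assume q: "q \<in> keys p"
    have "0 \<le> c * real (mdeg (fst q))" using c_pos by simp
    then show "monom_weight n (V_weight w) q \<le> real d * c"
      using q wt[of q] p(2)[of q] by (simp add: algebra_simps)
  qed
  let ?y = "D (x_free p ^ t) u"
  have "homog d (x_free p)" using p(2) by (fastforce simp: homog_def in_keys_iff lookup_x_free)
  then have yU: "?y \<in> U (k + real (t * d) * c)" using D_U[OF homog_power u] by blast
  have cl: "u \<in> carrier M" "?y \<in> carrier M" "e \<in> carrier M" using u yU e(1) U_sub UL_sub by blast+
  have "p = const_op n (x_free p) + R" by (simp add: R_def)
  then have py: "p \<odot> ?y = D (x_free p) ?y \<oplus> R \<odot> ?y"
    using smult_add[OF const_op_closed Rcl cl(2)] by metis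
  have "((\<lambda>x. p \<odot> x) ^^ Suc t) u = p \<odot> (?y \<oplus> e)" by (simp add: e(2))
  also have "\<dots> = (D (x_free p) ?y \<oplus> R \<odot> ?y) \<oplus> p \<odot> e"
    unfolding py[symmetric] by (rule smult_r_distr[OF p(1) cl(2,3)])
  also have "\<dots> = D (x_free p ^ Suc t) u \<oplus> (R \<odot> ?y \<oplus> p \<odot> e)"
    using cl p(1) Rcl by (simp add: D_mult M.a_assoc smult_closed const_op_closed)
  finally have 1: "((\<lambda>x. p \<odot> x) ^^ Suc t) u = \<dots>" .
  have "R \<odot> ?y \<in> UL (k + real (Suc t * d) * c)"
    by (rule UL_act_U[OF RV yU]) (use c_pos in \<open>simp add: algebra_simps\<close>)
  moreover have "p \<odot> e \<in> UL (k + real (Suc t * d) * c)"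
    using UL_act[OF pV e(1)] by (simp add: algebra_simps)
  ultimately show ?case using 1 UL_add by blast
qed

lemma annihilator_x_free_power:
  assumes F: "good_filtration \<int> n order_weight M F"
    and p: "p \<in> carrier (weyl n)"
    and ann: "\<forall>g\<in>carrier (gr_module n order_weight M F).
      p \<odot>\<^bsub>gr_module n order_weight M F\<^esub> g = \<zero>\<^bsub>gr_module n order_weight M F\<^esub>"
    and ex: "carrier M = (\<Union>k. U k)"
  shows "\<exists>t. hcomp d (x_free p) ^ t \<in> gen_ann"
proof -
  obtain s' m' \<kappa>' where gen: "lmod_generates (weyl n) M s' m'" and \<kappa>': "\<kappa>' \<in> {..<s'} \<rightarrow> \<int>"
    and Feq: "\<And>k. F k = {\<Oplus>l\<in>{..<s'}. P l \<odot> m' l | P. \<forall>l<s'. P l \<in> weyl_filt n order_weight (k - \<kappa>' l)}"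
    using F unfolding good_filtration_def by blast
  have m': "m' l \<in> carrier M" if "l < s'" for l using gen that by (auto simp: lmod_generates_def)
  have Fsub: "F k \<subseteq> carrier M" for k
    unfolding Feq using m' by (auto intro!: M.finsum_closed smult_closed simp: weyl_filt_iff)
  have Fzero: "\<zero> \<in> F k" for k
  proof -
    have "(\<Oplus>l\<in>{..<s'}. 0 \<odot> m' l) = (\<Oplus>l\<in>{..<s'}. \<zero>)"
      using m' by (intro M.finsum_cong' refl) (auto simp: smult_0)
    then have "\<zero> = (\<Oplus>l\<in>{..<s'}. 0 \<odot> m' l)" by simp
    then show ?thesis unfolding Feq by (intro CollectI exI[of _ "\<lambda>_. 0"]) (simp add: zero_weyl_filt)
  qed
  define b where "b l = (SOME k. m' l \<in> U k)" for l
  have b: "m' l \<in> U (b l)" if "l < s'" for l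
  proof -
    have "\<exists>k. m' l \<in> U k" using m'[OF that] ex by blast
    then show ?thesis unfolding b_def by (rule someI_ex)
  qed
  \<comment> \<open>\<open>C\<close> bounds the discrepancy between the two filtrations on the
    generators \<open>m' l\<close> of \<open>F\<close>; beyond that, an operator of order at most
    \<open>e\<close> has \<open>V\<close>-weight at most \<open>c e\<close>.\<close>
  define C where "C = Max (insert 0 ((\<lambda>l. b l - c * \<kappa>' l) ` {..<s'}))"
  have FU: "F k \<subseteq> U (c * k + C)" for k
  proof
    fix x assume "x \<in> F k"
    then obtain P where P: "\<forall>l<s'. P l \<in> weyl_filt n order_weight (k - \<kappa>' l)" "x = (\<Oplus>l\<in>{..<s'}. P l \<odot> m' l)"
      unfolding Feq by blast
    show "x \<in> U (c * k + C)" unfolding P(2)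
    proof (rule M.finsum_mem[OF U_sub U_zero U_add])
      fix l assume l: "l \<in> {..<s'}"
      have "P l \<in> weyl_filt n (V_weight w) (c * (k - \<kappa>' l))"
        unfolding weyl_filt_iff
      proof (intro conjI ballI)
        show Pc: "P l \<in> carrier (weyl n)" using P(1) l by (simp add: weyl_filt_iff)
        fix q assume q: "q \<in> keys (P l)"
        obtain \<alpha> \<beta> where ab: "q = (\<alpha>, \<beta>)" "\<alpha> \<in> mindices n" "\<beta> \<in> mindices n"
          by (rule weyl_carrierE[OF Pc q])
        have "monom_weight n order_weight q \<le> k - \<kappa>' l" using P(1) l q by (auto simp: weyl_filt_iff)
        then have "real (mdeg \<beta>) \<le> k - \<kappa>' l" by (simp add: ab(1) monom_weight_order[OF ab(3)])
        then have "c * (real (mdeg \<beta>) - real (mdeg \<alpha>)) \<le> c * (k - \<kappa>' l)" using c_pos by (intro mult_left_mono) auto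
        then show "monom_weight n (V_weight w) q \<le> c * (k - \<kappa>' l)"
          using ab monom_weight_V_const[of n w c \<alpha> \<beta>] w_const by simp
      qed
      then have "P l \<odot> m' l \<in> U (c * (k - \<kappa>' l) + b l)" using b l by (intro U_act) auto
      moreover have "b l - c * \<kappa>' l \<le> C" unfolding C_def using l by (intro Max_ge) auto
      then have "c * (k - \<kappa>' l) + b l \<le> c * k + C" by (simp add: algebra_simps)
      ultimately show "P l \<odot> m' l \<in> U (c * k + C)" using U_mono by blast
    qed
  qed
  \<comment> \<open>Orders and the shifts \<open>\<kappa>' l\<close> are integers, so strictly below
    an integral index means lower by at least one.\<close>
  have Fless: "filt_less F (of_int k) \<subseteq> F (of_int k - 1)" for k :: int
  proof
    fix x assume "x \<in> filt_less F (of_int k)"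
    then obtain j where j: "j < of_int k" "x \<in> F j" by (auto simp: filt_less_def)
    then obtain P where P: "\<forall>l<s'. P l \<in> weyl_filt n order_weight (j - \<kappa>' l)" "x = (\<Oplus>l\<in>{..<s'}. P l \<odot> m' l)"
      unfolding Feq by blast
    have "P l \<in> weyl_filt n order_weight (of_int k - 1 - \<kappa>' l)" if l: "l < s'" for l
      unfolding weyl_filt_iff
    proof (intro conjI ballI)
      show Pc: "P l \<in> carrier (weyl n)" using P(1) l by (simp add: weyl_filt_iff)
      fix q assume q: "q \<in> keys (P l)"
      obtain \<alpha> \<beta> where ab: "q = (\<alpha>, \<beta>)" "\<alpha> \<in> mindices n" "\<beta> \<in> mindices n"
        by (rule weyl_carrierE[OF Pc q])
      obtain z :: int where z: "\<kappa>' l = of_int z" using \<kappa>' l by (auto elim: Ints_cases)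
      have "monom_weight n order_weight q \<le> j - \<kappa>' l" using P(1) l q by (auto simp: weyl_filt_iff)
      then have "real (mdeg \<beta>) < of_int k - of_int z" using j(1) z by (simp add: ab(1) monom_weight_order[OF ab(3)])
      then have "int (mdeg \<beta>) \<le> k - 1 - z" by linarith
      then have "real (mdeg \<beta>) \<le> of_int (k - 1 - z)" by linarith
      then show "monom_weight n order_weight q \<le> of_int k - 1 - \<kappa>' l" by (simp add: ab(1) monom_weight_order[OF ab(3)] z)
    qed
    then show "x \<in> F (of_int k - 1)" unfolding Feq P(2) by blast
  qed
  let ?p = "weyl_comp n order_weight (real d) p"
  have step: "?p \<odot> u \<in> F (of_int (k + (int d - 1)))" if "u \<in> F (of_int k)" for u and k :: int
    using annihilator_comp[OF Fsub Fzero that p bspec[OF ann], of "real d"] Fless[of "k + int d"] by (auto simp: algebra_simps)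
  have iter: "((\<lambda>x. ?p \<odot> x) ^^ t) u \<in> F (of_int (k + int t * (int d - 1)))" if "u \<in> F (of_int k)" for u t and k :: int
  proof (induction t)
    case (Suc t)
    then show ?case using step[OF Suc] by (simp add: algebra_simps)
  qed (use that in simp)
  have pc: "?p \<in> carrier (weyl n)" by (rule weyl_comp_closed[OF p])
  have pd: "mdeg (snd k) = d" if k: "k \<in> keys ?p" for k
  proof -
    have "monom_weight n order_weight k = real d" using k by (simp add: weyl_comp_eq_keep keys_keep)
    moreover obtain \<alpha> \<beta> where "k = (\<alpha>, \<beta>)" "\<beta> \<in> mindices n" using weyl_carrierE[OF pc k] by blast
    ultimately show ?thesis using monom_weight_order by simp
  qed
  have xf: "x_free ?p = hcomp d (x_free p)"
  proof (rule poly_mapping_eqI)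
    fix \<beta>
    show "lookup (x_free ?p) \<beta> = lookup (hcomp d (x_free p)) \<beta>"
    proof (cases "(0, \<beta>) \<in> keys p")
      case True
      then have "\<beta> \<in> mindices n" using p by (auto simp: weyl_carrier_iff)
      then show ?thesis by (simp add: lookup_x_free weyl_comp_eq_keep lookup_keep monom_weight_order)
    next
      case False
      then show ?thesis by (simp add: lookup_x_free weyl_comp_eq_keep lookup_keep in_keys_iff)
    qed
  qed
  let ?q = "hcomp d (x_free p)"
  have hq: "homog (t * d) (?q ^ t)" for t by (intro homog_power homog_hcomp)
  have ex1: "\<exists>t. D (?q ^ t) (m l) \<in> UL (\<kappa> l + real (t * d) * c)" if l: "l < s" for l
  proof -
    obtain k :: int where k: "m l \<in> F (of_int k)" using good_filtration_exhaust[OF gen Feq m_closed[OF l]] by blast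
    \<comment> \<open>The iterate lies in \<open>U\<close> at level
      \<open>c (k + t d - t) + C\<close>, which is to be less than
      \<open>\<kappa> l + t d c\<close>; the terms in \<open>t d\<close> cancel.\<close>
    obtain t :: nat where t: "(c * of_int k + C - \<kappa> l) / c < real t" using reals_Archimedean2 by blast
    then have t': "c * of_int k + C - \<kappa> l < real t * c" using c_pos by (simp add: pos_divide_less_eq)
    let ?K = "of_int (k + int t * (int d - 1)) :: real"
    have "((\<lambda>x. ?p \<odot> x) ^^ t) (m l) \<in> U (c * ?K + C)" using iter[OF k] FU by blast
    moreover have "c * ?K + C < \<kappa> l + real (t * d) * c" using t' by (simp add: algebra_simps)
    ultimately have 1: "((\<lambda>x. ?p \<odot> x) ^^ t) (m l) \<in> UL (\<kappa> l + real (t * d) * c)" using U_sub_UL by blast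
    obtain e where e: "e \<in> UL (\<kappa> l + real (t * d) * c)"
      "((\<lambda>x. ?p \<odot> x) ^^ t) (m l) = D (?q ^ t) (m l) \<oplus> e"
      using x_free_leading[OF pc pd m_in_U[OF l], of t] unfolding xf by blast
    have cl: "e \<in> carrier M" "D (?q ^ t) (m l) \<in> carrier M" using e(1) UL_sub D_closed m_closed[OF l] by blast+
    have "D (?q ^ t) (m l) = ((\<lambda>x. ?p \<odot> x) ^^ t) (m l) \<oplus> \<ominus> e"
      unfolding e(2) using add_minus_cancel_left[OF cl] cl by (simp add: M.a_comm)
    also have "\<dots> \<in> UL (\<kappa> l + real (t * d) * c)"
      by (rule UL_add[OF 1 additive_subgroup.a_inv_closed[OF UL_subgroup e(1)]])
    finally show ?thesis by blast
  qed
  then obtain t where t: "\<And>l. l < s \<Longrightarrow> D (?q ^ t l) (m l) \<in> UL (\<kappa> l + real (t l * d) * c)" by metis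
  \<comment> \<open>The sum serves merely as a common upper bound of the exponents
    \<open>t l\<close>.\<close>
  let ?t = "\<Sum>l<s. t l"
  have "D (?q ^ ?t) (m l) \<in> UL (\<kappa> l + real (?t * d) * c)" if l: "l < s" for l
  proof -
    have tl: "t l \<le> ?t" using l by (intro member_le_sum) auto
    have "?q ^ ?t = ?q ^ (?t - t l) * ?q ^ t l" using tl by (simp add: power_add[symmetric])
    then have "D (?q ^ ?t) (m l) = D (?q ^ (?t - t l)) (D (?q ^ t l) (m l))" by (simp add: D_mult m_closed[OF l])
    also have "\<dots> \<in> UL (\<kappa> l + real (t l * d) * c + real ((?t - t l) * d) * c)" by (rule D_UL[OF hq t[OF l]])
    also have "\<kappa> l + real (t l * d) * c + real ((?t - t l) * d) * c = \<kappa> l + real (?t * d) * c"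
      using tl by (simp add: of_nat_diff algebra_simps)
    finally show ?thesis .
  qed
  then have "?q ^ ?t \<in> gen_ann" unfolding homog_in_gen_ann[OF hq] by blast
  then show ?thesis ..
qed

text \<open>A common zero \<open>a\<close> of the annihilator and of the variables outside
  \<open>r+1..n\<close> gives a point \<open>(0, a)\<close> of the conormal space and of the
  characteristic variety, so the hypothesis forces \<open>a = 0\<close>. The Nullstellensatz then
  yields the powers of variables that the integral equation requires.\<close>

theorem noncharacteristic_operators:
  assumes fg: "lmod_fin_gen (weyl n) M" and nc: "noncharacteristic_near_origin r n M"
    and ex: "carrier M = (\<Union>k. U k)" and r: "r \<le> n" and j: "j \<in> {r+1..n}"
  shows "\<exists>N P. homog N P \<and> P \<in> monos_in (insert j {1..r}) \<and> lookup P (single j N) = 1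
    \<and> (\<forall>l<s. D P (m l) \<in> UL (\<kappa> l + real N * c))"
proof -
  \<comment> \<open>The same choice as in \<open>char_variety\<close>, whose annihilator is taken
    for this particular filtration.\<close>
  define F where "F = (SOME F. good_filtration \<int> n order_weight M F)"
  have "\<exists>F. good_filtration \<int> n order_weight M F"
  proof -
    obtain s' m' where gen: "lmod_generates (weyl n) M s' m'" using fg unfolding lmod_fin_gen_def by blast
    show ?thesis unfolding good_filtration_def
      by (intro exI[of _ "\<lambda>k. {\<Oplus>l\<in>{..<s'}. P l \<odot> m' l | P. \<forall>l<s'. P l \<in> weyl_filt n order_weight (k - 0)}"]
          exI[of _ s'] exI[of _ m'] exI[of _ "\<lambda>_. 0"]) (use gen in auto)
  qed
  then have F: "good_filtration \<int> n order_weight M F" unfolding F_def by (rule someI_ex)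
  let ?G = "gr_module n order_weight M F" and ?W = "{r+1..n}"
  obtain f where f: "poly_eval f (\<lambda>_. 0) \<noteq> 0"
    "conormal r n \<inter> char_variety n M \<inter> {(a, \<xi>). poly_eval f a \<noteq> 0} \<subseteq> zero_section n"
    using nc unfolding noncharacteristic_near_origin_def by blast
  define A where "A = {p + z | p z. p \<in> gen_ann \<and> z \<in> outside_monos ?W}"
  note gI = is_idealD[OF gen_ann_ideal] and oI = is_idealD[OF outside_monos_ideal[of ?W]]
  have A: "is_ideal A" unfolding is_ideal_def
  proof (intro conjI ballI allI)
    show "0 \<in> A" unfolding A_def using gI(1) oI(1) by (intro CollectI exI[of _ 0]) simp
  next
    fix x y assume "x \<in> A" "y \<in> A"
    then obtain p z p' z' where "x = p + z" "p \<in> gen_ann" "z \<in> outside_monos ?W"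
      "y = p' + z'" "p' \<in> gen_ann" "z' \<in> outside_monos ?W" unfolding A_def by blast
    then have "x + y = (p + p') + (z + z')" "p + p' \<in> gen_ann" "z + z' \<in> outside_monos ?W"
      using gI(2) oI(2) by (simp_all add: add_ac)
    then show "x + y \<in> A" unfolding A_def by blast
  next
    fix q x assume "x \<in> A"
    then obtain p z where "x = p + z" "p \<in> gen_ann" "z \<in> outside_monos ?W" unfolding A_def by blast
    then have "q * x = q * p + q * z" "q * p \<in> gen_ann" "q * z \<in> outside_monos ?W"
      using gI(3) oI(3) by (simp_all add: distrib_left)
    then show "q * x \<in> A" unfolding A_def by blast
  qed
  have gA: "p \<in> A" if "p \<in> gen_ann" for p
  proof -
    have "p = p + 0" by simp
    then show ?thesis unfolding A_def using that oI(1) by blast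
  qed
  have oA: "z \<in> A" if "z \<in> outside_monos ?W" for z
  proof -
    have "z = 0 + z" by simp
    then show ?thesis unfolding A_def using that gI(1) by blast
  qed
  have pow: "\<exists>N. \<exists>p\<in>gen_ann. var l ^ N - p \<in> outside_monos ?W" if l: "l \<in> ?W" for l
  proof -
    have "\<exists>N. var l ^ N \<in> A"
    proof (rule nullstellensatz[OF A])
      fix a assume a: "\<And>p. p \<in> A \<Longrightarrow> cpoly_eval p a = 0"
      have a0: "a i = 0" if "i \<notin> ?W" for i
      proof -
        have "var i \<in> outside_monos ?W" using that by (simp add: outside_monos_def var_def)
        then have "cpoly_eval (var i) a = 0" by (intro a oA)
        then show ?thesis by (simp add: cpoly_eval_var)
      qed
      have "symbol_eval p (\<lambda>_. 0) a = 0"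
        if p: "p \<in> carrier (weyl n)" "\<forall>g\<in>carrier ?G. p \<odot>\<^bsub>?G\<^esub> g = \<zero>\<^bsub>?G\<^esub>" for p
      proof -
        \<comment> \<open>Only a power of each component is known to lie in the ideal, which is
          enough for vanishing at \<open>a\<close>.\<close>
        have "cpoly_eval (hcomp d (x_free p)) a = 0" for d
        proof -
          obtain t where "hcomp d (x_free p) ^ t \<in> gen_ann"
            using annihilator_x_free_power[OF F p(1,2) ex] by blast
          then have "cpoly_eval (hcomp d (x_free p) ^ t) a = 0" by (intro a gA)
          then show ?thesis by (simp add: cpoly_eval_power)
        qed
        then show ?thesis unfolding symbol_eval_at_0 cpoly_eval_sum_hcomp[of "x_free p"] by simp
      qed
      moreover have aff: "a \<in> affine_space n" "(\<lambda>_. 0) \<in> affine_space n" using a0 by (auto simp: affine_space_def)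
      ultimately have "((\<lambda>_. 0), a) \<in> char_variety n M"
        unfolding char_variety_def Let_def F_def[symmetric] by blast
      moreover have "((\<lambda>_. 0), a) \<in> conormal r n" using aff a0 by (auto simp: conormal_def)
      \<comment> \<open>The origin belongs to the neighborhood in the hypothesis, since
        \<open>f\<close> does not vanish there.\<close>
      ultimately have "((\<lambda>_. 0), a) \<in> zero_section n" using f by blast
      then have "a l = 0" by (auto simp: zero_section_def)
      then show "cpoly_eval (var l) a = 0" by (simp add: cpoly_eval_var)
    qed
    then obtain N p z where N: "var l ^ N = p + z" "p \<in> gen_ann" "z \<in> outside_monos ?W" unfolding A_def by blast
    then have "var l ^ N - p = z" by simp
    then show ?thesis using N(2,3) by blast
  qed
  have "\<exists>N. \<exists>P\<in>gen_ann. homog N P \<and> P \<in> monos_in (insert j {1..r}) \<and> lookup P (single j N) = 1"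
  proof (rule homogeneous_integral_equation[OF gen_ann_ideal hcomp_gen_ann _ _ _ pow j])
    fix i assume "i \<notin> {1..r} \<union> ?W"
    then have "i \<notin> {1..n}" using r by auto
    then show "var i \<in> gen_ann" by (rule var_gen_ann)
  qed auto
  then obtain N P where P: "P \<in> gen_ann" "homog N P" "P \<in> monos_in (insert j {1..r})"
    "lookup P (single j N) = 1" by blast
  then show ?thesis using homog_in_gen_ann by blast
qed

end

section \<open>Associated graded modules\<close>

lemma (in abelian_group) r_coset_mem: "x \<in> H +> u \<longleftrightarrow> (\<exists>h\<in>H. x = h \<oplus> u)"
  by (auto simp: a_r_coset_def')

locale additive_hom =
  A: abelian_group A + B: abelian_group B
  for A :: "('a, 'x) ring_scheme" and B :: "('b, 'y) ring_scheme" +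
  fixes \<theta> :: "'a \<Rightarrow> 'b"
  assumes \<theta>_closed: "x \<in> carrier A \<Longrightarrow> \<theta> x \<in> carrier B"
    and \<theta>_add: "x \<in> carrier A \<Longrightarrow> y \<in> carrier A \<Longrightarrow> \<theta> (x \<oplus>\<^bsub>A\<^esub> y) = \<theta> x \<oplus>\<^bsub>B\<^esub> \<theta> y"
begin

lemma \<theta>_zero: "\<theta> \<zero>\<^bsub>A\<^esub> = \<zero>\<^bsub>B\<^esub>"
  using \<theta>_add[of "\<zero>\<^bsub>A\<^esub>" "\<zero>\<^bsub>A\<^esub>"] \<theta>_closed[of "\<zero>\<^bsub>A\<^esub>"]
  by (metis A.zero_closed A.l_zero B.add.l_cancel_one')

lemma \<theta>_finsum: "f \<in> S \<rightarrow> carrier A \<Longrightarrow> \<theta> (\<Oplus>\<^bsub>A\<^esub>s\<in>S. f s) = (\<Oplus>\<^bsub>B\<^esub>s\<in>S. \<theta> (f s))"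
proof (induction S rule: infinite_finite_induct)
  case (insert x S)
  then have "f \<in> S \<rightarrow> carrier A" "f x \<in> carrier A" "(\<lambda>s. \<theta> (f s)) \<in> S \<rightarrow> carrier B" "\<theta> (f x) \<in> carrier B"
    using \<theta>_closed by auto
  then show ?case using insert by (simp add: A.finsum_insert B.finsum_insert \<theta>_add A.finsum_closed)
qed (simp_all add: \<theta>_zero)

lemma kernel_coset:
  assumes g: "g \<in> carrier A"
  shows "{x \<in> carrier A. \<theta> x = \<zero>\<^bsub>B\<^esub>} +>\<^bsub>A\<^esub> g = {x \<in> carrier A. \<theta> x = \<theta> g}"
proof (intro equalityI subsetI)
  fix x assume "x \<in> {x \<in> carrier A. \<theta> x = \<zero>\<^bsub>B\<^esub>} +>\<^bsub>A\<^esub> g"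
  then show "x \<in> {x \<in> carrier A. \<theta> x = \<theta> g}"
    using g \<theta>_closed[OF g] by (auto simp: A.r_coset_mem \<theta>_add)
next
  fix x assume x: "x \<in> {x \<in> carrier A. \<theta> x = \<theta> g}"
  let ?h = "x \<ominus>\<^bsub>A\<^esub> g"
  have h: "?h \<in> carrier A" "x = ?h \<oplus>\<^bsub>A\<^esub> g"
    using x g by (auto simp: a_minus_def A.a_assoc A.l_neg)
  then have "\<theta> x = \<theta> ?h \<oplus>\<^bsub>B\<^esub> \<theta> g" using \<theta>_add[OF h(1) g] by simp
  then have "\<theta> ?h \<oplus>\<^bsub>B\<^esub> \<theta> g = \<theta> g" using x by simp
  then have "\<theta> ?h = \<zero>\<^bsub>B\<^esub>" using \<theta>_closed[OF h(1)] \<theta>_closed[OF g] by simp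
  then show "x \<in> {x \<in> carrier A. \<theta> x = \<zero>\<^bsub>B\<^esub>} +>\<^bsub>A\<^esub> g"
    unfolding A.r_coset_mem using h by blast
qed

end

text \<open>Elements of the graded module are families of cosets; working with finitely supported
  representatives reduces its laws to those of \<open>M\<close>.\<close>

definition sections :: "('m, 'c) ring_scheme \<Rightarrow> (real \<Rightarrow> 'm set) \<Rightarrow> (real \<Rightarrow> 'm) set" where
  "sections M U = {u. (\<forall>k. u k \<in> U k) \<and> finite {k. u k \<noteq> \<zero>\<^bsub>M\<^esub>}}"

definition gr_section :: "('m, 'c) ring_scheme \<Rightarrow> (real \<Rightarrow> 'm set) \<Rightarrow> (real \<Rightarrow> 'm) \<Rightarrow> real \<Rightarrow> 'm set" where
  "gr_section M U u = (\<lambda>k. filt_less U k +>\<^bsub>M\<^esub> u k)"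

context V_filtered
begin

abbreviation G :: "(weyl_elem, real \<Rightarrow> 'm set) module" where
  "G \<equiv> gr_module n (V_weight w) M U"

abbreviation cl :: "real \<Rightarrow> 'm \<Rightarrow> 'm set" where "cl k u \<equiv> UL k +> u"

abbreviation degs :: "weyl_elem \<Rightarrow> real set" where
  "degs P \<equiv> monom_weight n (V_weight w) ` keys P"

abbreviation comp :: "real \<Rightarrow> weyl_elem \<Rightarrow> weyl_elem" where
  "comp \<equiv> weyl_comp n (V_weight w)"

definition act :: "weyl_elem \<Rightarrow> (real \<Rightarrow> 'm) \<Rightarrow> real \<Rightarrow> 'm" where
  "act P u = (\<lambda>k. \<Oplus>d\<in>degs P. comp d P \<odot> u (k - d))"

lemma UL_abelian_subgroup: "abelian_subgroup (UL k) M"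
  by (intro abelian_subgroupI3 UL_subgroup M.abelian_group_axioms)

lemma cl_zero: "cl k \<zero> = UL k"
  by (rule M.a_coset_add_zero[OF UL_sub])

lemma cl_self: "u \<in> carrier M \<Longrightarrow> u \<in> cl k u"
  unfolding M.r_coset_mem using UL_zero[of k] by (intro bexI[of _ "\<zero>"]) auto

lemma cl_add: "u \<in> carrier M \<Longrightarrow> v \<in> carrier M \<Longrightarrow> cl k u <+> cl k v = cl k (u \<oplus> v)"
  by (rule abelian_subgroup.a_rcos_sum[OF UL_abelian_subgroup])

lemma cl_absorb: "h \<in> UL k \<Longrightarrow> u \<in> carrier M \<Longrightarrow> cl k (h \<oplus> u) = cl k u"
proof -
  assume h: "h \<in> UL k" and u: "u \<in> carrier M"
  have "h \<oplus> u \<in> cl k u" unfolding M.r_coset_mem using h by blast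
  then show ?thesis using abelian_subgroup.a_repr_independence'[OF UL_abelian_subgroup] u by metis
qed

lemma sections_closed: "u \<in> sections M U \<Longrightarrow> u k \<in> carrier M"
  using U_sub by (auto simp: sections_def)

lemma sections_U: "u \<in> sections M U \<Longrightarrow> u k \<in> U k"
  by (auto simp: sections_def)

lemma gr_section_closed: "u \<in> sections M U \<Longrightarrow> gr_section M U u \<in> carrier G"
proof -
  assume u: "u \<in> sections M U"
  have "{k. gr_section M U u k \<noteq> UL k} \<subseteq> {k. u k \<noteq> \<zero>}"
    unfolding gr_section_def using cl_zero by auto
  moreover have "finite {k. u k \<noteq> \<zero>}" using u by (simp add: sections_def)
  ultimately have "finite {k. gr_section M U u k \<noteq> UL k}" by (rule finite_subset)
  then show ?thesis using sections_U[OF u] by (simp add: gr_module_def gr_section_def)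
qed

lemma gr_carrier_cases:
  assumes "g \<in> carrier G"
  obtains u where "u \<in> sections M U" "g = gr_section M U u"
proof -
  have g: "\<And>k. \<exists>u\<in>U k. g k = cl k u" "finite {k. g k \<noteq> UL k}" using assms by (auto simp: gr_module_def)
  from g(1) obtain v where v: "\<And>k. v k \<in> U k" "\<And>k. g k = cl k (v k)" by metis
  \<comment> \<open>Representatives of trivial classes are reset to 0, which makes the support
    finite.\<close>
  define u where "u k = (if g k = UL k then \<zero> else v k)" for k
  have "finite {k. u k \<noteq> \<zero>}" by (rule finite_subset[OF _ g(2)]) (auto simp: u_def)
  then have "u \<in> sections M U" using v(1) U_zero by (simp add: sections_def u_def)
  moreover have "g = gr_section M U u"
    by (rule ext) (use v(2) cl_zero in \<open>auto simp: gr_section_def u_def\<close>)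
  ultimately show ?thesis by (rule that)
qed

lemma sections_add:
  assumes "u \<in> sections M U" "v \<in> sections M U"
  shows "(\<lambda>k. u k \<oplus> v k) \<in> sections M U"
proof -
  have "{k. u k \<oplus> v k \<noteq> \<zero>} \<subseteq> {k. u k \<noteq> \<zero>} \<union> {k. v k \<noteq> \<zero>}" by auto
  moreover have "finite ({k. u k \<noteq> \<zero>} \<union> {k. v k \<noteq> \<zero>})" using assms by (simp add: sections_def)
  ultimately have "finite {k. u k \<oplus> v k \<noteq> \<zero>}" by (rule finite_subset)
  then show ?thesis using assms U_add by (simp add: sections_def)
qed

lemma sections_zero: "(\<lambda>_. \<zero>) \<in> sections M U"
  using U_zero by (simp add: sections_def)

lemma gr_section_add:
  assumes "u \<in> sections M U" "v \<in> sections M U"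
  shows "gr_section M U u \<oplus>\<^bsub>G\<^esub> gr_section M U v = gr_section M U (\<lambda>k. u k \<oplus> v k)"
  using assms by (simp add: gr_module_def gr_section_def cl_add sections_closed)

lemma gr_section_zero: "gr_section M U (\<lambda>_. \<zero>) = \<zero>\<^bsub>G\<^esub>"
  by (simp add: gr_module_def gr_section_def cl_zero)

lemma gr_abelian_group: "abelian_group G"
proof (rule abelian_groupI)
  fix x y assume "x \<in> carrier G" "y \<in> carrier G"
  then show "x \<oplus>\<^bsub>G\<^esub> y \<in> carrier G"
    by (elim gr_carrier_cases) (simp add: gr_section_add gr_section_closed sections_add)
next
  show "\<zero>\<^bsub>G\<^esub> \<in> carrier G" using gr_section_closed[OF sections_zero] by (simp add: gr_section_zero)
next
  fix x y z assume "x \<in> carrier G" "y \<in> carrier G" "z \<in> carrier G"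
  then show "x \<oplus>\<^bsub>G\<^esub> y \<oplus>\<^bsub>G\<^esub> z = x \<oplus>\<^bsub>G\<^esub> (y \<oplus>\<^bsub>G\<^esub> z)"
    by (elim gr_carrier_cases) (simp add: gr_section_add sections_add sections_closed M.a_assoc)
next
  fix x y assume "x \<in> carrier G" "y \<in> carrier G"
  then show "x \<oplus>\<^bsub>G\<^esub> y = y \<oplus>\<^bsub>G\<^esub> x"
    by (elim gr_carrier_cases) (simp add: gr_section_add sections_closed M.a_comm)
next
  fix x assume "x \<in> carrier G"
  then show "\<zero>\<^bsub>G\<^esub> \<oplus>\<^bsub>G\<^esub> x = x"
    unfolding gr_section_zero[symmetric]
    by (elim gr_carrier_cases) (simp add: gr_section_add sections_zero sections_closed)
next
  fix x assume "x \<in> carrier G"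
  then obtain u where u: "u \<in> sections M U" "x = gr_section M U u" by (rule gr_carrier_cases)
  let ?v = "\<lambda>k. \<ominus> u k"
  have "{k. ?v k \<noteq> \<zero>} \<subseteq> {k. u k \<noteq> \<zero>}" by auto
  then have v: "?v \<in> sections M U"
    using u(1) additive_subgroup.a_inv_closed[OF U_subgroup] by (auto simp: sections_def intro: finite_subset)
  have "gr_section M U ?v \<oplus>\<^bsub>G\<^esub> x = \<zero>\<^bsub>G\<^esub>"
    unfolding u(2) gr_section_add[OF v u(1)] gr_section_zero[symmetric]
    using sections_closed[OF u(1)] by (simp add: M.l_neg)
  then show "\<exists>y\<in>carrier G. y \<oplus>\<^bsub>G\<^esub> x = \<zero>\<^bsub>G\<^esub>" using gr_section_closed[OF v] by blast
qed

lemma act_closed_at: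
  assumes "P \<in> carrier (weyl n)" "u \<in> sections M U"
  shows "comp d P \<odot> u (k - d) \<in> U k"
  using U_act[OF weyl_comp_filt[OF assms(1)], of "u (k - d)" "k - d" d] sections_U[OF assms(2)] by simp

lemma act_sections:
  assumes P: "P \<in> carrier (weyl n)" and u: "u \<in> sections M U"
  shows "act P u \<in> sections M U"
proof -
  let ?S = "{k. u k \<noteq> \<zero>}"
  have "act P u k \<in> U k" for k
    unfolding act_def by (rule M.finsum_mem[OF U_sub U_zero U_add act_closed_at[OF P u]])
  moreover have "{k. act P u k \<noteq> \<zero>} \<subseteq> (\<lambda>(d, j). d + j) ` (degs P \<times> ?S)"
  proof (rule subsetI, rule ccontr)
    fix k assume k: "k \<in> {k. act P u k \<noteq> \<zero>}" and no: "k \<notin> (\<lambda>(d, j). d + j) ` (degs P \<times> ?S)"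
    have "u (k - d) = \<zero>" if "d \<in> degs P" for d
    proof (rule ccontr)
      assume "u (k - d) \<noteq> \<zero>"
      then have "(\<lambda>(d, j). d + j) (d, k - d) \<in> (\<lambda>(d, j). d + j) ` (degs P \<times> ?S)" using that by (intro imageI) simp
      then show False using no by simp
    qed
    then have "act P u k = (\<Oplus>d\<in>degs P. \<zero>)"
      unfolding act_def using smult_r_null[OF weyl_comp_closed[OF P]] by (intro M.finsum_cong' refl) auto
    then show False using k by simp
  qed
  moreover have "finite ((\<lambda>(d, j). d + j) ` (degs P \<times> ?S))" using u by (simp add: sections_def)
  ultimately show ?thesis by (auto simp: sections_def intro: finite_subset)
qed

text \<open>Another choice of representatives changes the sum by an element of \<open>UL k\<close>,
  so the union in \<open>gr_smult\<close> is a single coset.\<close>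

lemma gr_smult_section:
  assumes P: "P \<in> carrier (weyl n)" and u: "u \<in> sections M U"
  shows "P \<odot>\<^bsub>G\<^esub> gr_section M U u = gr_section M U (act P u)"
proof
  fix k
  let ?s = "\<lambda>v. \<Oplus>d\<in>degs P. comp d P \<odot> v d"
  let ?Pi = "\<Pi> d\<in>degs P. gr_section M U u (k - d)"
  have eq: "cl k (?s v) = cl k (act P u k)" if v: "v \<in> ?Pi" for v
  proof -
    have "\<forall>d\<in>degs P. \<exists>h\<in>UL (k - d). v d = h \<oplus> u (k - d)"
      using v unfolding gr_section_def Pi_iff M.r_coset_mem .
    then obtain h where h: "\<And>d. d \<in> degs P \<Longrightarrow> h d \<in> UL (k - d)"
      "\<And>d. d \<in> degs P \<Longrightarrow> v d = h d \<oplus> u (k - d)" by metis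
    have hc: "h d \<in> carrier M" if "d \<in> degs P" for d using h(1)[OF that] UL_sub by blast
    have hU: "comp d P \<odot> h d \<in> UL k" if "d \<in> degs P" for d
      using UL_act[OF weyl_comp_filt[OF P] h(1)[OF that], of d] by simp
    have hUc: "comp d P \<odot> h d \<in> carrier M" if "d \<in> degs P" for d using hU[OF that] UL_sub by blast
    have uc: "comp d P \<odot> u (k - d) \<in> carrier M" for d using act_closed_at[OF P u] U_sub by blast
    have "?s v = (\<Oplus>d\<in>degs P. comp d P \<odot> h d \<oplus> comp d P \<odot> u (k - d))"
    proof (rule M.finsum_cong'[OF refl])
      fix d assume d: "d \<in> degs P"
      show "comp d P \<odot> v d = comp d P \<odot> h d \<oplus> comp d P \<odot> u (k - d)"
        unfolding h(2)[OF d] by (rule smult_r_distr[OF weyl_comp_closed[OF P] hc[OF d] sections_closed[OF u]])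
    qed (use hUc uc in auto)
    also have "\<dots> = ?s h \<oplus> act P u k"
      unfolding act_def using hUc uc by (intro M.finsum_addf) auto
    also have "cl k \<dots> = cl k (act P u k)"
    proof (rule cl_absorb)
      show "?s h \<in> UL k" by (rule M.finsum_mem[OF UL_sub UL_zero UL_add hU])
    qed (rule sections_closed[OF act_sections[OF P u]])
    finally show ?thesis .
  qed
  moreover have "(\<lambda>d. u (k - d)) \<in> ?Pi"
    unfolding gr_section_def using cl_self[OF sections_closed[OF u]] by auto
  ultimately have "(\<Union>v\<in>?Pi. cl k (?s v)) = cl k (act P u k)" by (auto simp: eq)
  then show "(P \<odot>\<^bsub>G\<^esub> gr_section M U u) k = gr_section M U (act P u) k"
    by (simp add: gr_module_def gr_smult_def Let_def) (simp add: gr_section_def)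
qed

lemma gr_smult_closed: "P \<in> carrier (weyl n) \<Longrightarrow> g \<in> carrier G \<Longrightarrow> P \<odot>\<^bsub>G\<^esub> g \<in> carrier G"
  by (elim gr_carrier_cases) (simp add: gr_smult_section gr_section_closed act_sections)

lemma gr_smult_one: "g \<in> carrier G \<Longrightarrow> \<one>\<^bsub>weyl n\<^esub> \<odot>\<^bsub>G\<^esub> g = g"
proof (elim gr_carrier_cases)
  fix u assume u: "u \<in> sections M U" "g = gr_section M U u"
  have w0: "monom_weight n (V_weight w) 0 = 0" by (simp add: monom_weight_def)
  have k: "keys (1 :: weyl_elem) = {0}" by simp
  have "comp 0 1 = 1"
    unfolding weyl_comp_eq_keep by (rule poly_mapping_eqI) (auto simp: lookup_keep w0 lookup_one when_def)
  then have "act 1 u j = (\<Oplus>d\<in>{0::real}. u j)" for j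
    unfolding act_def k image_insert image_empty w0
    using smult_one[of "u j"] sections_closed[OF u(1)] by (intro M.finsum_cong' refl) auto
  then have "act 1 u = u" using sections_closed[OF u(1)] by (intro ext) (simp add: M.finsum_insert)
  moreover have "1 \<in> carrier (weyl n)" using one_closed by simp
  ultimately show "\<one>\<^bsub>weyl n\<^esub> \<odot>\<^bsub>G\<^esub> g = g" unfolding u(2) using gr_smult_section[OF _ u(1), of 1] by simp
qed

lemma gr_section_finsum:
  assumes "finite S" "\<And>l. l \<in> S \<Longrightarrow> v l \<in> sections M U"
  shows "gr_section M U (\<lambda>k. \<Oplus>l\<in>S. v l k) = (\<Oplus>\<^bsub>G\<^esub>l\<in>S. gr_section M U (v l))
    \<and> (\<lambda>k. \<Oplus>l\<in>S. v l k) \<in> sections M U"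
  using assms
proof (induction S rule: finite_induct)
  case empty
  interpret G: abelian_group G by (rule gr_abelian_group)
  show ?case by (simp add: gr_section_zero sections_zero)
next
  case (insert x S)
  interpret G: abelian_group G by (rule gr_abelian_group)
  let ?t = "\<lambda>k. \<Oplus>l\<in>S. v l k"
  have IH: "gr_section M U ?t = (\<Oplus>\<^bsub>G\<^esub>l\<in>S. gr_section M U (v l))" "?t \<in> sections M U" using insert by auto
  have "(\<lambda>k. \<Oplus>l\<in>insert x S. v l k) = (\<lambda>k. v x k \<oplus> ?t k)"
    using insert sections_closed by (intro ext M.finsum_insert) auto
  moreover have "(\<Oplus>\<^bsub>G\<^esub>l\<in>insert x S. gr_section M U (v l)) = gr_section M U (v x) \<oplus>\<^bsub>G\<^esub> (\<Oplus>\<^bsub>G\<^esub>l\<in>S. gr_section M U (v l))"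
    using insert gr_section_closed by (intro G.finsum_insert) auto
  ultimately show ?case using insert(4)[of x] IH gr_section_add[of "v x" ?t] sections_add[of "v x" ?t] by simp
qed

end

section \<open>Restriction of filtered modules\<close>

lemma monom_weight_sub:
  assumes "r \<le> n" "p \<in> mindices r \<times> mindices r"
  shows "monom_weight n uv p = monom_weight r uv p"
proof -
  have "lookup (fst p) i = 0 \<and> lookup (snd p) i = 0" if "i \<in> {1..n} - {1..r}" for i
    using assms(2) that mindices_lookup[of _ r i] by (auto simp: mem_Times_iff)
  then show ?thesis unfolding monom_weight_def using assms(1) by (intro sum.mono_neutral_right) auto
qed

lemma weyl_carrier_mono: "r \<le> n \<Longrightarrow> carrier (weyl r) \<subseteq> carrier (weyl n)"
  unfolding weyl_carrier_iff subset_iff mindices_def by fastforce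

text \<open>No \<open>\<partial>_l\<close> occurs in \<open>P\<close>, so only the empty contraction
  contributes. This makes \<open>restr_sub\<close> stable under the smaller Weyl algebra.\<close>

lemma weyl_xvar_commute:
  assumes "P \<in> carrier (weyl r)" "l \<notin> {1..r}"
  shows "weyl_mult P (xvar l) = weyl_mult (xvar l) P"
proof -
  have "weyl_mult (single p z) (xvar l) = weyl_mult (xvar l) (single p z)"
    if p: "p \<in> keys P" for p z
  proof -
    obtain \<alpha> \<beta> where ab: "p = (\<alpha>, \<beta>)" "\<beta> \<in> mindices r" by (rule weyl_carrierE[OF assms(1) p])
    have "lookup \<beta> l = 0" by (rule mindices_lookup[OF ab(2) assms(2)])
    then have lz: "leibniz_set \<beta> (single l 1) = {0}" unfolding leibniz_set_single_1 by simp
    then have "weyl_mult (single p z) (xvar l) = single (\<alpha> + single l 1, \<beta>) z"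
      unfolding ab(1) xvar_eq weyl_mult_single weyl_monom_mult_eq lz by (simp add: leibniz_coef_def)
    then show ?thesis by (simp add: ab(1) xvar_eq weyl_mult_single_trivial add.commute)
  qed
  then have "weyl_mult (\<Sum>p\<in>keys P. single p (lookup P p)) (xvar l)
    = weyl_mult (xvar l) (\<Sum>p\<in>keys P. single p (lookup P p))"
    by (simp only: weyl_mult_sum_left weyl_mult_sum_right cong: sum.cong)
  then show ?thesis unfolding poly_mapping_sum_single[of P, symmetric] .
qed

lemma comp_xvar: "weyl_comp n uv d (xvar l) = xvar l \<or> weyl_comp n uv d (xvar l) = 0"
  by (simp add: weyl_comp_eq_keep xvar_eq keep_single)

locale restricted_V_filtered = V_filtered n M w U for n and M :: "(weyl_elem, 'm) module" (structure) and w U +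
  fixes r :: nat
  assumes r: "r \<le> n"
begin

abbreviation N :: "'m set" where "N \<equiv> restr_sub r n M"
abbreviation rc :: "'m \<Rightarrow> 'm set" where "rc \<equiv> restr_class r n M"
abbreviation MR :: "(weyl_elem, 'm set) module" where "MR \<equiv> restriction r n M"
abbreviation UR :: "real \<Rightarrow> 'm set set" where "UR \<equiv> restr_filt r n M U"

lemma N_act: "P \<in> carrier (weyl r) \<Longrightarrow> x \<in> N \<Longrightarrow> P \<odot> x \<in> N"
  unfolding restr_sub_eq_xspan using weyl_carrier_mono[OF r]
  by (intro xspan_act[of "carrier M"]) (auto intro!: smult_closed weyl_xvar_commute)

lemma N_sub: "N \<subseteq> carrier M"
  unfolding restr_sub_eq_xspan by (rule xspan_sub) simp

lemma N_zero: "\<zero> \<in> N"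
  unfolding restr_sub_eq_xspan by (rule xspan_zero) simp_all

lemma N_add: "x \<in> N \<Longrightarrow> y \<in> N \<Longrightarrow> x \<oplus> y \<in> N"
  unfolding restr_sub_eq_xspan by (rule xspan_add) simp_all

lemma N_subgroup: "additive_subgroup N M"
proof (rule additive_subgroup_smult[OF N_sub N_zero N_add])
  fix x assume "x \<in> N"
  moreover have "- 1 \<in> carrier (weyl r)"
    using const_filt[of "- 1" r order_weight] by (simp add: weyl_filt_iff single_uminus)
  ultimately show "(\<ominus>\<^bsub>weyl n\<^esub> \<one>\<^bsub>weyl n\<^esub>) \<odot> x \<in> N" unfolding weyl_minus_one by (rule N_act[rotated])
qed

lemma N_abelian_subgroup: "abelian_subgroup N M"
  by (intro abelian_subgroupI3 N_subgroup M.abelian_group_axioms)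

lemma rc_add: "x \<in> carrier M \<Longrightarrow> y \<in> carrier M \<Longrightarrow> rc (x \<oplus> y) = rc x \<oplus>\<^bsub>MR\<^esub> rc y"
  using abelian_subgroup.a_rcos_sum[OF N_abelian_subgroup] by (simp add: restr_class_def restriction_def)

lemma rc_zero: "rc \<zero> = \<zero>\<^bsub>MR\<^esub>"
  using M.a_coset_add_zero[OF N_sub] by (simp add: restr_class_def restriction_def)

lemma rc_self: "x \<in> carrier M \<Longrightarrow> x \<in> rc x"
  unfolding restr_class_def M.r_coset_mem using N_zero by (intro bexI[of _ "\<zero>"]) auto

lemma rc_eq:
  assumes "x \<in> carrier M" "h \<in> N" shows "rc (h \<oplus> x) = rc x"
proof -
  have "h \<oplus> x \<in> N +> x" unfolding M.r_coset_mem using assms(2) by blast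
  from abelian_subgroup.a_repr_independence'[OF N_abelian_subgroup this assms(1)]
  show ?thesis unfolding restr_class_def by (rule sym)
qed

lemma rc_smult:
  assumes P: "P \<in> carrier (weyl r)" and x: "x \<in> carrier M"
  shows "P \<odot>\<^bsub>MR\<^esub> rc x = rc (P \<odot> x)"
proof -
  have Pn: "P \<in> carrier (weyl n)" using P weyl_carrier_mono[OF r] by blast
  have "\<forall>y\<in>rc x. rc (P \<odot> y) = rc (P \<odot> x)"
  proof
    fix y assume y: "y \<in> rc x"
    obtain h where h: "h \<in> N" "y = h \<oplus> x" using y unfolding restr_class_def M.r_coset_mem by blast
    have "h \<in> carrier M" using h(1) N_sub by blast
    then have "P \<odot> y = P \<odot> h \<oplus> P \<odot> x" unfolding h(2) by (rule smult_r_distr[OF Pn _ x])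
    then show "rc (P \<odot> y) = rc (P \<odot> x)"
      using rc_eq[OF smult_closed[OF Pn x] N_act[OF P h(1)]] by simp
  qed
  then have "(\<Union>y\<in>rc x. rc (P \<odot> y)) = rc (P \<odot> x)" by (rule UN_constant_eq[OF rc_self[OF x]])
  then show ?thesis by (simp add: restriction_def)
qed

lemma MR_carrier: "carrier MR = rc ` carrier M"
  by (simp add: restriction_def)

lemma MR_abelian_group: "abelian_group MR"
proof (rule abelian_groupI)
  fix x assume "x \<in> carrier MR"
  then obtain a where a: "a \<in> carrier M" "x = rc a" unfolding MR_carrier by blast
  have "rc (\<ominus> a) \<oplus>\<^bsub>MR\<^esub> x = \<zero>\<^bsub>MR\<^esub>"
    unfolding a(2) using a(1) by (simp add: rc_add[symmetric] M.l_neg rc_zero)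
  then show "\<exists>y\<in>carrier MR. y \<oplus>\<^bsub>MR\<^esub> x = \<zero>\<^bsub>MR\<^esub>" unfolding MR_carrier using a(1) by blast
qed (auto simp: MR_carrier rc_add[symmetric] rc_zero[symmetric] M.a_ac)

lemma rc_hom: "additive_hom M MR rc"
  by (intro additive_hom.intro additive_hom_axioms.intro M.abelian_group_axioms MR_abelian_group)
    (auto simp: MR_carrier rc_add)

lemma MR_left_module: "left_module (weyl r) MR"
proof (intro left_module.intro left_module_axioms.intro weyl_ring MR_abelian_group)
  note sub = subsetD[OF weyl_carrier_mono[OF r]]
  fix a b x y assume ab: "a \<in> carrier (weyl r)" and x: "x \<in> carrier MR"
  obtain x' where x': "x' \<in> carrier M" "x = rc x'" using x unfolding MR_carrier by blast
  show "a \<odot>\<^bsub>MR\<^esub> x \<in> carrier MR"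
    unfolding x'(2) rc_smult[OF ab x'(1)] MR_carrier using x' ab by (intro imageI smult_closed sub)
  show "(a \<oplus>\<^bsub>weyl r\<^esub> b) \<odot>\<^bsub>MR\<^esub> x = a \<odot>\<^bsub>MR\<^esub> x \<oplus>\<^bsub>MR\<^esub> b \<odot>\<^bsub>MR\<^esub> x" if b: "b \<in> carrier (weyl r)"
    using ab b x'(1) weyl_add_closed[OF ab b] unfolding x'(2)
    by (simp add: rc_smult smult_add sub rc_add smult_closed)
  show "a \<odot>\<^bsub>MR\<^esub> (x \<oplus>\<^bsub>MR\<^esub> y) = a \<odot>\<^bsub>MR\<^esub> x \<oplus>\<^bsub>MR\<^esub> a \<odot>\<^bsub>MR\<^esub> y" if y: "y \<in> carrier MR"
  proof -
    obtain y' where y': "y' \<in> carrier M" "y = rc y'" using y unfolding MR_carrier by blast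
    then show ?thesis unfolding x'(2) using x'(1) ab
      by (simp add: rc_smult smult_r_distr sub rc_add[symmetric] smult_closed)
  qed
  show "(a \<otimes>\<^bsub>weyl r\<^esub> b) \<odot>\<^bsub>MR\<^esub> x = a \<odot>\<^bsub>MR\<^esub> (b \<odot>\<^bsub>MR\<^esub> x)" if b: "b \<in> carrier (weyl r)"
    using ab b x'(1) weyl_mult_closed[OF ab b] unfolding x'(2)
    by (simp add: rc_smult smult_mult sub smult_closed)
next
  fix x assume "x \<in> carrier MR"
  then obtain x' where x': "x' \<in> carrier M" "x = rc x'" unfolding MR_carrier by blast
  show "\<one>\<^bsub>weyl r\<^esub> \<odot>\<^bsub>MR\<^esub> x = x"
    using x' smult_one[OF x'(1)] const_filt[of 1 r order_weight] by (simp add: rc_smult weyl_filt_iff)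
qed

lemma UR_eq: "UR k = rc ` U k"
  by (simp add: restr_filt_def)

lemma UR_less: "filt_less UR k = rc ` UL k"
  by (auto simp: filt_less_def UR_eq)

sublocale MR: V_filtered r MR w UR
proof (intro V_filtered.intro weyl_module.intro MR_left_module V_filtered_axioms.intro)
  fix k
  show "UR k \<subseteq> carrier MR" unfolding UR_eq MR_carrier using U_sub by blast
  show "\<zero>\<^bsub>MR\<^esub> \<in> UR k" unfolding UR_eq rc_zero[symmetric] using U_zero by blast
  show "x \<oplus>\<^bsub>MR\<^esub> y \<in> UR k" if xy': "x \<in> UR k" "y \<in> UR k" for x y
  proof -
    obtain x' y' where xy: "x' \<in> U k" "x = rc x'" "y' \<in> U k" "y = rc y'" using xy' unfolding UR_eq by blast
    then have "x \<oplus>\<^bsub>MR\<^esub> y = rc (x' \<oplus> y')" using U_sub[of k] by (simp add: rc_add subset_iff)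
    then show ?thesis unfolding UR_eq using U_add[OF xy(1,3)] by simp
  qed
  show "UR k \<subseteq> UR l" if "k \<le> l" for l unfolding UR_eq using U_mono[OF that] by blast
  show "P \<odot>\<^bsub>MR\<^esub> x \<in> UR (a + k)" if P: "P \<in> weyl_filt r (V_weight w) a" and x: "x \<in> UR k" for P a x
  proof -
    obtain x' where x': "x' \<in> U k" "x = rc x'" using x unfolding UR_eq by blast
    have Pr: "P \<in> carrier (weyl r)" using P by (simp add: weyl_filt_iff)
    have "P \<in> weyl_filt n (V_weight w) a"
      unfolding weyl_filt_iff
    proof (intro conjI ballI)
      show "P \<in> carrier (weyl n)" using Pr weyl_carrier_mono[OF r] by blast
      fix p assume p: "p \<in> keys P"
      then have "p \<in> mindices r \<times> mindices r" using Pr by (auto simp: weyl_carrier_iff)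
      then show "monom_weight n (V_weight w) p \<le> a" using monom_weight_sub[OF r] P p by (simp add: weyl_filt_iff)
    qed
    then have "P \<odot> x' \<in> U (a + k)" using x'(1) by (rule U_act)
    moreover have "x' \<in> carrier M" using x'(1) U_sub by blast
    ultimately show ?thesis unfolding UR_eq x'(2) using rc_smult[OF Pr] by simp
  qed
qed

text \<open>The surjection from the graded module of \<open>M\<close> to that of the restriction.
  The natural map is the inverse of the isomorphism it induces, once its kernel is identified with
  \<open>restr_sub r n G\<close>.\<close>

definition \<theta> :: "(real \<Rightarrow> 'm set) \<Rightarrow> real \<Rightarrow> 'm set set" where
  "\<theta> g = (\<lambda>k. rc ` g k)"

lemma \<theta>_cl:
  assumes "u \<in> carrier M" shows "rc ` cl k u = MR.cl k (rc u)"
proof -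
  have "rc (h \<oplus> u) = rc h \<oplus>\<^bsub>MR\<^esub> rc u" if "h \<in> UL k" for h
    using that UL_sub[of k] assms by (intro rc_add) auto
  then show ?thesis unfolding a_r_coset_def' UR_less by force
qed

lemma \<theta>_section: "u \<in> sections M U \<Longrightarrow> \<theta> (gr_section M U u) = gr_section MR UR (\<lambda>k. rc (u k))"
  by (simp add: \<theta>_def gr_section_def \<theta>_cl sections_closed)

lemma rc_sections: "u \<in> sections M U \<Longrightarrow> (\<lambda>k. rc (u k)) \<in> sections MR UR"
proof -
  assume u: "u \<in> sections M U"
  have "{k. rc (u k) \<noteq> \<zero>\<^bsub>MR\<^esub>} \<subseteq> {k. u k \<noteq> \<zero>}"
    by (intro Collect_mono impI notI) (simp add: rc_zero)
  moreover have "finite {k. u k \<noteq> \<zero>}" using u by (simp add: sections_def)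
  ultimately have "finite {k. rc (u k) \<noteq> \<zero>\<^bsub>MR\<^esub>}" by (rule finite_subset)
  then show ?thesis using u by (simp add: sections_def UR_eq)
qed

lemma \<theta>_hom: "additive_hom G MR.G \<theta>"
proof (intro additive_hom.intro additive_hom_axioms.intro gr_abelian_group MR.gr_abelian_group)
  fix x assume "x \<in> carrier G"
  then show "\<theta> x \<in> carrier MR.G"
    by (elim gr_carrier_cases) (simp add: \<theta>_section rc_sections MR.gr_section_closed)
next
  fix x y assume "x \<in> carrier G" "y \<in> carrier G"
  then show "\<theta> (x \<oplus>\<^bsub>G\<^esub> y) = \<theta> x \<oplus>\<^bsub>MR.G\<^esub> \<theta> y"
    by (elim gr_carrier_cases)
      (simp add: gr_section_add \<theta>_section sections_add rc_sections MR.gr_section_add rc_add sections_closed)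
qed

lemma \<theta>_surj: "h \<in> carrier MR.G \<Longrightarrow> \<exists>g\<in>carrier G. \<theta> g = h"
proof (elim MR.gr_carrier_cases)
  fix v assume v: "v \<in> sections MR UR" "h = gr_section MR UR v"
  have "\<forall>k. \<exists>u\<in>U k. rc u = v k" using MR.sections_U[OF v(1)] unfolding UR_eq by force
  then obtain u' where u': "\<And>k. u' k \<in> U k" "\<And>k. rc (u' k) = v k" by metis
  define u where "u k = (if v k = \<zero>\<^bsub>MR\<^esub> then \<zero> else u' k)" for k
  have rcu: "rc (u k) = v k" for k using u'(2) rc_zero by (simp add: u_def)
  have "{k. u k \<noteq> \<zero>} \<subseteq> {k. v k \<noteq> \<zero>\<^bsub>MR\<^esub>}" by (auto simp: u_def)
  moreover have "finite {k. v k \<noteq> \<zero>\<^bsub>MR\<^esub>}" using v(1) by (simp add: sections_def)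
  ultimately have "finite {k. u k \<noteq> \<zero>}" by (rule finite_subset)
  moreover have "u k \<in> U k" for k using u'(1) U_zero by (simp add: u_def)
  ultimately have "u \<in> sections M U" by (simp add: sections_def)
  then show ?thesis using \<theta>_section rcu gr_section_closed v(2) by (intro bexI[of _ "gr_section M U u"]) auto
qed

lemma \<theta>_smult:
  assumes P: "P \<in> carrier (weyl r)" and g: "g \<in> carrier G"
  shows "\<theta> (P \<odot>\<^bsub>G\<^esub> g) = P \<odot>\<^bsub>MR.G\<^esub> \<theta> g"
proof -
  obtain u where u: "u \<in> sections M U" "g = gr_section M U u" using g by (rule gr_carrier_cases)
  have Pn: "P \<in> carrier (weyl n)" using P weyl_carrier_mono[OF r] by blast
  have keysP: "monom_weight n uv p = monom_weight r uv p" if "p \<in> keys P" for p uv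
    by (rule monom_weight_sub[OF r]) (use P that in \<open>unfold weyl_carrier_iff, blast\<close>)
  have degs: "degs P = MR.degs P" using keysP by (intro image_cong) auto
  have comp: "comp d P = MR.comp d P" for d
    unfolding weyl_comp_def using keysP[of _ "V_weight w"] by (intro sum.cong refl Collect_cong conj_cong) simp_all
  have "rc (act P u k) = MR.act P (\<lambda>k. rc (u k)) k" for k
  proof -
    have cl: "comp d P \<odot> u (k - d) \<in> carrier M" for d using act_closed_at[OF Pn u(1)] U_sub by blast
    have "rc (act P u k) = (\<Oplus>\<^bsub>MR\<^esub>d\<in>degs P. rc (comp d P \<odot> u (k - d)))"
      unfolding act_def using cl by (intro additive_hom.\<theta>_finsum[OF rc_hom]) auto
    also have "\<dots> = MR.act P (\<lambda>k. rc (u k)) k"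
      unfolding MR.act_def degs comp
      by (intro MR.M.finsum_cong' refl)
        (auto simp: rc_smult weyl_comp_closed[OF P] sections_closed[OF u(1)] MR_carrier intro!: imageI smult_closed weyl_comp_closed[OF Pn])
    finally show ?thesis .
  qed
  then show ?thesis
    unfolding u(2) gr_smult_section[OF Pn u(1)] \<theta>_section[OF u(1)] \<theta>_section[OF act_sections[OF Pn u(1)]]
      MR.gr_smult_section[OF P rc_sections[OF u(1)]] by simp
qed

lemma \<theta>_gr_class: "u \<in> carrier M \<Longrightarrow> \<theta> (gr_class M U k u) = gr_class MR UR k (rc u)"
  by (rule ext) (simp add: \<theta>_def gr_class_def \<theta>_cl UR_less)

text \<open>The easy inclusion: multiplication by \<open>x_j\<close> with \<open>j > r\<close> takes
  representatives into \<open>N\<close>.\<close>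

lemma restr_sub_gr_in_kernel:
  assumes "g \<in> restr_sub r n G"
  shows "g \<in> carrier G \<and> \<theta> g = \<zero>\<^bsub>MR.G\<^esub>"
proof -
  interpret G: abelian_group G by (rule gr_abelian_group)
  interpret H: abelian_group MR.G by (rule MR.gr_abelian_group)
  let ?K = "{g \<in> carrier G. \<theta> g = \<zero>\<^bsub>MR.G\<^esub>}"
  obtain m where m: "m \<in> {r+1..n} \<rightarrow> carrier G" "g = (\<Oplus>\<^bsub>G\<^esub>j\<in>{r+1..n}. xvar j \<odot>\<^bsub>G\<^esub> m j)"
    using assms unfolding restr_sub_def by blast
  have "g \<in> ?K" unfolding m(2)
  proof (rule G.finsum_mem)
    fix j assume j: "j \<in> {r+1..n}"
    then have jn: "j \<in> {1..n}" by auto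
    have mj: "m j \<in> carrier G" using m(1) j by (rule funcset_mem)
    then obtain u where u: "u \<in> sections M U" "m j = gr_section M U u" by (rule gr_carrier_cases)
    have "act (xvar j) u k \<in> N" for k
      unfolding act_def
    proof (rule M.finsum_mem[OF N_sub N_zero N_add])
      fix d
      have ucl: "u (k - d) \<in> carrier M" by (rule sections_closed[OF u(1)])
      have "X j (u (k - d)) \<in> N"
      proof -
        have "X j (u (k - d)) = (\<Oplus>l\<in>{r+1..n}. if j = l then X l (u (k - d)) else \<zero>)"
          using j ucl by (intro M.finsum_singleton[symmetric]) (auto intro!: X_closed)
        also have "\<dots> = (\<Oplus>l\<in>{r+1..n}. X l (if j = l then u (k - d) else \<zero>))"
          using ucl by (intro M.finsum_cong' refl) (auto simp: smult_r_null xvar_closed intro!: X_closed)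
        finally show ?thesis unfolding restr_sub_def using ucl
          by (intro CollectI exI[of _ "\<lambda>l. if j = l then u (k - d) else \<zero>"]) auto
      qed
      then show "comp d (xvar j) \<odot> u (k - d) \<in> N"
        using comp_xvar[of n "V_weight w" d j] smult_0[OF ucl] N_zero by auto
    qed
    then have "rc (act (xvar j) u k) = \<zero>\<^bsub>MR\<^esub>" for k
      using rc_eq[OF M.zero_closed, of "act (xvar j) u k"] N_sub rc_zero by (auto simp: subset_iff)
    then have "\<theta> (xvar j \<odot>\<^bsub>G\<^esub> m j) = \<zero>\<^bsub>MR.G\<^esub>"
      unfolding u(2) gr_smult_section[OF xvar_closed[OF jn] u(1)] \<theta>_section[OF act_sections[OF xvar_closed[OF jn] u(1)]]
      using MR.gr_section_zero by simp
    moreover have "xvar j \<odot>\<^bsub>G\<^esub> m j \<in> carrier G" by (rule gr_smult_closed[OF xvar_closed[OF jn] mj])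
    ultimately show "xvar j \<odot>\<^bsub>G\<^esub> m j \<in> ?K" by blast
  qed (use additive_hom.\<theta>_zero[OF \<theta>_hom] additive_hom.\<theta>_add[OF \<theta>_hom] in auto)
  then show ?thesis by blast
qed

text \<open>Vanishing under \<open>\<theta>\<close> in degree \<open>k\<close> means that
  \<open>u k\<close> agrees modulo \<open>UL k\<close> with an element of \<open>N\<close> in
  \<open>U k\<close>. Strictness writes that element with coefficients in \<open>U (k + c)\<close>;
  as \<open>x_l\<close> has degree \<open>-c\<close>, these represent graded elements of the right
  degree.\<close>

lemma kernel_in_restr_sub_gr:
  assumes strict: "\<And>x k. x \<in> U k \<Longrightarrow> x \<in> N \<Longrightarrow> x \<in> xspan r n M (U (k + c))"
    and w: "\<And>i. i \<in> {1..n} \<Longrightarrow> w i = c"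
    and g: "g \<in> carrier G" "\<theta> g = \<zero>\<^bsub>MR.G\<^esub>"
  shows "g \<in> restr_sub r n G"
proof -
  obtain u where u: "u \<in> sections M U" "g = gr_section M U u" using g(1) by (rule gr_carrier_cases)
  let ?J = "{r+1..n}"
  have ex: "\<exists>a. a \<in> ?J \<rightarrow> U (k + c) \<and> cl k (u k) = cl k (\<Oplus>l\<in>?J. X l (a l))" for k
  proof -
    have ucl: "u k \<in> carrier M" by (rule sections_closed[OF u(1)])
    have "MR.cl k (rc (u k)) = filt_less UR k"
      using fun_cong[OF g(2), of k] unfolding u(2) \<theta>_section[OF u(1)] by (simp add: gr_section_def gr_module_def)
    then have "rc (u k) \<in> filt_less UR k" using MR.cl_self[of "rc (u k)" k] ucl by (simp add: MR_carrier)
    then obtain h where h: "h \<in> UL k" "rc (u k) = rc h" unfolding UR_less by blast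
    have hcl: "h \<in> carrier M" using h(1) UL_sub by blast
    have "u k \<in> rc h" using rc_self[OF ucl] h(2) by simp
    then obtain y where y: "y \<in> N" "u k = y \<oplus> h" unfolding restr_class_def M.r_coset_mem by blast
    have ycl: "y \<in> carrier M" using y(1) N_sub by blast
    have "y = u k \<oplus> (\<ominus> h)" unfolding y(2) using hcl ycl by (simp add: M.a_assoc M.r_neg)
    also have "\<dots> \<in> U k"
      using sections_U[OF u(1)] additive_subgroup.a_inv_closed[OF U_subgroup subsetD[OF UL_sub_U h(1)]] by (rule U_add)
    finally have "y \<in> xspan r n M (U (k + c))" using y(1) by (rule strict)
    then obtain a where a: "a \<in> ?J \<rightarrow> U (k + c)" "y = (\<Oplus>l\<in>?J. X l (a l))" unfolding xspan_def by blast
    have "cl k (u k) = cl k y" unfolding y(2) using cl_absorb[OF h(1) ycl] hcl ycl by (simp add: M.a_comm)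
    then show ?thesis using a by blast
  qed
  \<comment> \<open>The coefficients are chosen to be 0 wherever \<open>u k\<close> is, so that the
    families \<open>b l\<close> below have finite support.\<close>
  have "\<exists>a. \<forall>k. a k \<in> ?J \<rightarrow> U (k + c) \<and> (u k = \<zero> \<longrightarrow> a k = (\<lambda>_. \<zero>))
    \<and> cl k (u k) = cl k (\<Oplus>l\<in>?J. X l (a k l))"
  proof (rule choice, rule allI)
    fix k
    show "\<exists>a. a \<in> ?J \<rightarrow> U (k + c) \<and> (u k = \<zero> \<longrightarrow> a = (\<lambda>_. \<zero>)) \<and> cl k (u k) = cl k (\<Oplus>l\<in>?J. X l (a l))"
    proof (cases "u k = \<zero>")
      case True
      have "(\<Oplus>l\<in>?J. X l \<zero>) = (\<Oplus>l\<in>?J. \<zero>)"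
        by (intro M.finsum_cong' refl) (auto intro!: smult_r_null xvar_closed)
      then show ?thesis using True U_zero by (intro exI[of _ "\<lambda>_. \<zero>"]) simp
    qed (use ex in blast)
  qed
  then obtain a where a': "\<forall>k. a k \<in> ?J \<rightarrow> U (k + c) \<and> (u k = \<zero> \<longrightarrow> a k = (\<lambda>_. \<zero>))
    \<and> cl k (u k) = cl k (\<Oplus>l\<in>?J. X l (a k l))" by (rule exE)
  have a: "a k \<in> ?J \<rightarrow> U (k + c)" "u k = \<zero> \<Longrightarrow> a k l = \<zero>"
    "cl k (u k) = cl k (\<Oplus>l\<in>?J. X l (a k l))" for k l
    using spec[OF a', of k] by auto
  \<comment> \<open>A coefficient used in degree \<open>k\<close> becomes the component of degree
    \<open>k + c\<close>, which \<open>x_l\<close> brings back to degree \<open>k\<close>.\<close>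
  define b where "b l = (\<lambda>k. a (k - c) l)" for l
  have b: "b l \<in> sections M U" if l: "l \<in> ?J" for l
  proof -
    have "b l k \<in> U k" for k using a(1)[of "k - c"] l by (auto simp: b_def)
    moreover have "{k. b l k \<noteq> \<zero>} \<subseteq> (\<lambda>k. k + c) ` {k. u k \<noteq> \<zero>}"
    proof
      fix k assume "k \<in> {k. b l k \<noteq> \<zero>}"
      then have "u (k - c) \<noteq> \<zero>" using a(2) by (auto simp: b_def)
      then show "k \<in> (\<lambda>k. k + c) ` {k. u k \<noteq> \<zero>}" by (intro image_eqI[of _ _ "k - c"]) auto
    qed
    moreover have "finite ((\<lambda>k. k + c) ` {k. u k \<noteq> \<zero>})" using u(1) by (simp add: sections_def)
    then have "finite {k. b l k \<noteq> \<zero>}" by (rule finite_subset[rotated]) fact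
    ultimately show ?thesis by (simp add: sections_def)
  qed
  have actb: "act (xvar l) (b l) = (\<lambda>k. X l (a k l))" if l: "l \<in> ?J" for l
  proof
    fix k
    have ln: "l \<in> {1..n}" using l by auto
    have "monom_weight n (V_weight w) (single l 1, 0) = c * (real (mdeg 0) - real (mdeg (single l 1)))"
      using ln by (intro monom_weight_V_const[OF w]) (auto simp: mindices_def)
    then have wt: "monom_weight n (V_weight w) (single l 1, 0) = - c" by (simp add: mdeg_0 mdeg_single)
    have d: "degs (xvar l) = {- c}" using wt by (simp add: xvar_eq)
    have cx: "comp (- c) (xvar l) = xvar l" using wt by (simp add: weyl_comp_eq_keep xvar_eq keep_single)
    have "X l (b l (k + c)) \<in> carrier M" by (rule X_closed[OF ln sections_closed[OF b[OF l]]])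
    then show "act (xvar l) (b l) k = X l (a k l)"
      unfolding act_def d by (simp add: cx M.finsum_insert b_def)
  qed
  have Xb: "xvar l \<odot>\<^bsub>G\<^esub> gr_section M U (b l) = gr_section M U (\<lambda>k. X l (a k l))"
    "(\<lambda>k. X l (a k l)) \<in> sections M U" if l: "l \<in> ?J" for l
    using gr_smult_section[OF xvar_closed b[OF l], of l] act_sections[OF xvar_closed b[OF l], of l] l
    unfolding actb[OF l] by auto
  interpret G: abelian_group G by (rule gr_abelian_group)
  have "g = gr_section M U (\<lambda>k. \<Oplus>l\<in>?J. X l (a k l))" unfolding u(2) gr_section_def a(3) ..
  also have "\<dots> = (\<Oplus>\<^bsub>G\<^esub>l\<in>?J. gr_section M U (\<lambda>k. X l (a k l)))"
    using gr_section_finsum[of ?J "\<lambda>l k. X l (a k l)"] Xb(2) by simp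
  also have "\<dots> = (\<Oplus>\<^bsub>G\<^esub>l\<in>?J. xvar l \<odot>\<^bsub>G\<^esub> gr_section M U (b l))"
    using Xb b gr_section_closed gr_smult_closed[OF xvar_closed] by (intro G.finsum_cong' refl) auto
  finally show ?thesis unfolding restr_sub_def using b gr_section_closed
    by (intro CollectI exI[of _ "\<lambda>l. gr_section M U (b l)"]) auto
qed

end

section \<open>The natural map\<close>

context additive_hom
begin

text \<open>Cosets of the kernel are fibres of \<open>\<theta>\<close>, so when the kernel is
  \<open>restr_sub\<close> this is literally the inverse of the induced isomorphism.\<close>

definition fibre :: "'b \<Rightarrow> 'a set" where
  "fibre h = {x \<in> carrier A. \<theta> x = h}"

end

text \<open>The first isomorphism theorem, read in the direction of the natural map; that this
  direction is well defined is the content of \<open>ker\<close>.\<close>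

lemma lmod_iso_fibre:
  fixes A :: "(weyl_elem, 'a) module" and B :: "(weyl_elem, 'b) module"
  assumes hom: "additive_hom A B \<theta>"
    and surj: "\<And>h. h \<in> carrier B \<Longrightarrow> \<exists>g\<in>carrier A. \<theta> g = h"
    and smult: "\<And>P g. P \<in> carrier (weyl r) \<Longrightarrow> g \<in> carrier A \<Longrightarrow> P \<odot>\<^bsub>A\<^esub> g \<in> carrier A"
      "\<And>P g. P \<in> carrier (weyl r) \<Longrightarrow> g \<in> carrier A \<Longrightarrow> \<theta> (P \<odot>\<^bsub>A\<^esub> g) = P \<odot>\<^bsub>B\<^esub> \<theta> g"
    and ker: "restr_sub r n A = {g \<in> carrier A. \<theta> g = \<zero>\<^bsub>B\<^esub>}"
  shows "additive_hom.fibre A \<theta> \<in> lmod_iso (weyl r) B (restriction r n A)"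
    and "g \<in> carrier A \<Longrightarrow> additive_hom.fibre A \<theta> (\<theta> g) = restr_class r n A g"
proof -
  interpret additive_hom A B \<theta> by (rule hom)
  have rc: "restr_class r n A g = fibre (\<theta> g)" if "g \<in> carrier A" for g
    unfolding restr_class_def ker kernel_coset[OF that] fibre_def ..
  then show "g \<in> carrier A \<Longrightarrow> fibre (\<theta> g) = restr_class r n A g" by simp
  have inj: "inj_on fibre (carrier B)"
  proof (rule inj_onI)
    fix h h' assume h: "h \<in> carrier B" "h' \<in> carrier B" "fibre h = fibre h'"
    obtain g where "g \<in> carrier A" "\<theta> g = h" using surj[OF h(1)] by blast
    then have "g \<in> fibre h'" using h(3) by (auto simp: fibre_def)
    then show "h = h'" using \<open>\<theta> g = h\<close> by (simp add: fibre_def)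
  qed
  have "fibre ` carrier B = restr_class r n A ` carrier A"
  proof (intro equalityI subsetI)
    fix C assume "C \<in> fibre ` carrier B"
    then obtain h where "h \<in> carrier B" "C = fibre h" by blast
    then show "C \<in> restr_class r n A ` carrier A" using surj[of h] rc by force
  qed (use rc \<theta>_closed in auto)
  then have bij: "bij_betw fibre (carrier B) (carrier (restriction r n A))"
    using inj by (simp add: bij_betw_def restriction_def)
  have add: "fibre (h \<oplus>\<^bsub>B\<^esub> h') = fibre h <+>\<^bsub>A\<^esub> fibre h'" if hh: "h \<in> carrier B" "h' \<in> carrier B" for h h'
  proof -
    obtain g g' where g: "g \<in> carrier A" "\<theta> g = h" "g' \<in> carrier A" "\<theta> g' = h'" using surj hh by metis
    have "additive_subgroup {x \<in> carrier A. \<theta> x = \<zero>\<^bsub>B\<^esub>} A"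
    proof (rule additive_subgroup.intro, rule subgroup.intro)
      fix x assume x: "x \<in> {x \<in> carrier A. \<theta> x = \<zero>\<^bsub>B\<^esub>}"
      then have "\<theta> (\<ominus>\<^bsub>A\<^esub> x) \<oplus>\<^bsub>B\<^esub> \<theta> x = \<zero>\<^bsub>B\<^esub>" using \<theta>_add[of "\<ominus>\<^bsub>A\<^esub> x" x] by (simp add: A.l_neg \<theta>_zero)
      then have "\<theta> (\<ominus>\<^bsub>A\<^esub> x) = \<zero>\<^bsub>B\<^esub>" using x \<theta>_closed[of "\<ominus>\<^bsub>A\<^esub> x"] by simp
      then show "inv\<^bsub>add_monoid A\<^esub> x \<in> {x \<in> carrier A. \<theta> x = \<zero>\<^bsub>B\<^esub>}" using x by (simp add: a_inv_def[symmetric])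
    qed (auto simp: \<theta>_zero \<theta>_add)
    then have "abelian_subgroup {x \<in> carrier A. \<theta> x = \<zero>\<^bsub>B\<^esub>} A" by (intro abelian_subgroupI3 A.abelian_group_axioms)
    from abelian_subgroup.a_rcos_sum[OF this g(1,3)] show ?thesis
      unfolding kernel_coset[OF g(1)] kernel_coset[OF g(3)] kernel_coset[OF A.a_closed[OF g(1,3)]] \<theta>_add[OF g(1,3)] g(2,4)
      by (simp add: fibre_def)
  qed
  have sm: "fibre (P \<odot>\<^bsub>B\<^esub> h) = (\<Union>x\<in>fibre h. restr_class r n A (P \<odot>\<^bsub>A\<^esub> x))"
    if P: "P \<in> carrier (weyl r)" and h: "h \<in> carrier B" for P h
  proof -
    have "restr_class r n A (P \<odot>\<^bsub>A\<^esub> x) = fibre (P \<odot>\<^bsub>B\<^esub> h)" if "x \<in> fibre h" for x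
      using that P smult rc by (auto simp: fibre_def)
    moreover have "fibre h \<noteq> {}" using surj[OF h] by (auto simp: fibre_def)
    ultimately show ?thesis by (metis (no_types, lifting) UN_constant_eq ex_in_conv)
  qed
  show "fibre \<in> lmod_iso (weyl r) B (restriction r n A)"
    unfolding lmod_iso_def using bij add sm by (auto simp: restriction_def)
qed

text \<open>All powers of 1 act as the identity, so the exponent of the denominator is arbitrary.
  Localizing at 1 therefore gives a copy of the module with elements
  \<open>{a} \<times> UNIV\<close>.\<close>

lemma frac_class_one:
  assumes one: "\<And>x. x \<in> carrier A \<Longrightarrow> \<one>\<^bsub>weyl r\<^esub> \<odot>\<^bsub>A\<^esub> x = x" and a: "a \<in> carrier A"
  shows "frac_class r \<one>\<^bsub>weyl r\<^esub> A a k = {a} \<times> UNIV"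
proof -
  interpret ring "weyl r" by (rule weyl_ring)
  show ?thesis unfolding frac_class_def nat_pow_one using one a by auto
qed

lemma localization_one_carrier:
  assumes "\<And>x. x \<in> carrier C \<Longrightarrow> \<one>\<^bsub>weyl r\<^esub> \<odot>\<^bsub>C\<^esub> x = x"
  shows "carrier (localization r \<one>\<^bsub>weyl r\<^esub> C) = {{a} \<times> UNIV | a. a \<in> carrier C}"
proof -
  have "carrier (localization r \<one>\<^bsub>weyl r\<^esub> C) = {frac_class r \<one>\<^bsub>weyl r\<^esub> C a k | a k. a \<in> carrier C}"
    by (simp add: localization_def)
  also have "\<dots> = {{a} \<times> UNIV | a. a \<in> carrier C}"
    using frac_class_one[OF assms] by blast
  finally show ?thesis .
qed

lemma localization_one_add:
  assumes "\<And>x. x \<in> carrier C \<Longrightarrow> \<one>\<^bsub>weyl r\<^esub> \<odot>\<^bsub>C\<^esub> x = x"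
    and "a \<in> carrier C" "b \<in> carrier C" "a \<oplus>\<^bsub>C\<^esub> b \<in> carrier C"
  shows "({a} \<times> UNIV) \<oplus>\<^bsub>localization r \<one>\<^bsub>weyl r\<^esub> C\<^esub> ({b} \<times> UNIV) = {a \<oplus>\<^bsub>C\<^esub> b} \<times> UNIV"
proof -
  interpret W: ring "weyl r" by (rule weyl_ring)
  have "frac_class r \<one>\<^bsub>weyl r\<^esub> C ((\<one>\<^bsub>weyl r\<^esub> [^]\<^bsub>weyl r\<^esub> l) \<odot>\<^bsub>C\<^esub> a \<oplus>\<^bsub>C\<^esub> (\<one>\<^bsub>weyl r\<^esub> [^]\<^bsub>weyl r\<^esub> k) \<odot>\<^bsub>C\<^esub> b) (k + l)
    = {a \<oplus>\<^bsub>C\<^esub> b} \<times> UNIV" for k l :: nat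
    unfolding W.nat_pow_one assms(1)[OF assms(2)] assms(1)[OF assms(3)] by (rule frac_class_one[OF assms(1,4)])
  then show ?thesis by (auto simp: localization_def simp del: weyl_simps)
qed

text \<open>For \<open>f = 1\<close> the relation that defines the action leaves
  \<open>Q = P\<close> as the only choice.\<close>

lemma localization_one_smult:
  assumes P: "P \<in> carrier (weyl r)"
    and C: "\<And>x. x \<in> carrier C \<Longrightarrow> \<one>\<^bsub>weyl r\<^esub> \<odot>\<^bsub>C\<^esub> x = x" "P \<odot>\<^bsub>C\<^esub> a \<in> carrier C"
  shows "P \<odot>\<^bsub>localization r \<one>\<^bsub>weyl r\<^esub> C\<^esub> ({a} \<times> UNIV) = {P \<odot>\<^bsub>C\<^esub> a} \<times> UNIV"
proof -
  interpret W: ring "weyl r" by (rule weyl_ring)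
  have "{(Q, l :: nat). Q \<in> carrier (weyl r) \<and> (\<one>\<^bsub>weyl r\<^esub> [^]\<^bsub>weyl r\<^esub> l) \<otimes>\<^bsub>weyl r\<^esub> P = Q \<otimes>\<^bsub>weyl r\<^esub> (\<one>\<^bsub>weyl r\<^esub> [^]\<^bsub>weyl r\<^esub> k)}
    = {P} \<times> UNIV" for k :: nat
    unfolding W.nat_pow_one W.l_one[OF P] using P W.r_one by (auto simp del: weyl_simps)
  moreover have "frac_class r \<one>\<^bsub>weyl r\<^esub> C (P \<odot>\<^bsub>C\<^esub> a) l = {P \<odot>\<^bsub>C\<^esub> a} \<times> UNIV" for l
    by (rule frac_class_one[OF C])
  ultimately show ?thesis by (auto simp: localization_def simp del: weyl_simps)
qed

lemma lmod_iso_localization_one: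
  fixes A :: "(weyl_elem, 'a) module" and B :: "(weyl_elem, 'b) module"
  assumes \<psi>: "\<psi> \<in> lmod_iso (weyl r) A B"
    and one: "\<And>x. x \<in> carrier A \<Longrightarrow> \<one>\<^bsub>weyl r\<^esub> \<odot>\<^bsub>A\<^esub> x = x"
    and add: "\<And>x y. x \<in> carrier A \<Longrightarrow> y \<in> carrier A \<Longrightarrow> x \<oplus>\<^bsub>A\<^esub> y \<in> carrier A"
    and smult: "\<And>P x. P \<in> carrier (weyl r) \<Longrightarrow> x \<in> carrier A \<Longrightarrow> P \<odot>\<^bsub>A\<^esub> x \<in> carrier A"
  shows "\<exists>\<phi>\<in>lmod_iso (weyl r) (localization r \<one>\<^bsub>weyl r\<^esub> A) (localization r \<one>\<^bsub>weyl r\<^esub> B).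
    \<forall>a\<in>carrier A. \<phi> (frac_class r \<one>\<^bsub>weyl r\<^esub> A a 0) = frac_class r \<one>\<^bsub>weyl r\<^esub> B (\<psi> a) 0"
proof -
  interpret W: ring "weyl r" by (rule weyl_ring)
  let ?f = "\<one>\<^bsub>weyl r\<^esub>"
  have \<psi>': "bij_betw \<psi> (carrier A) (carrier B)"
    "\<And>x y. x \<in> carrier A \<Longrightarrow> y \<in> carrier A \<Longrightarrow> \<psi> (x \<oplus>\<^bsub>A\<^esub> y) = \<psi> x \<oplus>\<^bsub>B\<^esub> \<psi> y"
    "\<And>P x. P \<in> carrier (weyl r) \<Longrightarrow> x \<in> carrier A \<Longrightarrow> \<psi> (P \<odot>\<^bsub>A\<^esub> x) = P \<odot>\<^bsub>B\<^esub> \<psi> x"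
    using \<psi> by (auto simp: lmod_iso_def)
  have \<psi>c: "\<psi> x \<in> carrier B" if "x \<in> carrier A" for x using \<psi>'(1) that by (auto simp: bij_betw_def)
  have \<psi>s: "\<exists>x\<in>carrier A. y = \<psi> x" if "y \<in> carrier B" for y using \<psi>'(1) that by (auto simp: bij_betw_def)
  \<comment> \<open>The laws of \<open>B\<close> are carried over from \<open>A\<close> along
    \<open>\<psi>\<close>, which spares a separate proof that the restriction of the graded module
    satisfies them.\<close>
  have oneB: "?f \<odot>\<^bsub>B\<^esub> y = y" if y: "y \<in> carrier B" for y
    using \<psi>s[OF y] one \<psi>'(3)[OF W.one_closed] by metis
  have addB: "x \<oplus>\<^bsub>B\<^esub> y \<in> carrier B" if xy: "x \<in> carrier B" "y \<in> carrier B" for x y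
    using \<psi>s[OF xy(1)] \<psi>s[OF xy(2)] \<psi>'(2) \<psi>c add by metis
  have smultB: "P \<odot>\<^bsub>B\<^esub> y \<in> carrier B" if Py: "P \<in> carrier (weyl r)" "y \<in> carrier B" for P y
    using \<psi>s[OF Py(2)] \<psi>'(3)[OF Py(1)] \<psi>c smult[OF Py(1)] by metis
  note addl = localization_one_add and smultl = localization_one_smult
  have carr: "carrier (localization r ?f A) = {{a} \<times> (UNIV :: nat set) | a. a \<in> carrier A}"
    "carrier (localization r ?f B) = {{a} \<times> (UNIV :: nat set) | a. a \<in> carrier B}"
    by (rule localization_one_carrier, erule one, rule localization_one_carrier, erule oneB)
  define \<phi> :: "('a \<times> nat) set \<Rightarrow> ('b \<times> nat) set" where "\<phi> C = map_prod \<psi> id ` C" for C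
  have \<phi>: "\<phi> ({a} \<times> UNIV) = {\<psi> a} \<times> UNIV" for a by (force simp: \<phi>_def)
  have "\<phi> \<in> lmod_iso (weyl r) (localization r ?f A) (localization r ?f B)"
    unfolding lmod_iso_def carr
  proof (intro CollectI conjI ballI)
    show "bij_betw \<phi> {{a} \<times> (UNIV :: nat set) | a. a \<in> carrier A} {{a} \<times> (UNIV :: nat set) | a. a \<in> carrier B}"
      unfolding bij_betw_def
    proof
      show "inj_on \<phi> {{a} \<times> (UNIV :: nat set) | a. a \<in> carrier A}"
        using \<psi>'(1) by (auto simp: inj_on_def bij_betw_def \<phi> times_eq_iff)
      show "\<phi> ` {{a} \<times> (UNIV :: nat set) | a. a \<in> carrier A} = {{a} \<times> (UNIV :: nat set) | a. a \<in> carrier B}"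
      proof (intro equalityI subsetI)
        fix D assume "D \<in> {{a} \<times> (UNIV :: nat set) | a. a \<in> carrier B}"
        then obtain x where "x \<in> carrier A" "D = \<phi> ({x} \<times> UNIV)" using \<psi>s \<phi> by blast
        then show "D \<in> \<phi> ` {{a} \<times> (UNIV :: nat set) | a. a \<in> carrier A}" by blast
      qed (use \<psi>c \<phi> in blast)
    qed
  next
    fix C D assume "C \<in> {{a} \<times> (UNIV :: nat set) | a. a \<in> carrier A}" "D \<in> {{a} \<times> (UNIV :: nat set) | a. a \<in> carrier A}"
    then obtain a b where ab: "a \<in> carrier A" "C = {a} \<times> UNIV" "b \<in> carrier A" "D = {b} \<times> UNIV" by blast
    have "C \<oplus>\<^bsub>localization r ?f A\<^esub> D = {a \<oplus>\<^bsub>A\<^esub> b} \<times> UNIV"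
      unfolding ab(2,4) by (rule addl) (use one ab(1,3) add in auto)
    moreover have "\<phi> C \<oplus>\<^bsub>localization r ?f B\<^esub> \<phi> D = {\<psi> a \<oplus>\<^bsub>B\<^esub> \<psi> b} \<times> UNIV"
      unfolding ab(2,4) \<phi> by (rule addl) (use oneB ab(1,3) \<psi>c addB in auto)
    ultimately show "\<phi> (C \<oplus>\<^bsub>localization r ?f A\<^esub> D) = \<phi> C \<oplus>\<^bsub>localization r ?f B\<^esub> \<phi> D"
      by (simp only: \<phi> \<psi>'(2)[OF ab(1,3)])
  next
    fix P C assume P: "P \<in> carrier (weyl r)" and "C \<in> {{a} \<times> (UNIV :: nat set) | a. a \<in> carrier A}"
    then obtain a where a: "a \<in> carrier A" "C = {a} \<times> UNIV" by blast
    have "P \<odot>\<^bsub>localization r ?f A\<^esub> C = {P \<odot>\<^bsub>A\<^esub> a} \<times> UNIV"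
      unfolding a(2) by (rule smultl[OF P]) (use one smult[OF P a(1)] in auto)
    moreover have "P \<odot>\<^bsub>localization r ?f B\<^esub> \<phi> C = {P \<odot>\<^bsub>B\<^esub> \<psi> a} \<times> UNIV"
      unfolding a(2) \<phi> by (rule smultl[OF P]) (use oneB smultB[OF P \<psi>c[OF a(1)]] in auto)
    ultimately show "\<phi> (P \<odot>\<^bsub>localization r ?f A\<^esub> C) = P \<odot>\<^bsub>localization r ?f B\<^esub> \<phi> C"
      by (simp only: \<phi> \<psi>'(3)[OF P a(1)])
  qed
  moreover have "\<phi> (frac_class r ?f A a 0) = frac_class r ?f B (\<psi> a) 0" if a: "a \<in> carrier A" for a
  proof -
    have "frac_class r ?f A a 0 = {a} \<times> UNIV" by (rule frac_class_one[OF _ a]) (erule one)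
    moreover have "frac_class r ?f B (\<psi> a) 0 = {\<psi> a} \<times> UNIV" by (rule frac_class_one[OF _ \<psi>c[OF a]]) (erule oneB)
    ultimately show ?thesis by (simp only: \<phi>)
  qed
  ultimately show ?thesis by (intro bexI[of _ \<phi>] ballI)
qed

theorem theorem5p6:
  fixes n r :: nat
    and w :: "nat \<Rightarrow> real"
    and M :: "(weyl_elem, 'm) module"
    and U :: "real \<Rightarrow> 'm set"
  assumes "r \<le> n"
    and "\<forall>i\<in>{1..n}. w i = w 1 \<and> w i > 0"
    and "left_module (weyl n) M"
    and "lmod_fin_gen (weyl n) M"
    and "good_filtration UNIV n (V_weight w) M U"
    and "noncharacteristic_near_origin r n M"
  shows "natural_map_iso_near_origin r n w M U"
proof -
  \<comment> \<open>For \<open>n = 0\<close> the hypothesis says nothing about \<open>w 1\<close>,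
    and any positive number can serve as \<open>c\<close>.\<close>
  define c where "c = (if n = 0 then 1 else w 1)"
  have c: "0 < c" using bspec[OF assms(2), of 1] by (simp add: c_def)
  have w: "w i = c" if "i \<in> {1..n}" for i
  proof -
    have "w i = w 1" using bspec[OF assms(2) that] by (rule conjunct1)
    then show ?thesis using that by (simp add: c_def)
  qed
  obtain s m \<kappa> where gen: "lmod_generates (weyl n) M s m"
    and Ueq': "\<forall>k. U k = {\<Oplus>\<^bsub>M\<^esub>l\<in>{..<s}. P l \<odot>\<^bsub>M\<^esub> m l | P. \<forall>l<s. P l \<in> weyl_filt n (V_weight w) (k - \<kappa> l)}"
    using assms(5) unfolding good_filtration_def by (elim exE conjE)
  note Ueq = spec[OF Ueq']
  interpret good_V_filtered n M w U c s m \<kappa>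
  proof (intro good_V_filtered.intro good_V_filtered_axioms.intro weyl_module.intro assms(3) c w Ueq)
    show "m l \<in> carrier M" if "l < s" for l using gen that by (auto simp: lmod_generates_def)
  qed
  interpret restricted_V_filtered n M w U r
    by (intro restricted_V_filtered.intro restricted_V_filtered_axioms.intro V_filtered_axioms assms(1))
  have ex: "carrier M = (\<Union>k. U k)"
    using good_filtration_exhaust[OF gen Ueq] U_sub by blast
  have strict: "x \<in> xspan r n M (U (k + c))" if "x \<in> U k" "x \<in> N" for x k
    by (rule xspan_strict[OF ex assms(1) noncharacteristic_operators[OF assms(4,6) ex assms(1)] order_refl assms(1) that(1)
          that(2)[unfolded restr_sub_eq_xspan]])
  have ker: "restr_sub r n G = {g \<in> carrier G. \<theta> g = \<zero>\<^bsub>MR.G\<^esub>}"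
    using restr_sub_gr_in_kernel kernel_in_restr_sub_gr[OF strict w] by blast
  have Psub: "P \<in> carrier (weyl n)" if "P \<in> carrier (weyl r)" for P using that weyl_carrier_mono[OF assms(1)] by blast
  have iso: "additive_hom.fibre G \<theta> \<in> lmod_iso (weyl r) MR.G (restriction r n G)"
    by (rule lmod_iso_fibre(1)[OF \<theta>_hom \<theta>_surj gr_smult_closed[OF Psub] \<theta>_smult ker])
  have fibre: "additive_hom.fibre G \<theta> (\<theta> g) = restr_class r n G g" if "g \<in> carrier G" for g
    by (rule lmod_iso_fibre(2)[OF \<theta>_hom \<theta>_surj gr_smult_closed[OF Psub] \<theta>_smult ker that])
  interpret H: abelian_group MR.G by (rule MR.gr_abelian_group)
  have "\<exists>\<phi>\<in>lmod_iso (weyl r) (localization r \<one>\<^bsub>weyl r\<^esub> MR.G) (localization r \<one>\<^bsub>weyl r\<^esub> (restriction r n G)).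
    \<forall>a\<in>carrier MR.G. \<phi> (frac_class r \<one>\<^bsub>weyl r\<^esub> MR.G a 0)
      = frac_class r \<one>\<^bsub>weyl r\<^esub> (restriction r n G) (additive_hom.fibre G \<theta> a) 0"
    by (rule lmod_iso_localization_one[OF iso MR.gr_smult_one H.a_closed MR.gr_smult_closed])
  then obtain \<phi> where \<phi>: "\<phi> \<in> lmod_iso (weyl r) (localization r \<one>\<^bsub>weyl r\<^esub> MR.G) (localization r \<one>\<^bsub>weyl r\<^esub> (restriction r n G))"
    "\<And>a. a \<in> carrier MR.G \<Longrightarrow> \<phi> (frac_class r \<one>\<^bsub>weyl r\<^esub> MR.G a 0)
      = frac_class r \<one>\<^bsub>weyl r\<^esub> (restriction r n G) (additive_hom.fibre G \<theta> a) 0" by blast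
  have "\<phi> (frac_class r \<one>\<^bsub>weyl r\<^esub> (gr_restriction r n w M U) (gr_restriction_class r n M U k u) 0)
    = frac_class r \<one>\<^bsub>weyl r\<^esub> (restriction_gr r n w M U) (restriction_gr_class r n w M U k u) 0" if u: "u \<in> U k" for u k
  proof -
    have g: "gr_class M U k u \<in> carrier G" by (rule gr_class_closed[of U u k, OF U_sub U_zero u])
    have ucl: "u \<in> carrier M" using u U_sub by blast
    have "gr_restriction_class r n M U k u = \<theta> (gr_class M U k u)"
      unfolding gr_restriction_class_def using \<theta>_gr_class[OF ucl] by simp
    moreover have "\<theta> (gr_class M U k u) \<in> carrier MR.G" using additive_hom.\<theta>_closed[OF \<theta>_hom g] .
    ultimately show ?thesis
      using \<phi>(2) fibre[OF g] by (simp add: gr_restriction_def restriction_gr_def restriction_gr_class_def)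
  qed
  moreover have "\<one>\<^bsub>weyl r\<^esub> \<in> polys r" by (simp add: polys_def mindices_def mem_Times_iff)
  moreover have "poly_eval \<one>\<^bsub>weyl r\<^esub> (\<lambda>_. 0) \<noteq> 0" by (simp add: poly_eval_def symbol_eval_def)
  ultimately show ?thesis
    unfolding natural_map_iso_near_origin_def
    using \<phi>(1) by (intro bexI[of _ "\<one>\<^bsub>weyl r\<^esub>"] conjI bexI[of _ \<phi>] allI ballI) (simp_all add: gr_restriction_def restriction_gr_def)
qed

end
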